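(* Let $n,n'\ge 2$ and $k,k'\ge 1$ be integers and let $\alpha,\alpha'\in(0,1)$ be irrational. Let $g\in G_{\alpha,n}$ be $k$-admissible and $g'\in G_{\alpha',n'}$ be $k'$-admissible, and let $f\in \mathrm{Homeo}_+(\mathbb S^1)_{k,g}$ and $f'\in\mathrm{Homeo}_+(\mathbb S^1)_{k',g'}$. Then $G_{\alpha,n,k,g,f}$ is topologically conjugate to $G_{\alpha',n',k',g',f'}$ if and only if all of the following hold: (i) $n=n'$ and $k=k'$; (ii) $\alpha$ is equivalent to $\alpha'$, i.e. there exist $m_1,n_1,m_2,n_2\in\mathbb Z$ with $|m_1n_2-n_1m_2|=1$ such that $\alpha'=\frac{m_1+n_1\alpha}{m_2+n_2\alpha}$; (iii) $g$ and $\psi_{\alpha,\alpha'}g'\psi_{\alpha,\alpha'}^{-1}$ are in the same orbit of the affine action on $G_{\alpha,n}$ by $N_{\mathrm{Homeo}_+(\mathbb R)}(G_{\alpha,n})\ltimes G_{\alpha,n}^k$, i.e. there exist $\varphi\in N_{\mathrm{Homeo}_+(\mathbb R)}(G_{\alpha,n})$ and $h\in G_{\alpha,n}$ such that $\psi_{\alpha,\alpha'}g'\psi_{\alpha,\alpha'}^{-1}=\varphi g h^k\varphi^{-1}$. Here, when (i) and (ii) hold, $\psi_{\alpha,\alpha'}$ is a fixed element of $\mathrm{Homeo}_+(\mathbb R)$ with $G_{\alpha,n}=\psi_{\alpha,\alpha'}G_{\alpha',n}\psi_{\alpha,\alpha'}^{-1}$.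
   Context: $\mathbb S^1$ is the unit circle in $\mathbb C$. $\mathrm{Homeo}_+(X)$ denotes the group of orientation preserving homeomorphisms of $X$. Two subgroups $G,H$ of $\mathrm{Homeo}_+(\mathbb S^1)$ are topologically conjugate if $\phi G\phi^{-1}=H$ for some $\phi\in \mathrm{Homeo}_+(\mathbb S^1)$. The groups $G_{\alpha,n}$. For $a\in\mathbb R$ let $L_a(x)=x+a$ on $\mathbb R$. Fix a homeomorphism $\hbar$ from $\mathbb R$ to $(0,1)$, for example $\hbar(x)=\frac1\pi(\frac\pi2+\arctan x)$. For $\sigma\in \mathrm{Homeo}_+(\mathbb R)$ define $\hbar(\sigma)\in\mathrm{Homeo}_+(\mathbb R)$ by $\hbar(\sigma)(x)=\hbar\sigma\hbar^{-1}(x-i)+i$ for $x\in(i,i+1)$, $i\in\mathbb Z$, and $\hbar(\sigma)(x)=x$ for $x\in\mathbb Z$. For irrational $\alpha\in(0,1)$ put $G_{\alpha,2}=\langle L_1,L_\alpha\rangle$ and, inductively, let $G_{\alpha,n+1}$ be the group generated by $\{\hbar(\sigma):\sigma\in G_{\alpha,n}\}\cup\{L_1\}$. It is known that $G_{\alpha,n}$ is isomorphic to $\mathbb Z^n$, and that $G_{\alpha,n}$ and $G_{\alpha',n}$ are conjugate in $\mathrm{Homeo}_+(\mathbb R)$ if and only if $\alpha$ and $\alpha'$ are equivalent in the sense of (ii), so that $\psi_{\alpha,\alpha'}$ exists. The groups $G_{\alpha,n,k,g,f}$. Let $n\ge2$, $k\ge1$, $\alpha\in(0,1)$ irrational. Put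 $G_{\alpha,n}^s=\{g^s:g\in G_{\alpha,n}\}$ for integers $s\ge 1$. Call $g\in G_{\alpha,n}$ $k$-admissible if $g\notin\bigcup_{s\ge1,\ \gcd(k,s)\ne1}G_{\alpha,n}^s$. Put $x_j=e^{2\pi \mathrm i j/k}$ for $j=1,\dots,k$ and $x_{k+1}=x_1$; $(x_i,x_{i+1})$ is the open arc from $x_i$ to $x_{i+1}$ anticlockwise (for $k=1$, the circle minus $x_1$). Fix an orientation preserving homeomorphism $\phi:\mathbb R\to(x_1,x_2)$ and write $\tilde\sigma=\phi\sigma\phi^{-1}$ for $\sigma\in\mathrm{Homeo}_+(\mathbb R)$. For $k$-admissible $g$, $\mathrm{Homeo}_+(\mathbb S^1)_{k,g}$ is the set of $f\in\mathrm{Homeo}_+(\mathbb S^1)$ with $f(x_i)=x_{i+1}$ for $i=1,\dots,k$ and $f^k|_{(x_1,x_2)}=\tilde g$. For such $f$ and $\sigma\in\mathrm{Homeo}_+(\mathbb R)$, let $\overline\sigma^f\in\mathrm{Homeo}_+(\mathbb S^1)$ be given by $\overline\sigma^f(x)=f^{i-1}\tilde\sigma f^{-(i-1)}(x)$ for $x\in(x_i,x_{i+1})$, $i=1,\dots,k$, and $\overline\sigma^f(x_i)=x_i$. Then $G_{\alpha,n,k,g,f}$ is the subgroup of $\mathrm{Homeo}_+(\mathbb S^1)$ generated by $\{\overline\sigma^f:\sigma\in G_{\alpha,n}\}\cup\{f\}$. Normalizer and affine action. $N_{\mathrm{Homeo}_+(\mathbb R)}(G_{\alpha,n})=\{\varphi\in\mathrm{Homeo}_+(\mathbb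 R):\varphi G_{\alpha,n}\varphi^{-1}=G_{\alpha,n}\}$. The semidirect product $N_{\mathrm{Homeo}_+(\mathbb R)}(G_{\alpha,n})\ltimes G_{\alpha,n}^k$ acts on $G_{\alpha,n}$ by $(\varphi,q).g=\varphi g\varphi^{-1}q$. *)

theory Defs
  imports "HOL-Analysis.Analysis" "HOL-Algebra.Algebra"
begin

section \<open>Groups of orientation preserving homeomorphisms\<close>

definition HomeoR :: "(real \<Rightarrow> real) monoid"
  where "HomeoR = BijGroup UNIV
    \<lparr>carrier := {f. (\<exists>f'. homeomorphism UNIV UNIV f f') \<and> strict_mono f}\<rparr>"

text \<open>
  The circle is parametrised by \<open>t \<mapsto> exp (2 \<pi> \<i> t)\<close>. A self-homeomorphism of the circle
  preserves orientation iff it has an increasing continuous lift along this covering.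
  As always for \<^const>\<open>BijGroup\<close>, group elements are \<^const>\<open>undefined\<close> outside the circle.
\<close>

definition circ :: "real \<Rightarrow> complex"
  where "circ t = cis (2 * pi * t)"

definition HomeoS1 :: "(complex \<Rightarrow> complex) monoid"
  where "HomeoS1 = BijGroup (sphere 0 1)
    \<lparr>carrier := {f \<in> extensional (sphere 0 1).
       (\<exists>f'. homeomorphism (sphere 0 1) (sphere 0 1) f f') \<and>
       (\<exists>F :: real \<Rightarrow> real. continuous_on UNIV F \<and> strict_mono F \<and> (\<forall>t. f (circ t) = circ (F t)))}\<rparr>"

definition topologically_conjugate :: "(complex \<Rightarrow> complex) set \<Rightarrow> (complex \<Rightarrow> complex) set \<Rightarrow> bool"
  where "topologically_conjugate G H \<longleftrightarrow>
    (\<exists>\<phi> \<in> carrier HomeoS1. \<phi> <#\<^bsub>HomeoS1\<^esub> G #>\<^bsub>HomeoS1\<^esub> inv\<^bsub>HomeoS1\<^esub> \<phi> = H)"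


section \<open>The groups acting on the line\<close>

definition translation :: "real \<Rightarrow> real \<Rightarrow> real"
  where "translation a x = x + a"

text \<open>\<open>\<eta>\<close> is the fixed homeomorphism from the line to the unit interval.\<close>

definition interval_lift :: "(real \<Rightarrow> real) \<Rightarrow> (real \<Rightarrow> real) \<Rightarrow> real \<Rightarrow> real"
  where "interval_lift \<eta> \<sigma> x =
    (if x \<in> \<int> then x
     else \<eta> (\<sigma> (inv_into UNIV \<eta> (x - of_int \<lfloor>x\<rfloor>))) + of_int \<lfloor>x\<rfloor>)"

text \<open>The recursion starts at \<open>n = 2\<close>; smaller \<open>n\<close> are irrelevant.\<close>

definition line_group :: "(real \<Rightarrow> real) \<Rightarrow> real \<Rightarrow> nat \<Rightarrow> (real \<Rightarrow> real) set"
  where "line_group \<eta> \<alpha> n =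
    ((\<lambda>G. generate HomeoR (interval_lift \<eta> ` G \<union> {translation 1})) ^^ (n - 2))
      (generate HomeoR {translation 1, translation \<alpha>})"

definition powers :: "(real \<Rightarrow> real) set \<Rightarrow> nat \<Rightarrow> (real \<Rightarrow> real) set"
  where "powers G s = (\<lambda>g. g [^]\<^bsub>HomeoR\<^esub> s) ` G"

definition admissible :: "nat \<Rightarrow> (real \<Rightarrow> real) set \<Rightarrow> (real \<Rightarrow> real) \<Rightarrow> bool"
  where "admissible k G g \<longleftrightarrow>
    g \<in> G \<and> g \<notin> (\<Union>s \<in> {s. s \<ge> 1 \<and> gcd k s \<noteq> 1}. powers G s)"

definition equivalent_irrationals :: "real \<Rightarrow> real \<Rightarrow> bool"
  where "equivalent_irrationals \<alpha> \<alpha>' \<longleftrightarrow>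
    (\<exists>m\<^sub>1 n\<^sub>1 m\<^sub>2 n\<^sub>2 :: int. \<bar>m\<^sub>1 * n\<^sub>2 - n\<^sub>1 * m\<^sub>2\<bar> = 1 \<and>
       \<alpha>' = (of_int m\<^sub>1 + of_int n\<^sub>1 * \<alpha>) / (of_int m\<^sub>2 + of_int n\<^sub>2 * \<alpha>))"


section \<open>The groups acting on the circle\<close>

definition vertex :: "nat \<Rightarrow> nat \<Rightarrow> complex"
  where "vertex k j = circ (real j / real k)"

text \<open>The open arc from \<open>vertex k i\<close> anticlockwise to \<open>vertex k (i + 1)\<close>;
  for \<open>k = 1\<close> it is the circle minus one point.\<close>

definition arc_between :: "nat \<Rightarrow> nat \<Rightarrow> complex set"
  where "arc_between k i = circ ` {real i / real k <..< real (i + 1) / real k}"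

text \<open>Orientation preserving homeomorphisms from the line onto \<open>arc_between k 1\<close>.\<close>

definition arc_chart :: "nat \<Rightarrow> (real \<Rightarrow> complex) \<Rightarrow> bool"
  where "arc_chart k \<phi> \<longleftrightarrow>
    (\<exists>\<phi>'. homeomorphism UNIV (arc_between k 1) \<phi> \<phi>') \<and>
    (\<exists>\<theta> :: real \<Rightarrow> real. continuous_on UNIV \<theta> \<and> strict_mono \<theta> \<and> (\<forall>t. \<phi> t = circ (\<theta> t)))"

definition transport :: "(real \<Rightarrow> complex) \<Rightarrow> (real \<Rightarrow> real) \<Rightarrow> complex \<Rightarrow> complex"
  where "transport \<phi> \<sigma> = \<phi> \<circ> \<sigma> \<circ> inv_into UNIV \<phi>"

definition circle_roots :: "(real \<Rightarrow> complex) \<Rightarrow> nat \<Rightarrow> (real \<Rightarrow> real) \<Rightarrow> (complex \<Rightarrow> complex) set"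
  where "circle_roots \<phi> k g = {f \<in> carrier HomeoS1.
    (\<forall>i \<in> {1..k}. f (vertex k i) = vertex k (i + 1)) \<and>
    (\<forall>x \<in> arc_between k 1. (f [^]\<^bsub>HomeoS1\<^esub> k) x = transport \<phi> g x)}"

definition circle_extension ::
    "(real \<Rightarrow> complex) \<Rightarrow> nat \<Rightarrow> (complex \<Rightarrow> complex) \<Rightarrow> (real \<Rightarrow> real) \<Rightarrow> complex \<Rightarrow> complex"
  where "circle_extension \<phi> k f \<sigma> = (\<lambda>x \<in> sphere 0 1.
    if \<exists>i \<in> {1..k}. x \<in> arc_between k i
    then let i = (THE i. i \<in> {1..k} \<and> x \<in> arc_between k i);
             F = f [^]\<^bsub>HomeoS1\<^esub> (i - 1)
         in F (transport \<phi> \<sigma> ((inv\<^bsub>HomeoS1\<^esub> F) x))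
    else x)"

text \<open>The element \<open>g\<close> enters only through \<open>f \<in> circle_roots \<phi> k g\<close>.\<close>

definition circle_group ::
    "(real \<Rightarrow> real) \<Rightarrow> (real \<Rightarrow> complex) \<Rightarrow> real \<Rightarrow> nat \<Rightarrow> nat \<Rightarrow> (complex \<Rightarrow> complex) \<Rightarrow> (complex \<Rightarrow> complex) set"
  where "circle_group \<eta> \<phi> \<alpha> n k f =
    generate HomeoS1 (circle_extension \<phi> k f ` line_group \<eta> \<alpha> n \<union> {f})"


section \<open>The affine action\<close>

text \<open>The semidirect product of the normalizer of \<open>G\<close> with the group of \<open>k\<close>-th powers in \<open>G\<close>;
  its multiplication is the one that makes \<open>affine_act\<close> a left action when \<open>G\<close> is abelian.\<close>

definition affine_group ::
    "(real \<Rightarrow> real) set \<Rightarrow> nat \<Rightarrow> ((real \<Rightarrow> real) \<times> (real \<Rightarrow> real)) monoid"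
  where "affine_group G k =
    \<lparr>carrier = normalizer HomeoR G \<times> powers G k,
     mult = \<lambda>(\<phi>, q) (\<phi>', q').
       (\<phi> \<otimes>\<^bsub>HomeoR\<^esub> \<phi>', \<phi> \<otimes>\<^bsub>HomeoR\<^esub> q' \<otimes>\<^bsub>HomeoR\<^esub> inv\<^bsub>HomeoR\<^esub> \<phi> \<otimes>\<^bsub>HomeoR\<^esub> q),
     one = (\<one>\<^bsub>HomeoR\<^esub>, \<one>\<^bsub>HomeoR\<^esub>)\<rparr>"

fun affine_act :: "(real \<Rightarrow> real) \<times> (real \<Rightarrow> real) \<Rightarrow> (real \<Rightarrow> real) \<Rightarrow> real \<Rightarrow> real"
  where "affine_act (\<phi>, q) g = \<phi> \<otimes>\<^bsub>HomeoR\<^esub> g \<otimes>\<^bsub>HomeoR\<^esub> inv\<^bsub>HomeoR\<^esub> \<phi> \<otimes>\<^bsub>HomeoR\<^esub> q"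


section \<open>Explicit description of the affine orbits\<close>

lemma group_HomeoR: "group HomeoR"
proof -
  let ?C = "{f :: real \<Rightarrow> real. (\<exists>f'. homeomorphism UNIV UNIV f f') \<and> strict_mono f}"
  have bij: "f \<in> Bij UNIV" if "f \<in> ?C" for f
    using that by (auto simp: Bij_def bij_betw_def homeomorphism_def strict_mono_imp_inj_on)
  have "subgroup ?C (BijGroup UNIV)"
  proof
    show "?C \<subseteq> carrier (BijGroup UNIV)"
      using bij by (auto simp: BijGroup_def)
    show "f \<otimes>\<^bsub>BijGroup UNIV\<^esub> g \<in> ?C" if "f \<in> ?C" "g \<in> ?C" for f g
    proof -
      have "f \<otimes>\<^bsub>BijGroup UNIV\<^esub> g = f \<circ> g"
        using bij[OF that(1)] bij[OF that(2)] by (auto simp: BijGroup_def compose_def)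
      then show ?thesis
        using that homeomorphism_compose[of UNIV UNIV g _ UNIV f]
        by (auto simp: strict_mono_def)
    qed
    show "\<one>\<^bsub>BijGroup UNIV\<^esub> \<in> ?C"
      using homeomorphism_ident[of UNIV] by (auto simp: BijGroup_def strict_mono_def restrict_def)
    show "inv\<^bsub>BijGroup UNIV\<^esub> f \<in> ?C" if f: "f \<in> ?C" for f
    proof -
      obtain f' where f': "homeomorphism UNIV UNIV f f'" and m: "strict_mono f"
        using f by auto
      have ff: "f (f' y) = y" "f' (f y) = y" for y
        using f' by (auto simp: homeomorphism_def)
      have "f y = z \<longleftrightarrow> y = f' z" for y z using ff by metis
      then have "inv\<^bsub>BijGroup UNIV\<^esub> f = f'"
        by (auto simp: inv_BijGroup[OF bij[OF f]] inv_into_def)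
      moreover have "strict_mono f'"
        using m ff by (metis strict_mono_def strict_mono_less)
      ultimately show ?thesis
        using homeomorphism_symD[OF f'] by auto
    qed
  qed
  from subgroup.subgroup_is_group[OF this group_BijGroup] show ?thesis
    by (simp add: HomeoR_def)
qed

lemma HomeoR_I:
  assumes "strict_mono f" "surj f" shows "f \<in> carrier HomeoR"
proof -
  have inj: "inj f" using assms(1) by (rule strict_mono_imp_inj_on)
  have "mono (inv_into UNIV f)"
    using assms by (intro monoI) (metis strict_mono_less_eq surj_f_inv_f)
  then have "continuous_on UNIV (inv_into UNIV f)"
    using inj by (intro continuous_onI_mono) (auto simp: inj_imp_surj_inv monoD)
  moreover have "continuous_on UNIV f"
    using assms by (intro continuous_onI_mono) (auto simp: strict_mono_less_eq)
  ultimately have "homeomorphism UNIV UNIV f (inv_into UNIV f)"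
    using inj assms(2) by (simp add: homeomorphism_def inj_imp_surj_inv surj_f_inv_f)
  then show ?thesis using assms by (auto simp: HomeoR_def)
qed

lemma interval_lift_closed:
  assumes \<eta>: "homeomorphism UNIV {0<..<1} \<eta> \<eta>'" and \<sigma>: "\<sigma> \<in> carrier HomeoR"
  shows "interval_lift \<eta> \<sigma> \<in> carrier HomeoR"
proof -
  define \<tau> where "\<tau> = (\<lambda>y. \<eta> (\<sigma> (inv_into UNIV \<eta> y)))"
  have inj: "inj \<eta>" using \<eta> by (metis UNIV_I homeomorphism_apply1 injI)
  have inv: "inv_into UNIV \<eta> y = \<eta>' y" if "y \<in> {0<..<1}" for y
    using that inj \<eta> by (metis homeomorphism_apply2 inv_f_f)
  have \<sigma>m: "strict_mono \<sigma>" and "surj \<sigma>"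
    using \<sigma> by (auto simp: HomeoR_def homeomorphism_def)
  have mono: "(\<forall>x y. x < y \<longrightarrow> \<eta> x < \<eta> y) \<or> (\<forall>x y. x < y \<longrightarrow> \<eta> x > \<eta> y)"
    using injective_eq_monotone_map[of UNIV \<eta>] \<eta> inj
    by (auto simp: homeomorphism_def monotone_on_def)
  have \<tau>: "\<tau> ` {0<..<1} = {0<..<1}"
  proof -
    have "\<eta>' ` {0<..<1} = UNIV" "\<eta> ` UNIV = {0<..<1}" using \<eta> by (auto simp: homeomorphism_def)
    moreover have "\<tau> ` {0<..<1} = \<eta> ` \<sigma> ` \<eta>' ` {0<..<1}"
      unfolding \<tau>_def image_image using inv by (intro image_cong) auto
    ultimately show ?thesis using \<open>surj \<sigma>\<close> by simp
  qed
  have \<tau>m: "\<tau> x < \<tau> y" if xy: "0 < x" "x < y" "y < 1" for x y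
  proof -
    have e: "\<eta> (\<eta>' x) = x" "\<eta> (\<eta>' y) = y" 
      using xy \<eta> by (auto simp: homeomorphism_def)
    have "\<tau> x = \<eta> (\<sigma> (\<eta>' x))" "\<tau> y = \<eta> (\<sigma> (\<eta>' y))"
      using xy inv by (auto simp: \<tau>_def)
    with mono e xy \<sigma>m show ?thesis
      by (smt (verit) strict_mono_less)
  qed
  define L where "L = interval_lift \<eta> \<sigma>"
  have L: "L x = (if x \<in> \<int> then x else \<tau> (frac x) + of_int \<lfloor>x\<rfloor>)" for x
    by (simp add: L_def interval_lift_def \<tau>_def frac_def)
  have rng: "0 < \<tau> (frac x)" "\<tau> (frac x) < 1" if "x \<notin> \<int>" for x
  proof -
    have "frac x \<in> {0<..<1}" using that frac_lt_1 frac_gt_0_iff by auto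
    then have "\<tau> (frac x) \<in> {0<..<1}" using \<tau> by blast
    then show "0 < \<tau> (frac x)" "\<tau> (frac x) < 1" by auto
  qed
  have fl: "\<lfloor>L x\<rfloor> = \<lfloor>x\<rfloor>" for x
    using rng[of x] by (cases "x \<in> \<int>") (auto simp: L floor_eq_iff)
  have "strict_mono L"
  proof (rule strict_monoI)
    fix x y :: real assume xy: "x < y"
    show "L x < L y"
    proof (cases "\<lfloor>x\<rfloor> = \<lfloor>y\<rfloor>")
      case False
      then have "\<lfloor>L x\<rfloor> < \<lfloor>L y\<rfloor>" using xy by (simp add: fl floor_mono order.not_eq_order_implies_strict)
      then show ?thesis by (metis floor_less_cancel)
    next
      case True
      then have fr: "frac x < frac y" using xy by (simp add: frac_def)
      then have y: "y \<notin> \<int>" using frac_ge_0[of x] by (metis frac_eq_0_iff not_less)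
      show ?thesis
      proof (cases "x \<in> \<int>")
        case True
        then show ?thesis using rng[OF y] \<open>\<lfloor>x\<rfloor> = \<lfloor>y\<rfloor>\<close> y by (auto simp: L elim!: Ints_cases)
      next
        case False
        then have "\<tau> (frac x) < \<tau> (frac y)"
          using \<tau>m[OF _ fr frac_lt_1] by simp
        then show ?thesis using False y \<open>\<lfloor>x\<rfloor> = \<lfloor>y\<rfloor>\<close> by (simp add: L)
      qed
    qed
  qed
  moreover have "\<exists>x. L x = y" for y
  proof (cases "y \<in> \<int>")
    case True
    then show ?thesis by (metis L)
  next
    case False
    then have "frac y \<in> {0<..<1}" using frac_lt_1 frac_gt_0_iff by auto
    then obtain z where z: "z \<in> {0<..<1}" "\<tau> z = frac y" using \<tau> by (metis imageE)
    have "\<lfloor>z + of_int \<lfloor>y\<rfloor>\<rfloor> = \<lfloor>y\<rfloor>" using z(1) by (auto simp: floor_eq_iff)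
    then have "frac (z + of_int \<lfloor>y\<rfloor>) = z" by (simp add: frac_def)
    moreover from this have "z + of_int \<lfloor>y\<rfloor> \<notin> \<int>" using z(1) by (metis frac_eq_0_iff greaterThanLessThan_iff less_irrefl)
    ultimately have "L (z + of_int \<lfloor>y\<rfloor>) = y"
      using z \<open>\<lfloor>z + of_int \<lfloor>y\<rfloor>\<rfloor> = \<lfloor>y\<rfloor>\<close> by (simp add: L frac_def)
    then show ?thesis by blast
  qed
  then have "surj L" by (metis surjI)
  ultimately show ?thesis unfolding L_def by (rule HomeoR_I)
qed

lemma translation_closed: "translation a \<in> carrier HomeoR"
proof (rule HomeoR_I)
  show "surj (translation a)" by (rule surjI[of _ "\<lambda>x. x - a"]) (simp add: translation_def)
qed (simp add: strict_mono_def translation_def)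

lemma subgroup_line_group:
  assumes "homeomorphism UNIV {0<..<1} \<eta> \<eta>'"
  shows "subgroup (line_group \<eta> \<alpha> n) HomeoR"
proof -
  interpret group HomeoR by (rule group_HomeoR)
  have "subgroup (((\<lambda>G. generate HomeoR (interval_lift \<eta> ` G \<union> {translation 1})) ^^ m)
      (generate HomeoR {translation 1, translation \<alpha>})) HomeoR" for m
  proof (induction m)
    case 0
    then show ?case using translation_closed by (auto intro: generate_is_subgroup)
  next
    case (Suc m)
    then show ?case using translation_closed interval_lift_closed[OF assms] 
      by (auto intro!: generate_is_subgroup dest: subgroup.subset)
  qed
  then show ?thesis unfolding line_group_def .
qed

lemma affine_orbit_iff:
  assumes G: "subgroup G HomeoR" and g: "g \<in> G"
  shows "x \<in> orbit (affine_group G k) affine_act g \<longleftrightarrow>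
    (\<exists>\<phi> \<in> normalizer HomeoR G. \<exists>h \<in> G.
       x = \<phi> \<otimes>\<^bsub>HomeoR\<^esub> (g \<otimes>\<^bsub>HomeoR\<^esub> h [^]\<^bsub>HomeoR\<^esub> k) \<otimes>\<^bsub>HomeoR\<^esub> inv\<^bsub>HomeoR\<^esub> \<phi>)"
proof -
  interpret group HomeoR by (rule group_HomeoR)
  let ?N = "normalizer HomeoR G"
  have GC: "G \<subseteq> carrier HomeoR" using G by (rule subgroup.subset)
  have N: "subgroup ?N HomeoR" using GC by (rule normalizer_imp_subgroup)
  have conj: "\<phi> \<otimes>\<^bsub>HomeoR\<^esub> h \<otimes>\<^bsub>HomeoR\<^esub> inv\<^bsub>HomeoR\<^esub> \<phi> \<in> G"
    if "\<phi> \<in> ?N" "h \<in> G" for \<phi> h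
    using that GC by (fastforce simp: normalizer_def stabilizer_def l_coset_def r_coset_def)
  have pow: "\<phi> \<otimes>\<^bsub>HomeoR\<^esub> h [^]\<^bsub>HomeoR\<^esub> k \<otimes>\<^bsub>HomeoR\<^esub> inv\<^bsub>HomeoR\<^esub> \<phi>
      = (\<phi> \<otimes>\<^bsub>HomeoR\<^esub> h \<otimes>\<^bsub>HomeoR\<^esub> inv\<^bsub>HomeoR\<^esub> \<phi>) [^]\<^bsub>HomeoR\<^esub> k"
    if "\<phi> \<in> carrier HomeoR" "h \<in> carrier HomeoR" for \<phi> h and k :: nat
  proof (induction k)
    case 0 then show ?case using that by simp
  next
    case (Suc k)
    have c: "inv\<^bsub>HomeoR\<^esub> \<phi> \<otimes>\<^bsub>HomeoR\<^esub> (\<phi> \<otimes>\<^bsub>HomeoR\<^esub> y) = y" if "y \<in> carrier HomeoR" for y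
      using that \<open>\<phi> \<in> carrier HomeoR\<close> by (simp add: m_assoc[symmetric])
    have "(\<phi> \<otimes>\<^bsub>HomeoR\<^esub> h \<otimes>\<^bsub>HomeoR\<^esub> inv\<^bsub>HomeoR\<^esub> \<phi>) [^]\<^bsub>HomeoR\<^esub> Suc k
        = (\<phi> \<otimes>\<^bsub>HomeoR\<^esub> h [^]\<^bsub>HomeoR\<^esub> k \<otimes>\<^bsub>HomeoR\<^esub> inv\<^bsub>HomeoR\<^esub> \<phi>)
          \<otimes>\<^bsub>HomeoR\<^esub> (\<phi> \<otimes>\<^bsub>HomeoR\<^esub> h \<otimes>\<^bsub>HomeoR\<^esub> inv\<^bsub>HomeoR\<^esub> \<phi>)"
      by (simp only: Suc nat_pow_Suc)
    also have "\<dots> = \<phi> \<otimes>\<^bsub>HomeoR\<^esub> h [^]\<^bsub>HomeoR\<^esub> Suc k \<otimes>\<^bsub>HomeoR\<^esub> inv\<^bsub>HomeoR\<^esub> \<phi>"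
      using that by (simp add: m_assoc c)
    finally show ?case by simp
  qed
  have orb: "x \<in> orbit (affine_group G k) affine_act g \<longleftrightarrow>
      (\<exists>\<phi>\<in>?N. \<exists>h\<in>G. x = affine_act (\<phi>, h [^]\<^bsub>HomeoR\<^esub> k) g)"
    by (auto simp: orbit_def affine_group_def powers_def simp del: affine_act.simps)
  have eq: "affine_act (\<phi>, (\<phi> \<otimes>\<^bsub>HomeoR\<^esub> h \<otimes>\<^bsub>HomeoR\<^esub> inv\<^bsub>HomeoR\<^esub> \<phi>) [^]\<^bsub>HomeoR\<^esub> k) g
       = \<phi> \<otimes>\<^bsub>HomeoR\<^esub> (g \<otimes>\<^bsub>HomeoR\<^esub> h [^]\<^bsub>HomeoR\<^esub> k) \<otimes>\<^bsub>HomeoR\<^esub> inv\<^bsub>HomeoR\<^esub> \<phi>"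
    if "\<phi> \<in> ?N" "h \<in> G" for \<phi> h
  proof -
    have c: "\<phi> \<in> carrier HomeoR" "h \<in> carrier HomeoR" "g \<in> carrier HomeoR"
      using that GC g subgroup.subset[OF N] by auto
    have "inv\<^bsub>HomeoR\<^esub> \<phi> \<otimes>\<^bsub>HomeoR\<^esub> (\<phi> \<otimes>\<^bsub>HomeoR\<^esub> y) = y" if "y \<in> carrier HomeoR" for y
      using that c by (simp add: m_assoc[symmetric])
    then show ?thesis using c by (simp only: pow[OF c(1,2), symmetric] affine_act.simps) (simp add: m_assoc)
  qed
  have ex: "\<exists>h' \<in> G. h = \<phi> \<otimes>\<^bsub>HomeoR\<^esub> h' \<otimes>\<^bsub>HomeoR\<^esub> inv\<^bsub>HomeoR\<^esub> \<phi>"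
    if "\<phi> \<in> ?N" "h \<in> G" for \<phi> h
  proof -
    have "G = \<phi> <#\<^bsub>HomeoR\<^esub> G #>\<^bsub>HomeoR\<^esub> inv\<^bsub>HomeoR\<^esub> \<phi>"
      using that GC by (auto simp: normalizer_def stabilizer_def)
    then show ?thesis using that by (auto simp: l_coset_def r_coset_def)
  qed
  show ?thesis unfolding orb
  proof (rule bex_cong[OF refl], rule iffI)
    fix \<phi> assume \<phi>: "\<phi> \<in> ?N"
    assume "\<exists>h\<in>G. x = affine_act (\<phi>, h [^]\<^bsub>HomeoR\<^esub> k) g"
    then obtain h where h: "h \<in> G" "x = affine_act (\<phi>, h [^]\<^bsub>HomeoR\<^esub> k) g" by blast
    obtain h' where h': "h' \<in> G" "h = \<phi> \<otimes>\<^bsub>HomeoR\<^esub> h' \<otimes>\<^bsub>HomeoR\<^esub> inv\<^bsub>HomeoR\<^esub> \<phi>"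
      using ex[OF \<phi> h(1)] by blast
    show "\<exists>h\<in>G. x = \<phi> \<otimes>\<^bsub>HomeoR\<^esub> (g \<otimes>\<^bsub>HomeoR\<^esub> h [^]\<^bsub>HomeoR\<^esub> k) \<otimes>\<^bsub>HomeoR\<^esub> inv\<^bsub>HomeoR\<^esub> \<phi>"
      using h'(1) eq[OF \<phi> h'(1)] unfolding h(2) h'(2) by blast
  next
    fix \<phi> assume \<phi>: "\<phi> \<in> ?N"
    assume "\<exists>h\<in>G. x = \<phi> \<otimes>\<^bsub>HomeoR\<^esub> (g \<otimes>\<^bsub>HomeoR\<^esub> h [^]\<^bsub>HomeoR\<^esub> k) \<otimes>\<^bsub>HomeoR\<^esub> inv\<^bsub>HomeoR\<^esub> \<phi>"
    then obtain h where h: "h \<in> G"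
      "x = \<phi> \<otimes>\<^bsub>HomeoR\<^esub> (g \<otimes>\<^bsub>HomeoR\<^esub> h [^]\<^bsub>HomeoR\<^esub> k) \<otimes>\<^bsub>HomeoR\<^esub> inv\<^bsub>HomeoR\<^esub> \<phi>" by blast
    show "\<exists>h\<in>G. x = affine_act (\<phi>, h [^]\<^bsub>HomeoR\<^esub> k) g"
      using conj[OF \<phi> h(1)] eq[OF \<phi> h(1)] unfolding h(2) by metis
  qed
qed

corollary line_group_affine_orbit_iff:
  assumes "homeomorphism UNIV {0<..<1} \<eta> \<eta>'" and "g \<in> line_group \<eta> \<alpha> n"
  shows "x \<in> orbit (affine_group (line_group \<eta> \<alpha> n) k) affine_act g \<longleftrightarrow>
    (\<exists>\<phi> \<in> normalizer HomeoR (line_group \<eta> \<alpha> n). \<exists>h \<in> line_group \<eta> \<alpha> n.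
       x = \<phi> \<otimes>\<^bsub>HomeoR\<^esub> (g \<otimes>\<^bsub>HomeoR\<^esub> h [^]\<^bsub>HomeoR\<^esub> k) \<otimes>\<^bsub>HomeoR\<^esub> inv\<^bsub>HomeoR\<^esub> \<phi>)"
  using affine_orbit_iff[OF subgroup_line_group] assms by blast

end

theory Submission
  imports Defs
begin

text \<open>
  The idea is to pass to the universal covering of the circle. Write \<open>G\<close> for the line group. There is
  a coordinate on the line, covering the circle, in which the lift of \<open>f\<close> is the unit translation and
  the lift of the extension of \<open>\<sigma> \<in> G\<close> to the circle is \<open>interval_lift E \<sigma>\<close>, where \<open>E\<close> is the
  chart of the first arc. So the group of all lifts of the circle group is the extension \<open>K\<close> of \<open>G\<close>
  by the same step that leads from one line group to the next. Since the \<open>k\<close>-th power of \<open>f\<close> is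
  \<open>g\<close> on the first arc, the deck group is generated by the translation by \<open>k\<close> composed with the lift
  of the inverse of \<open>g\<close> (\<open>covers_circle_group\<close>). Circle groups are topologically
  conjugate iff the pairs of \<open>K\<close> and the deck generator are conjugate on the line
  (\<open>topologically_conjugate_iff_covers\<close>).

  The extension \<open>K\<close> remembers \<open>G\<close>: its elements with fixed points are the lifts, whose common
  fixed points are the integers, so that a conjugacy \<open>H\<close> between two extensions permutes the integers
  by a shift and restricts to a conjugacy \<open>\<rho>\<close> of the original groups on a unit interval
  (\<open>extension_rigidity\<close>). Iterated, this recovers \<open>n\<close>, and it reduces the comparison of the
  irrational numbers to two groups of translations, where it is a comparison of dense subgroups of
  the reals (\<open>line_group_rigidity\<close>).

  For the circle groups the same rigidity gives \<open>\<rho>\<close>, while the deck generators give \<open>k\<close>, which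
  is the amount by which they move the integers. The conjugate under \<open>H\<close> of the unit translation is
  the unit translation only up to the lift of some \<open>h\<close>. The deck generator contains the \<open>k\<close>-th power
  of the unit translation, and this is the origin of the powers \<open>h ^ k\<close> in the affine action
  (\<open>deck_conjugacy_necessary\<close>). Conversely, given \<open>\<rho>\<close> and \<open>h\<close> one can write down a suitable \<open>H\<close>, which
  is \<open>\<rho>\<close> twisted by a different power of \<open>h\<close> on every unit interval (\<open>twisted_lift\<close>).
\<close>

section \<open>Increasing homeomorphisms of the line\<close>

interpretation R: group HomeoR by (rule group_HomeoR)

lemma HomeoR_iff: "f \<in> carrier HomeoR \<longleftrightarrow> strict_mono f \<and> surj f"
proof
  assume "f \<in> carrier HomeoR"
  then show "strict_mono f \<and> surj f" by (auto simp: HomeoR_def homeomorphism_def)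
qed (simp add: HomeoR_I)

lemma HomeoR_mult:
  assumes "f \<in> carrier HomeoR" "g \<in> carrier HomeoR"
  shows "f \<otimes>\<^bsub>HomeoR\<^esub> g = f \<circ> g"
proof -
  have "f \<in> Bij UNIV" "g \<in> Bij UNIV"
    using assms by (auto simp: HomeoR_iff Bij_def bij_betw_def strict_mono_imp_inj_on)
  then show ?thesis by (auto simp: HomeoR_def BijGroup_def compose_def)
qed

lemma HomeoR_one: "\<one>\<^bsub>HomeoR\<^esub> = id"
  by (auto simp: HomeoR_def BijGroup_def)

lemma HomeoR_comp: "f \<circ> g \<in> carrier HomeoR"
  if "f \<in> carrier HomeoR" "g \<in> carrier HomeoR"
  using R.m_closed[OF that] by (simp add: HomeoR_mult that)

lemma HomeoR_id: "id \<in> carrier HomeoR"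
  using R.one_closed by (simp add: HomeoR_one)

lemma HomeoR_inv_apply:
  assumes "f \<in> carrier HomeoR"
  shows "f ((inv\<^bsub>HomeoR\<^esub> f) x) = x" "(inv\<^bsub>HomeoR\<^esub> f) (f x) = x"
proof -
  have "f \<circ> (inv\<^bsub>HomeoR\<^esub> f) = id" "(inv\<^bsub>HomeoR\<^esub> f) \<circ> f = id"
    using assms R.r_inv[of f] R.l_inv[of f] by (simp_all add: HomeoR_mult HomeoR_one)
  then show "f ((inv\<^bsub>HomeoR\<^esub> f) x) = x" "(inv\<^bsub>HomeoR\<^esub> f) (f x) = x"
    by (metis comp_apply id_apply)+
qed

lemma HomeoR_less: "f \<in> carrier HomeoR \<Longrightarrow> f x < f y \<longleftrightarrow> x < y"
  by (simp add: HomeoR_iff strict_mono_less)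

lemma HomeoR_le: "f \<in> carrier HomeoR \<Longrightarrow> f x \<le> f y \<longleftrightarrow> x \<le> y"
  by (simp add: HomeoR_iff strict_mono_less_eq)

lemma HomeoR_eq: "f \<in> carrier HomeoR \<Longrightarrow> f x = f y \<longleftrightarrow> x = y"
  by (simp add: HomeoR_iff strict_mono_eq)

lemma HomeoR_continuous: "f \<in> carrier HomeoR \<Longrightarrow> continuous_on UNIV f"
  by (auto simp: HomeoR_def homeomorphism_def)

lemma HomeoR_int_pow_add:
  assumes "f \<in> carrier HomeoR"
  shows "(f [^]\<^bsub>HomeoR\<^esub> (i + j :: int)) x = (f [^]\<^bsub>HomeoR\<^esub> i) ((f [^]\<^bsub>HomeoR\<^esub> j) x)"
  using assms by (simp add: R.int_pow_mult HomeoR_mult)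

lemma HomeoR_int_pow_0: "(f [^]\<^bsub>HomeoR\<^esub> (0 :: int)) x = x"
  by (simp add: HomeoR_one)

lemma HomeoR_int_pow_cancel:
  assumes "f \<in> carrier HomeoR"
  shows "(f [^]\<^bsub>HomeoR\<^esub> (i :: int)) ((f [^]\<^bsub>HomeoR\<^esub> (- i)) x) = x"
    "(f [^]\<^bsub>HomeoR\<^esub> (- i)) ((f [^]\<^bsub>HomeoR\<^esub> (i :: int)) x) = x"
  using HomeoR_int_pow_add[OF assms, of i "- i" x] HomeoR_int_pow_add[OF assms, of "- i" i x]
  by (simp_all add: HomeoR_int_pow_0 HomeoR_one)

lemma subgroup_HomeoR_iff:
  "subgroup G HomeoR \<longleftrightarrow> G \<subseteq> carrier HomeoR \<and> id \<in> G \<and> (\<forall>\<sigma>\<in>G. inv\<^bsub>HomeoR\<^esub> \<sigma> \<in> G) \<and>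
     (\<forall>\<sigma>\<in>G. \<forall>\<tau>\<in>G. \<sigma> \<circ> \<tau> \<in> G)" (is "?L = ?R")
proof
  assume ?L
  then show ?R
    using HomeoR_mult subgroup.m_closed subgroup.m_inv_closed subgroup.subset subgroup.one_closed HomeoR_one
    by (metis (no_types, lifting) subsetD)
next
  assume ?R
  then show ?L
    by (intro subgroup.intro) (auto simp: HomeoR_mult HomeoR_one subset_iff)
qed

text \<open>Conjugacy without inverses: in any group this says that conjugation by \<open>\<phi>\<close> maps \<open>G\<close>
  onto \<open>H\<close>. In this form an intertwiner can be composed with and compared to others pointwise.\<close>

definition intertwines :: "('a, 'b) monoid_scheme \<Rightarrow> 'a \<Rightarrow> 'a set \<Rightarrow> 'a set \<Rightarrow> bool"
  where "intertwines M \<phi> G H \<longleftrightarrow>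
    (\<forall>\<sigma>\<in>G. \<exists>\<tau>\<in>H. \<phi> \<otimes>\<^bsub>M\<^esub> \<sigma> = \<tau> \<otimes>\<^bsub>M\<^esub> \<phi>) \<and> (\<forall>\<tau>\<in>H. \<exists>\<sigma>\<in>G. \<phi> \<otimes>\<^bsub>M\<^esub> \<sigma> = \<tau> \<otimes>\<^bsub>M\<^esub> \<phi>)"

lemma (in group) conjugate_eq_iff_intertwines:
  assumes "\<phi> \<in> carrier G" "A \<subseteq> carrier G" "B \<subseteq> carrier G"
  shows "\<phi> <# A #> inv \<phi> = B \<longleftrightarrow> intertwines G \<phi> A B"
proof -
  have eq: "\<phi> \<otimes> \<sigma> = \<tau> \<otimes> \<phi> \<longleftrightarrow> \<tau> = \<phi> \<otimes> \<sigma> \<otimes> inv \<phi>"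
    if "\<sigma> \<in> A" "\<tau> \<in> carrier G" for \<sigma> \<tau>
  proof -
    have c: "\<sigma> \<in> carrier G" using that assms by auto
    show ?thesis
      using assms(1) c that(2) inv_solve_right[of \<tau> "\<phi> \<otimes> \<sigma>" \<phi>] by auto
  qed
  have "\<phi> <# A #> inv \<phi> = (\<lambda>\<sigma>. \<phi> \<otimes> \<sigma> \<otimes> inv \<phi>) ` A"
    by (auto simp: l_coset_def r_coset_def)
  moreover have "\<phi> \<otimes> \<sigma> \<otimes> inv \<phi> \<in> carrier G" if "\<sigma> \<in> A" for \<sigma>
    using that assms by auto
  ultimately show ?thesis
    using assms eq unfolding intertwines_def by (safe; force simp: subset_iff)
qed

lemma intertwines_HomeoR_iff:
  assumes "\<phi> \<in> carrier HomeoR" "G \<subseteq> carrier HomeoR" "H \<subseteq> carrier HomeoR"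
  shows "intertwines HomeoR \<phi> G H \<longleftrightarrow>
    (\<forall>\<sigma>\<in>G. \<exists>\<tau>\<in>H. \<forall>x. \<phi> (\<sigma> x) = \<tau> (\<phi> x)) \<and> (\<forall>\<tau>\<in>H. \<exists>\<sigma>\<in>G. \<forall>x. \<phi> (\<sigma> x) = \<tau> (\<phi> x))"
proof -
  have "\<phi> \<otimes>\<^bsub>HomeoR\<^esub> \<sigma> = \<tau> \<otimes>\<^bsub>HomeoR\<^esub> \<phi> \<longleftrightarrow> (\<forall>x. \<phi> (\<sigma> x) = \<tau> (\<phi> x))"
    if "\<sigma> \<in> G" "\<tau> \<in> H" for \<sigma> \<tau>
    using that assms by (auto simp: HomeoR_mult fun_eq_iff subset_iff)
  then show ?thesis unfolding intertwines_def by meson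
qed

lemma (in group) intertwines_inv:
  assumes "intertwines G \<phi> A B" "\<phi> \<in> carrier G" "A \<subseteq> carrier G" "B \<subseteq> carrier G"
  shows "intertwines G (inv \<phi>) B A"
proof -
  have "inv \<phi> \<otimes> \<tau> = \<sigma> \<otimes> inv \<phi>" if "\<sigma> \<in> A" "\<tau> \<in> B" "\<phi> \<otimes> \<sigma> = \<tau> \<otimes> \<phi>" for \<sigma> \<tau>
  proof -
    have c: "\<sigma> \<in> carrier G" "\<tau> \<in> carrier G" using that assms by auto
    have "\<tau> = \<phi> \<otimes> \<sigma> \<otimes> inv \<phi>" using inv_solve_right[of \<tau> "\<phi> \<otimes> \<sigma>" \<phi>] that c assms by simp
    then show ?thesis using c assms by (simp add: m_assoc[symmetric])
  qed
  then show ?thesis using assms(1) unfolding intertwines_def by metis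
qed

lemma (in group) intertwines_mult:
  assumes "intertwines G \<phi> A B" "intertwines G \<psi> B C" "\<phi> \<in> carrier G" "\<psi> \<in> carrier G"
    "A \<subseteq> carrier G" "B \<subseteq> carrier G" "C \<subseteq> carrier G"
  shows "intertwines G (\<psi> \<otimes> \<phi>) A C"
proof -
  have "\<psi> \<otimes> \<phi> \<otimes> \<sigma> = \<upsilon> \<otimes> (\<psi> \<otimes> \<phi>)"
    if "\<sigma> \<in> A" "\<tau> \<in> B" "\<upsilon> \<in> C" "\<phi> \<otimes> \<sigma> = \<tau> \<otimes> \<phi>" "\<psi> \<otimes> \<tau> = \<upsilon> \<otimes> \<psi>" for \<sigma> \<tau> \<upsilon>
  proof -
    have c: "\<sigma> \<in> carrier G" "\<tau> \<in> carrier G" "\<upsilon> \<in> carrier G" using that assms by auto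
    then have "\<psi> \<otimes> \<phi> \<otimes> \<sigma> = (\<psi> \<otimes> \<tau>) \<otimes> \<phi>" using that assms by (metis m_assoc)
    then show ?thesis using that assms c by (simp add: m_assoc)
  qed
  then show ?thesis using assms(1,2) unfolding intertwines_def by meson
qed

text \<open>The pieces agree at the integers and preserve integer parts, so that monotonicity and
  surjectivity can be checked on one unit interval at a time. Both the coordinate that straightens
  a circle map and the conjugacy \<open>twisted_lift\<close> below arise by such a pasting.\<close>

lemma HomeoR_paste:
  assumes q: "\<And>j. q j \<in> carrier HomeoR"
    and fix_ends: "\<And>j. q j (of_int j) = of_int j" "\<And>j. q j (of_int (j + 1)) = of_int (j + 1)"
  shows "(\<lambda>x. q \<lfloor>x\<rfloor> x) \<in> carrier HomeoR" (is "?Q \<in> _") and "\<lfloor>q \<lfloor>x\<rfloor> x\<rfloor> = \<lfloor>x\<rfloor>"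
proof -
  have q_floor: "\<lfloor>q j x\<rfloor> = j \<longleftrightarrow> \<lfloor>x\<rfloor> = j" for j x
  proof -
    have "\<lfloor>q j x\<rfloor> = j \<longleftrightarrow> q j (of_int j) \<le> q j x \<and> q j x < q j (of_int (j + 1))"
      using fix_ends[of j] by (simp add: floor_eq_iff)
    also have "\<dots> \<longleftrightarrow> \<lfloor>x\<rfloor> = j" by (simp only: HomeoR_le[OF q] HomeoR_less[OF q]) (simp add: floor_eq_iff)
    finally show ?thesis .
  qed
  then show floor_Q: "\<lfloor>?Q x\<rfloor> = \<lfloor>x\<rfloor>" for x by blast
  show "?Q \<in> carrier HomeoR"
  proof (rule HomeoR_I)
    show "strict_mono ?Q"
    proof (rule strict_monoI)
      fix x y :: real assume "x < y"
      show "?Q x < ?Q y"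
      proof (cases "\<lfloor>x\<rfloor> = \<lfloor>y\<rfloor>")
        case True
        then show ?thesis using \<open>x < y\<close> HomeoR_less[OF q] by simp
      next
        case False
        then have "\<lfloor>?Q x\<rfloor> < \<lfloor>?Q y\<rfloor>"
          using \<open>x < y\<close> floor_mono[of x y] by (simp only: floor_Q) linarith
        then show ?thesis by (metis floor_less_cancel)
      qed
    qed
    show "surj ?Q"
    proof (rule surjI)
      fix y
      define x where "x = (inv\<^bsub>HomeoR\<^esub> (q \<lfloor>y\<rfloor>)) y"
      have "q \<lfloor>y\<rfloor> x = y" using q by (simp add: x_def HomeoR_inv_apply)
      then show "?Q ((inv\<^bsub>HomeoR\<^esub> (q \<lfloor>y\<rfloor>)) y) = y" using q_floor[of "\<lfloor>y\<rfloor>" x] by (simp flip: x_def)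
    qed
  qed
qed

section \<open>Extending a group from the unit interval to the line\<close>

definition unit_chart :: "(real \<Rightarrow> real) \<Rightarrow> bool"
  where "unit_chart E \<longleftrightarrow> (\<exists>E'. homeomorphism UNIV {0<..<1} E E')"

lemma unit_chart_bounds:
  assumes "unit_chart E" shows "0 < E x" "E x < 1"
proof -
  have "E x \<in> {0<..<1}" using assms by (auto simp: unit_chart_def homeomorphism_def)
  then show "0 < E x" "E x < 1" by auto
qed

lemma unit_chart_onto:
  assumes "unit_chart E" "0 < y" "y < 1" obtains x where "y = E x"
proof -
  have "y \<in> range E" using assms by (auto simp: unit_chart_def homeomorphism_def)
  then show ?thesis using that by auto
qed

lemma unit_chart_eq:
  assumes "unit_chart E" shows "E x = E y \<longleftrightarrow> x = y"
  using assms unfolding unit_chart_def by (metis UNIV_I homeomorphism_apply1)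

lemma unit_chart_floor:
  assumes "unit_chart E" shows "\<lfloor>of_int j + E x\<rfloor> = j"
  using unit_chart_bounds[OF assms, of x] by (simp add: floor_eq_iff)

lemma unit_chart_floor_0:
  assumes "unit_chart E" shows "\<lfloor>E x\<rfloor> = 0"
  using unit_chart_floor[OF assms, of 0 x] by simp

lemma unit_chart_cases:
  assumes "unit_chart E"
  obtains (int) j where "y = of_int j" | (chart) j x where "y = of_int j + E x"
proof (cases "y \<in> \<int>")
  case True
  then show ?thesis using int by (auto elim: Ints_cases)
next
  case False
  then have "0 < frac y" "frac y < 1" by (auto simp: frac_gt_0_iff frac_lt_1)
  then obtain x where "frac y = E x" using unit_chart_onto[OF assms] by metis
  then have "y = of_int \<lfloor>y\<rfloor> + E x" by (simp add: frac_def algebra_simps)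
  then show ?thesis by (rule chart)
qed

lemma interval_lift_int: "interval_lift E \<sigma> (of_int j) = of_int j"
  by (simp add: interval_lift_def)

lemma interval_lift_0: "interval_lift E \<sigma> 0 = 0"
  by (simp add: interval_lift_def)

lemma interval_lift_chart:
  assumes "unit_chart E"
  shows "interval_lift E \<sigma> (of_int j + E x) = of_int j + E (\<sigma> x)"
proof -
  have "inj E" using unit_chart_eq[OF assms] by (auto intro: injI)
  moreover have "of_int j + E x \<notin> \<int>"
  proof
    assume "of_int j + E x \<in> \<int>"
    then have "E x = of_int \<lfloor>E x\<rfloor>" by (metis Ints_diff Ints_of_int add_diff_cancel_left' of_int_floor)
    moreover have "\<lfloor>E x\<rfloor> = 0" using unit_chart_floor[OF assms, of 0 x] by simp
    ultimately show False using unit_chart_bounds[OF assms, of x] by simp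
  qed
  ultimately show ?thesis
    using unit_chart_floor[OF assms, of j x] by (simp add: interval_lift_def add.commute del: floor_add_int)
qed

lemma interval_lift_chart_0:
  "unit_chart E \<Longrightarrow> interval_lift E \<sigma> (E x) = E (\<sigma> x)"
  using interval_lift_chart[of E \<sigma> 0 x] by simp

lemma interval_lift_HomeoR:
  "unit_chart E \<Longrightarrow> \<sigma> \<in> carrier HomeoR \<Longrightarrow> interval_lift E \<sigma> \<in> carrier HomeoR"
  using interval_lift_closed unfolding unit_chart_def by blast

lemma interval_lift_floor:
  assumes "unit_chart E" shows "\<lfloor>interval_lift E \<sigma> y\<rfloor> = \<lfloor>y\<rfloor>"
  by (rule unit_chart_cases[OF assms, of y])
    (simp_all add: interval_lift_int interval_lift_chart unit_chart_floor_0 assms)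

lemma interval_lift_comp:
  assumes "unit_chart E"
  shows "interval_lift E (\<sigma> \<circ> \<tau>) y = interval_lift E \<sigma> (interval_lift E \<tau> y)"
  by (rule unit_chart_cases[OF assms, of y])
    (simp_all add: interval_lift_int interval_lift_chart assms)

lemma interval_lift_id:
  assumes "unit_chart E" shows "interval_lift E id y = y"
  by (rule unit_chart_cases[OF assms, of y])
    (simp_all add: interval_lift_int interval_lift_chart assms)

lemma interval_lift_add_int:
  assumes "unit_chart E"
  shows "interval_lift E \<sigma> (y + of_int i) = interval_lift E \<sigma> y + of_int i"
proof (rule unit_chart_cases[OF assms, of y])
  fix j assume "y = of_int j"
  then show ?thesis by (metis interval_lift_int of_int_add)
next
  fix j x assume y: "y = of_int j + E x"
  then have "y + of_int i = of_int (j + i) + E x" by simp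
  then show ?thesis by (simp only: interval_lift_chart[OF assms] y)
qed

lemma translation_comp: "translation a \<circ> translation b = translation (a + b)"
  by (auto simp: translation_def)

lemma translation_int_pow: "translation a [^]\<^bsub>HomeoR\<^esub> (i :: int) = translation (of_int i * a)"
proof -
  have nat: "translation a [^]\<^bsub>HomeoR\<^esub> (m :: nat) = translation (of_nat m * a)" for m
  proof (induction m)
    case 0
    then show ?case by (auto simp: HomeoR_one translation_def)
  next
    case (Suc m)
    then show ?case
      by (simp add: HomeoR_mult translation_closed translation_comp algebra_simps)
  qed
  have "inv\<^bsub>HomeoR\<^esub> (translation b) = translation (- b)" for b
    by (rule R.inv_equality)
      (auto simp: HomeoR_mult HomeoR_one translation_closed translation_comp, simp add: translation_def fun_eq_iff)
  then show ?thesis by (cases i rule: int_cases2) (simp_all add: R.int_pow_neg_int int_pow_int nat translation_closed)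
qed

definition line_extension :: "(real \<Rightarrow> real) \<Rightarrow> (real \<Rightarrow> real) set \<Rightarrow> (real \<Rightarrow> real) set"
  where "line_extension E G = generate HomeoR (interval_lift E ` G \<union> {translation 1})"

text \<open>Lifts commute with integer translations and compose like the elements of \<open>G\<close>, so that every
  word in the generators can be sorted.\<close>

lemma line_extension_eq:
  assumes E: "unit_chart E" and G: "subgroup G HomeoR"
  shows "line_extension E G = {translation (of_int j) \<circ> interval_lift E \<sigma> | j \<sigma>. \<sigma> \<in> G}"
    (is "_ = ?S")
proof
  have C: "\<sigma> \<in> carrier HomeoR" if "\<sigma> \<in> G" for \<sigma> using that G subgroup.subset by blast
  have mult: "(translation (of_int i) \<circ> interval_lift E \<sigma>) \<circ> (translation (of_int j) \<circ> interval_lift E \<tau>)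
      = translation (of_int (i + j)) \<circ> interval_lift E (\<sigma> \<circ> \<tau>)" for i j \<sigma> \<tau>
    by (auto simp: translation_def interval_lift_add_int[OF E] interval_lift_comp[OF E])
  have triv: "translation (of_int 0) \<circ> interval_lift E id = id"
    by (auto simp: translation_def interval_lift_id[OF E])
  have car: "translation (of_int j) \<circ> interval_lift E \<sigma> \<in> carrier HomeoR" if "\<sigma> \<in> G" for j \<sigma>
    using that C E by (intro HomeoR_comp translation_closed interval_lift_HomeoR)
  have S_I: "translation (of_int j) \<circ> interval_lift E \<sigma> \<in> ?S" if "\<sigma> \<in> G" for j \<sigma>
    using that by blast
  have id_in: "id \<in> G" using G by (simp add: subgroup_HomeoR_iff)
  have "subgroup ?S HomeoR"
    unfolding subgroup_HomeoR_iff
  proof (intro conjI ballI)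
    show "?S \<subseteq> carrier HomeoR" using car by blast
    show "id \<in> ?S" using S_I[OF id_in, of 0] unfolding triv .
    show "\<kappa> \<circ> \<mu> \<in> ?S" if "\<kappa> \<in> ?S" "\<mu> \<in> ?S" for \<kappa> \<mu>
    proof -
      from that obtain i j \<sigma> \<tau> where "\<sigma> \<in> G" "\<tau> \<in> G" and
        "\<kappa> = translation (of_int i) \<circ> interval_lift E \<sigma>" "\<mu> = translation (of_int j) \<circ> interval_lift E \<tau>"
        by blast
      then have eq: "\<kappa> \<circ> \<mu> = translation (of_int (i + j)) \<circ> interval_lift E (\<sigma> \<circ> \<tau>)" and "\<sigma> \<circ> \<tau> \<in> G"
        using mult[of i \<sigma> j \<tau>] G by (simp_all only: subgroup_HomeoR_iff)
      show ?thesis unfolding eq by (rule S_I) fact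
    qed
    show "inv\<^bsub>HomeoR\<^esub> \<kappa> \<in> ?S" if \<kappa>: "\<kappa> \<in> ?S" for \<kappa>
    proof -
      from \<kappa> obtain i \<sigma> where \<sigma>: "\<sigma> \<in> G" and \<kappa>_eq: "\<kappa> = translation (of_int i) \<circ> interval_lift E \<sigma>"
        by blast
      let ?\<mu> = "translation (of_int (- i)) \<circ> interval_lift E (inv\<^bsub>HomeoR\<^esub> \<sigma>)"
      have inv_in: "inv\<^bsub>HomeoR\<^esub> \<sigma> \<in> G" using \<sigma> G subgroup.m_inv_closed by fast
      have "inv\<^bsub>HomeoR\<^esub> \<sigma> \<circ> \<sigma> = id" using C[OF \<sigma>] by (auto simp: HomeoR_inv_apply)
      then have "?\<mu> \<circ> \<kappa> = id" using mult[of "- i" "inv\<^bsub>HomeoR\<^esub> \<sigma>" i \<sigma>] triv unfolding \<kappa>_eq by simp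
      then have "inv\<^bsub>HomeoR\<^esub> \<kappa> = ?\<mu>"
        using car[OF \<sigma>] car[OF inv_in] unfolding \<kappa>_eq
        by (intro R.inv_equality) (simp_all only: HomeoR_mult HomeoR_one)
      then show ?thesis by (simp only: S_I[OF inv_in])
    qed
  qed
  moreover have "interval_lift E ` G \<union> {translation 1} \<subseteq> ?S"
  proof -
    have "translation (of_int 0) \<circ> interval_lift E \<sigma> = interval_lift E \<sigma>" for \<sigma>
      by (auto simp: translation_def)
    then have "interval_lift E \<sigma> \<in> ?S" if "\<sigma> \<in> G" for \<sigma>
      using S_I[OF that, of 0] by simp
    moreover have "translation (of_int 1) \<circ> interval_lift E id = translation 1"
      by (auto simp: translation_def interval_lift_id[OF E])
    then have "translation 1 \<in> ?S" using S_I[OF id_in, of 1] by simp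
    ultimately show ?thesis by (simp only: Un_subset_iff image_subset_iff insert_subset empty_subsetI) blast
  qed
  ultimately show "line_extension E G \<subseteq> ?S"
    unfolding line_extension_def by (intro R.generate_subgroup_incl)
  show "?S \<subseteq> line_extension E G"
  proof
    fix \<kappa> assume "\<kappa> \<in> ?S"
    then obtain j \<sigma> where \<sigma>: "\<sigma> \<in> G" and \<kappa>: "\<kappa> = translation (of_int j) \<circ> interval_lift E \<sigma>" by blast
    have sub: "subgroup (line_extension E G) HomeoR"
      unfolding line_extension_def
      using C E by (intro R.generate_is_subgroup) (auto intro: translation_closed interval_lift_HomeoR)
    have "translation 1 \<in> line_extension E G"
      unfolding line_extension_def by (auto intro: generate.incl)
    then have "translation 1 [^]\<^bsub>HomeoR\<^esub> j \<in> line_extension E G"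
      using R.subgroup_int_pow_closed[OF sub] by simp
    moreover have "interval_lift E \<sigma> \<in> line_extension E G"
      unfolding line_extension_def using \<sigma> by (auto intro: generate.incl)
    ultimately show "\<kappa> \<in> line_extension E G"
      using sub unfolding \<kappa> subgroup_HomeoR_iff translation_int_pow by simp
  qed
qed

lemma subgroup_line_extension:
  assumes "unit_chart E" "subgroup G HomeoR"
  shows "subgroup (line_extension E G) HomeoR"
  unfolding line_extension_def
  using assms subgroup.subset[OF assms(2)]
  by (intro R.generate_is_subgroup) (auto intro: translation_closed interval_lift_HomeoR)

section \<open>Rigidity of the extension\<close>

text \<open>Every element of the extension shifts integer parts by a constant. Hence the elements with a
  fixed point are exactly the lifts, and the integers are exactly the common fixed points of all
  lifts as soon as \<open>G\<close> contains a fixed-point-free element. This recovers the integers, and then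
  \<open>G\<close> itself, from the dynamics.\<close>

lemma line_extension_floor:
  assumes "unit_chart E"
  shows "\<lfloor>(translation (of_int j) \<circ> interval_lift E \<sigma>) y\<rfloor> = \<lfloor>y\<rfloor> + j"
  using interval_lift_floor[OF assms, of \<sigma> y] by (simp add: translation_def)

lemma line_extension_fixed_point:
  assumes "unit_chart E" "subgroup G HomeoR" "\<kappa> \<in> line_extension E G" "\<kappa> y = y"
  obtains \<sigma> where "\<sigma> \<in> G" "\<kappa> = interval_lift E \<sigma>"
proof -
  obtain j \<sigma> where \<sigma>: "\<sigma> \<in> G" and \<kappa>: "\<kappa> = translation (of_int j) \<circ> interval_lift E \<sigma>"
    using assms(3) unfolding line_extension_eq[OF assms(1,2)] by blast
  have "j = 0" using line_extension_floor[OF assms(1), of j \<sigma> y] assms(4) unfolding \<kappa> by simp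
  then have "\<kappa> = interval_lift E \<sigma>" using \<kappa> by (auto simp: translation_def)
  then show ?thesis using that \<sigma> by blast
qed

text \<open>The lift of the unit translation of \<open>G'\<close> moves every non-integer. It corresponds under \<open>H\<close> to
  an element that has a fixed point too, hence to a lift, which fixes all integers.\<close>

lemma intertwiner_maps_int_to_int:
  assumes E: "unit_chart E" "unit_chart E'" and G: "subgroup G HomeoR" "subgroup G' HomeoR"
    and T: "translation 1 \<in> G'"
    and H: "H \<in> carrier HomeoR" "intertwines HomeoR H (line_extension E G) (line_extension E' G')"
  shows "H (of_int i) \<in> \<int>"
proof (rule ccontr)
  assume nonint: "H (of_int i) \<notin> \<int>"
  let ?K = "line_extension E G" and ?K' = "line_extension E' G'"
  have K: "?K \<subseteq> carrier HomeoR" "?K' \<subseteq> carrier HomeoR"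
    using E G subgroup_line_extension subgroup.subset by blast+
  define \<tau> where "\<tau> = interval_lift E' (translation 1)"
  have "\<tau> \<in> ?K'" unfolding \<tau>_def line_extension_def using T by (auto intro: generate.incl)
  then obtain \<kappa> where \<kappa>: "\<kappa> \<in> ?K" "\<And>x. H (\<kappa> x) = \<tau> (H x)"
    using H(2) unfolding intertwines_HomeoR_iff[OF H(1) K] by blast
  obtain z where z: "H z = 0" using H(1) by (metis HomeoR_iff surjD)
  have "\<kappa> z = z"
    using \<kappa>(2)[of z] z interval_lift_0[of E'] HomeoR_eq[OF H(1), of "\<kappa> z" z] by (simp add: \<tau>_def)
  then obtain \<sigma> where "\<kappa> = interval_lift E \<sigma>"
    using line_extension_fixed_point[OF E(1) G(1) \<kappa>(1)] by blast
  then have fixed: "\<tau> (H (of_int i)) = H (of_int i)" using \<kappa>(2)[of "of_int i"] by (simp add: interval_lift_int)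
  show False
  proof (rule unit_chart_cases[OF E(2), of "H (of_int i)"])
    fix j x assume "H (of_int i) = of_int j + E' x"
    then show False
      using fixed by (simp add: \<tau>_def interval_lift_chart[OF E(2)] unit_chart_eq[OF E(2)] translation_def)
  qed (use nonint in auto)
qed

text \<open>An increasing bijection of the integers is a shift.\<close>

lemma intertwiner_on_int:
  assumes E: "unit_chart E" "unit_chart E'" and G: "subgroup G HomeoR" "subgroup G' HomeoR"
    and T: "translation 1 \<in> G" "translation 1 \<in> G'"
    and H: "H \<in> carrier HomeoR" "intertwines HomeoR H (line_extension E G) (line_extension E' G')"
  obtains m where "\<And>i. H (of_int i) = of_int (i + m)"
proof -
  have K: "line_extension E G \<subseteq> carrier HomeoR" "line_extension E' G' \<subseteq> carrier HomeoR"
    using E G subgroup_line_extension subgroup.subset by blast+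
  note to = intertwiner_maps_int_to_int[OF E G T(2) H]
  have "intertwines HomeoR (inv\<^bsub>HomeoR\<^esub> H) (line_extension E' G') (line_extension E G)"
    using R.intertwines_inv[OF H(2,1) K] .
  note from_int = intertwiner_maps_int_to_int[OF E(2,1) G(2,1) T(1) R.inv_closed[OF H(1)] this]
  have step: "H (of_int (i + 1)) = H (of_int i) + 1" for i
  proof -
    obtain a b where ab: "H (of_int i) = of_int a" "H (of_int (i + 1)) = of_int b"
      using to by (meson Ints_cases)
    obtain c where c: "(inv\<^bsub>HomeoR\<^esub> H) (of_int (a + 1)) = of_int c" using from_int by (meson Ints_cases)
    then have Hc: "H (of_int c) = of_int (a + 1)" using HomeoR_inv_apply(1)[OF H(1)] by metis
    have "of_int a < (of_int b :: real)" using ab HomeoR_less[OF H(1)] by (metis of_int_less_iff zless_add1_eq)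
    moreover have "i < c" using Hc ab HomeoR_less[OF H(1), of "of_int i" "of_int c"] by simp
    then have "of_int b \<le> (of_int (a + 1) :: real)"
      using Hc ab HomeoR_le[OF H(1), of "of_int (i + 1)" "of_int c"] by (simp del: of_int_add)
    ultimately show ?thesis using ab by simp
  qed
  obtain m where m: "H 0 = of_int m" using to[of 0] by (auto elim: Ints_cases)
  have "H (of_int i) = of_int (i + m)" for i
  proof (induction i rule: int_induct[of _ 0])
    case base then show ?case using m by simp
  next
    case (step1 i) then show ?case using step[of i] by simp
  next
    case (step2 i) then show ?case using step[of "i - 1"] by simp
  qed
  then show ?thesis by (rule that)
qed

text \<open>Once \<open>H\<close> respects the integers, its restriction to a unit interval can be read in the charts,
  where it conjugates \<open>G\<close> to \<open>G'\<close>. The reading is increasing because both charts preserve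
  or both reverse the orientation; one and the same decreasing chart may occur on both sides.\<close>

proposition extension_rigidity:
  assumes E: "unit_chart E" "unit_chart E'" and orient: "\<And>x y. E x < E y \<longleftrightarrow> E' x < E' y"
    and G: "subgroup G HomeoR" "subgroup G' HomeoR"
    and T: "translation 1 \<in> G" "translation 1 \<in> G'"
    and H: "H \<in> carrier HomeoR" "intertwines HomeoR H (line_extension E G) (line_extension E' G')"
  obtains \<rho> m where "\<rho> \<in> carrier HomeoR" "intertwines HomeoR \<rho> G G'"
    "\<And>i. H (of_int i) = of_int (i + m)" "\<And>x. H (E x) = of_int m + E' (\<rho> x)"
proof -
  let ?K = "line_extension E G" and ?K' = "line_extension E' G'"
  have K: "?K \<subseteq> carrier HomeoR" "?K' \<subseteq> carrier HomeoR"
    using E G subgroup_line_extension subgroup.subset by blast+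
  have GC: "G \<subseteq> carrier HomeoR" "G' \<subseteq> carrier HomeoR" using G subgroup.subset by blast+
  obtain m where m: "H (of_int i) = of_int (i + m)" for i
    using intertwiner_on_int[OF E G T H] by blast
  have m0: "H 0 = of_int m" and m1: "H 1 = of_int m + 1" using m[of 0] m[of 1] by simp_all
  have "\<exists>y. H (E x) = of_int m + E' y" for x
  proof -
    have "of_int m < H (E x)" "H (E x) < of_int m + 1"
      using unit_chart_bounds[OF E(1), of x] HomeoR_less[OF H(1)] m0 m1 by metis+
    then obtain y where "H (E x) - of_int m = E' y"
      using unit_chart_onto[OF E(2), of "H (E x) - of_int m"] by auto
    then show ?thesis by (metis add.commute diff_add_cancel)
  qed
  then obtain \<rho> where \<rho>: "\<And>x. H (E x) = of_int m + E' (\<rho> x)" by metis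
  have \<rho>_less: "E' (\<rho> x) < E' (\<rho> y) \<longleftrightarrow> E' x < E' y" for x y
    using HomeoR_less[OF H(1), of "E x" "E y"] orient[of x y] by (simp add: \<rho>)
  have mono: "(\<forall>x y. x < y \<longrightarrow> E' x < E' y) \<or> (\<forall>x y. x < y \<longrightarrow> E' x > E' y)"
    using injective_eq_monotone_map[of UNIV E'] E(2) unit_chart_eq[OF E(2)]
    by (auto simp: unit_chart_def homeomorphism_def monotone_on_def inj_on_def)
  have "strict_mono \<rho>"
  proof (rule strict_monoI)
    fix x y :: real assume "x < y"
    with mono \<rho>_less show "\<rho> x < \<rho> y" by (metis less_asym linorder_neqE)
  qed
  moreover have "\<exists>x. \<rho> x = y" for y
  proof -
    obtain z where z: "H z = of_int m + E' y" using H(1) by (metis HomeoR_iff surjD)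
    then have "H 0 < H z" "H z < H 1" using unit_chart_bounds[OF E(2), of y] m0 m1 by auto
    then have "0 < z" "z < 1" using HomeoR_less[OF H(1)] by auto
    then obtain x where "z = E x" using unit_chart_onto[OF E(1)] by blast
    then show ?thesis using z \<rho> unit_chart_eq[OF E(2)] by auto
  qed
  then have "surj \<rho>" by (metis surjI)
  ultimately have \<rho>C: "\<rho> \<in> carrier HomeoR" by (rule HomeoR_I)
  have lift_eq: "\<rho> (\<sigma> x) = \<tau> (\<rho> x)"
    if "\<And>x. H (interval_lift E \<sigma> x) = interval_lift E' \<tau> (H x)" for \<sigma> \<tau> x
    using that[of "E x"]
    by (simp add: interval_lift_chart[OF E(2)] interval_lift_chart_0[OF E(1)] \<rho> unit_chart_eq[OF E(2)])
  have "intertwines HomeoR \<rho> G G'"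
    unfolding intertwines_HomeoR_iff[OF \<rho>C GC]
  proof (intro conjI ballI)
    fix \<sigma> assume "\<sigma> \<in> G"
    then have "interval_lift E \<sigma> \<in> ?K" unfolding line_extension_def by (auto intro: generate.incl)
    then obtain \<kappa> where \<kappa>: "\<kappa> \<in> ?K'" "\<And>x. H (interval_lift E \<sigma> x) = \<kappa> (H x)"
      using H(2) unfolding intertwines_HomeoR_iff[OF H(1) K] by blast
    have "\<kappa> (H 0) = H 0" using \<kappa>(2)[of 0] by (simp add: interval_lift_0)
    then obtain \<tau> where "\<tau> \<in> G'" "\<kappa> = interval_lift E' \<tau>"
      using line_extension_fixed_point[OF E(2) G(2) \<kappa>(1)] by blast
    then show "\<exists>\<tau>\<in>G'. \<forall>x. \<rho> (\<sigma> x) = \<tau> (\<rho> x)" using lift_eq \<kappa>(2) by blast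
  next
    fix \<tau> assume "\<tau> \<in> G'"
    then have "interval_lift E' \<tau> \<in> ?K'" unfolding line_extension_def by (auto intro: generate.incl)
    then obtain \<kappa> where \<kappa>: "\<kappa> \<in> ?K" "\<And>x. H (\<kappa> x) = interval_lift E' \<tau> (H x)"
      using H(2) unfolding intertwines_HomeoR_iff[OF H(1) K] by blast
    have "\<kappa> 0 = 0"
      using \<kappa>(2)[of 0] m0 interval_lift_int[of E' \<tau> m] HomeoR_eq[OF H(1), of "\<kappa> 0" 0] by simp
    then obtain \<sigma> where "\<sigma> \<in> G" "\<kappa> = interval_lift E \<sigma>"
      using line_extension_fixed_point[OF E(1) G(1) \<kappa>(1)] by blast
    then show "\<exists>\<sigma>\<in>G. \<forall>x. \<rho> (\<sigma> x) = \<tau> (\<rho> x)" using lift_eq \<kappa>(2) by blast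
  qed
  then show ?thesis using that[OF \<rho>C] m \<rho> by blast
qed

section \<open>The line groups determine their parameters\<close>

lemma int_combination_eq_0:
  fixes a :: real
  assumes "a \<notin> \<rat>" "of_int i + of_int j * a = 0" shows "i = 0" "j = 0"
proof -
  show "j = 0"
  proof (rule ccontr)
    assume "j \<noteq> 0"
    then have "a = of_int (- i) / of_int j" using assms(2) by (simp add: field_simps)
    then show False using assms(1) by (metis Rats_divide Rats_of_int)
  qed
  then show "i = 0" using assms(2) by simp
qed

lemma generate_translations:
  "generate HomeoR {translation 1, translation a} = {translation (of_int i + of_int j * a) | i j. True}"
    (is "_ = ?S")
proof
  have S_I: "translation (of_int i + of_int j * a) \<in> ?S" for i j by blast
  have "subgroup ?S HomeoR"
    unfolding subgroup_HomeoR_iff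
  proof (intro conjI ballI)
    show "?S \<subseteq> carrier HomeoR" using translation_closed by blast
    have id_eq: "translation (of_int 0 + of_int 0 * a) = id" by (auto simp: translation_def)
    show "id \<in> ?S" using S_I[of 0 0] unfolding id_eq .
    show "inv\<^bsub>HomeoR\<^esub> \<sigma> \<in> ?S" if "\<sigma> \<in> ?S" for \<sigma>
    proof -
      obtain i j where \<sigma>: "\<sigma> = translation (of_int i + of_int j * a)" using \<open>\<sigma> \<in> ?S\<close> by blast
      have "inv\<^bsub>HomeoR\<^esub> \<sigma> = \<sigma> [^]\<^bsub>HomeoR\<^esub> (- 1 :: int)"
        by (simp add: \<sigma> R.int_pow_neg translation_closed)
      also have "\<dots> = translation (of_int (- i) + of_int (- j) * a)"
        unfolding \<sigma> translation_int_pow by simp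
      finally show ?thesis by (simp only: S_I)
    qed
    show "\<sigma> \<circ> \<tau> \<in> ?S" if "\<sigma> \<in> ?S" "\<tau> \<in> ?S" for \<sigma> \<tau>
    proof -
      obtain i j where \<sigma>: "\<sigma> = translation (of_int i + of_int j * a)" using \<open>\<sigma> \<in> ?S\<close> by blast
      obtain u v where \<tau>: "\<tau> = translation (of_int u + of_int v * a)" using \<open>\<tau> \<in> ?S\<close> by blast
      have "\<sigma> \<circ> \<tau> = translation (of_int (i + u) + of_int (j + v) * a)"
        unfolding \<sigma> \<tau> translation_comp by (simp add: algebra_simps)
      then show ?thesis by (simp only: S_I)
    qed
  qed
  moreover have "{translation 1, translation a} \<subseteq> ?S"
    using S_I[of 1 0] S_I[of 0 1] by (simp only: insert_subset empty_subsetI) simp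
  ultimately show "generate HomeoR {translation 1, translation a} \<subseteq> ?S"
    by (intro R.generate_subgroup_incl)
  show "?S \<subseteq> generate HomeoR {translation 1, translation a}" (is "_ \<subseteq> ?G")
  proof
    fix \<sigma> assume "\<sigma> \<in> ?S"
    then obtain i j where \<sigma>: "\<sigma> = translation (of_int i + of_int j * a)" by blast
    have G: "subgroup ?G HomeoR" using translation_closed by (intro R.generate_is_subgroup) auto
    have "translation 1 \<in> ?G" "translation a \<in> ?G" by (auto intro: generate.incl)
    then have "translation 1 [^]\<^bsub>HomeoR\<^esub> i \<in> ?G" "translation a [^]\<^bsub>HomeoR\<^esub> j \<in> ?G"
      using R.subgroup_int_pow_closed[OF G] by blast+
    then have "translation (of_int i) \<circ> translation (of_int j * a) \<in> ?G"
      using G by (simp add: translation_int_pow subgroup_HomeoR_iff)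
    then show "\<sigma> \<in> ?G" by (simp add: \<sigma> translation_comp)
  qed
qed

text \<open>A conjugacy between two groups of translations induces an order preserving isomorphism between
  the corresponding subgroups of the reals. Comparison with rationals shows that such an isomorphism
  is multiplication by a positive number, here called \<open>l\<close>; its matrix in the two bases has
  determinant one up to sign.\<close>

lemma translation_group_rigidity:
  assumes irr: "a \<notin> \<rat>" "b \<notin> \<rat>" and \<rho>: "\<rho> \<in> carrier HomeoR"
    and inter: "intertwines HomeoR \<rho> (generate HomeoR {translation 1, translation a})
      (generate HomeoR {translation 1, translation b})"
  shows "equivalent_irrationals a b"
proof -
  define L where "L c i j = of_int i + of_int j * c" for c :: real and i j :: int
  have sub: "generate HomeoR {translation 1, translation c} \<subseteq> carrier HomeoR" for c
    using translation_closed by (intro R.generate_incl) auto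
  have to: "\<exists>u v. \<forall>x. \<rho> (x + L a i j) = \<rho> x + L b u v" for i j
  proof -
    have "translation (L a i j) \<in> generate HomeoR {translation 1, translation a}"
      unfolding generate_translations L_def by blast
    then obtain \<tau> where "\<tau> \<in> generate HomeoR {translation 1, translation b}"
      and \<tau>: "\<And>x. \<rho> (translation (L a i j) x) = \<tau> (\<rho> x)"
      using inter unfolding intertwines_HomeoR_iff[OF \<rho> sub sub] by blast
    then obtain u v where "\<tau> = translation (L b u v)" unfolding generate_translations L_def by blast
    then show ?thesis using \<tau> by (auto simp: translation_def)
  qed
  have onto: "\<exists>i j. \<forall>x. \<rho> (x + L a i j) = \<rho> x + L b u v" for u v
  proof -
    have "translation (L b u v) \<in> generate HomeoR {translation 1, translation b}"
      unfolding generate_translations L_def by blast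
    then obtain \<sigma> where "\<sigma> \<in> generate HomeoR {translation 1, translation a}"
      and \<sigma>: "\<And>x. \<rho> (\<sigma> x) = translation (L b u v) (\<rho> x)"
      using inter unfolding intertwines_HomeoR_iff[OF \<rho> sub sub] by blast
    then obtain i j where "\<sigma> = translation (L a i j)" unfolding generate_translations L_def by blast
    then show ?thesis using \<sigma> by (auto simp: translation_def)
  qed
  define c where "c x = \<rho> x - \<rho> 0" for x
  have c_add: "c (y + L a i j) = c y + c (L a i j)" for y i j
  proof -
    obtain u v where uv: "\<And>x. \<rho> (x + L a i j) = \<rho> x + L b u v" using to by metis
    show ?thesis using uv[of y] uv[of 0] by (simp add: c_def)
  qed
  have c_less: "c x < c y \<longleftrightarrow> x < y" for x y using HomeoR_less[OF \<rho>] by (simp add: c_def)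
  have c0: "c 0 = 0" by (simp add: c_def)
  have L_mult: "of_int p * L d i j = L d (p * i) (p * j)" for p d i j
    by (simp add: L_def algebra_simps)
  have c_mult_nat: "c (of_nat q * L a i j) = of_nat q * c (L a i j)" for q i j
  proof (induction q)
    case (Suc q)
    then show ?case using c_add[of "of_nat q * L a i j" i j] by (simp add: algebra_simps)
  qed (simp add: c0)
  have c_mult: "c (of_int p * L a i j) = of_int p * c (L a i j)" for p i j
  proof (cases p rule: int_cases2)
    case (nonneg q)
    then show ?thesis using c_mult_nat by simp
  next
    case (nonpos q)
    have "of_nat q * L a i j = L a (int q * i) (int q * j)" using L_mult[of "int q"] by simp
    then have "c 0 = c (of_int p * L a i j) + c (of_nat q * L a i j)"
      using c_add[of "of_int p * L a i j" "int q * i" "int q * j"] nonpos by simp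
    then show ?thesis using c0 c_mult_nat[of q i j] nonpos by simp
  qed
  define l where "l = c 1"
  have "l > 0" using c_less[of 0 1] c0 by (simp add: l_def)
  have c_int: "c (of_int p) = of_int p * l" for p
    using c_mult[of p 1 0] by (simp add: L_def l_def)
  have linear: "c (L a i j) = l * L a i j" for i j
  proof (rule ccontr)
    let ?x = "L a i j"
    assume "c ?x \<noteq> l * ?x"
    then consider "c ?x / l < ?x" | "?x < c ?x / l" using \<open>l > 0\<close> by (fastforce simp: field_simps)
    then show False
    proof cases
      case 1
      then obtain r where "r \<in> \<rat>" and r: "c ?x / l < r" "r < ?x" using Rats_dense_in_real by blast
      then obtain p q where "q > 0" and pq: "r = of_int p / of_int q" by (elim Rats_cases')
      have "of_int p < of_int q * ?x" "of_int q * c ?x < of_int p * l"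
        using r \<open>q > 0\<close> \<open>l > 0\<close> unfolding pq by (simp_all add: field_simps)
      then show False using c_less[of "of_int p" "of_int q * ?x"] c_mult c_int by simp
    next
      case 2
      then obtain r where "r \<in> \<rat>" and r: "r < c ?x / l" "?x < r" using Rats_dense_in_real by blast
      then obtain p q where "q > 0" and pq: "r = of_int p / of_int q" by (elim Rats_cases')
      have "of_int q * ?x < of_int p" "of_int p * l < of_int q * c ?x"
        using r \<open>q > 0\<close> \<open>l > 0\<close> unfolding pq by (simp_all add: field_simps)
      then show False using c_less[of "of_int q * ?x" "of_int p"] c_mult c_int by simp
    qed
  qed
  have c_to: "\<exists>u v. l * L a i j = L b u v" for i j
    using to[of i j] linear[of i j] unfolding c_def by (metis add.left_neutral add_diff_cancel_left')
  have c_onto: "\<exists>i j. l * L a i j = L b u v" for u v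
    using onto[of u v] linear unfolding c_def by (metis add.left_neutral add_diff_cancel_left')
  obtain i j where l: "l = L b i j" using c_to[of 1 0] by (auto simp: L_def)
  obtain u v where la: "l * a = L b u v" using c_to[of 0 1] by (auto simp: L_def)
  obtain p q where pq: "l * L a p q = 1" using c_onto[of 1 0] by (auto simp: L_def)
  obtain r s where rs: "l * L a r s = b" using c_onto[of 0 1] by (auto simp: L_def)
  have expand: "l * L a x y = L b (i * x + u * y) (j * x + v * y)" for x y
  proof -
    have "l * L a x y = of_int x * l + of_int y * (l * a)" by (simp add: L_def algebra_simps)
    also have "\<dots> = of_int x * L b i j + of_int y * L b u v" by (simp only: la) (simp only: l)
    finally show ?thesis by (simp add: L_def algebra_simps)
  qed
  have "of_int (i * p + u * q - 1) + of_int (j * p + v * q) * b = 0"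
    using pq unfolding expand by (simp add: L_def algebra_simps)
  from int_combination_eq_0[OF irr(2) this] have e1: "i * p + u * q = 1" "j * p + v * q = 0" by simp_all
  have "of_int (i * r + u * s) + of_int (j * r + v * s - 1) * b = 0"
    using rs unfolding expand by (simp add: L_def algebra_simps)
  from int_combination_eq_0[OF irr(2) this] have e2: "i * r + u * s = 0" "j * r + v * s = 1" by simp_all
  have "(i * v - u * j) * (p * s - r * q) = (i * p + u * q) * (j * r + v * s) - (i * r + u * s) * (j * p + v * q)"
    by (simp add: algebra_simps)
  then have "(i * v - u * j) * (p * s - r * q) = 1" using e1 e2 by simp
  then have "\<bar>r * q - s * p\<bar> = 1"
    using abs_zmult_eq_1[of "p * s - r * q" "i * v - u * j"] by (simp add: mult.commute)
  moreover have "L a p q \<noteq> 0" using pq by auto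
  then have "b = L a r s / L a p q" using pq rs by (metis \<open>l > 0\<close> div_by_1 less_irrefl mult_divide_mult_cancel_left)
  then have "b = (of_int r + of_int s * a) / (of_int p + of_int q * a)" by (simp add: L_def)
  ultimately show ?thesis unfolding equivalent_irrationals_def by blast
qed

lemma line_group_2: "line_group \<eta> \<alpha> 2 = generate HomeoR {translation 1, translation \<alpha>}"
  by (simp add: line_group_def)

lemma line_group_Suc:
  assumes "n \<ge> 2" shows "line_group \<eta> \<alpha> (Suc n) = line_extension \<eta> (line_group \<eta> \<alpha> n)"
proof -
  have "Suc n - 2 = Suc (n - 2)" using assms by simp
  then show ?thesis by (simp add: line_group_def line_extension_def)
qed

lemma line_group_subgroup: "unit_chart \<eta> \<Longrightarrow> subgroup (line_group \<eta> \<alpha> n) HomeoR"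
  unfolding unit_chart_def using subgroup_line_group by blast

lemma translation_1_in_line_group:
  assumes "n \<ge> 2" shows "translation 1 \<in> line_group \<eta> \<alpha> n"
  using assms
proof (induction n rule: nat_induct_at_least)
  case base
  then show ?case unfolding line_group_2 by (auto intro: generate.incl)
next
  case (Suc n)
  then show ?case unfolding line_group_Suc[OF Suc.hyps] line_extension_def by (auto intro: generate.incl)
qed

lemma line_group_commute:
  assumes "unit_chart \<eta>" "n \<ge> 2" "\<sigma> \<in> line_group \<eta> \<alpha> n" "\<tau> \<in> line_group \<eta> \<alpha> n"
  shows "\<sigma> (\<tau> x) = \<tau> (\<sigma> x)"
  using assms(2-)
proof (induction n arbitrary: \<sigma> \<tau> x rule: nat_induct_at_least)
  case base
  then obtain i j u v where "\<sigma> = translation (of_int i + of_int j * \<alpha>)" "\<tau> = translation (of_int u + of_int v * \<alpha>)"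
    unfolding line_group_2 generate_translations by blast
  then show ?case by (simp add: translation_def)
next
  case (Suc n)
  obtain i \<sigma>' where \<sigma>: "\<sigma>' \<in> line_group \<eta> \<alpha> n" "\<sigma> = translation (of_int i) \<circ> interval_lift \<eta> \<sigma>'"
    using Suc.prems(1) unfolding line_group_Suc[OF Suc.hyps] line_extension_eq[OF assms(1) line_group_subgroup[OF assms(1)]]
    by blast
  obtain j \<tau>' where \<tau>: "\<tau>' \<in> line_group \<eta> \<alpha> n" "\<tau> = translation (of_int j) \<circ> interval_lift \<eta> \<tau>'"
    using Suc.prems(2) unfolding line_group_Suc[OF Suc.hyps] line_extension_eq[OF assms(1) line_group_subgroup[OF assms(1)]]
    by blast
  have "\<sigma>' \<circ> \<tau>' = \<tau>' \<circ> \<sigma>'" using Suc.IH[OF \<sigma>(1) \<tau>(1)] by auto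
  then have "interval_lift \<eta> \<sigma>' (interval_lift \<eta> \<tau>' x) = interval_lift \<eta> \<tau>' (interval_lift \<eta> \<sigma>' x)"
    using interval_lift_comp[OF assms(1)] by metis
  then show ?case
    by (simp add: \<sigma>(2) \<tau>(2) translation_def interval_lift_add_int[OF assms(1)])
qed

text \<open>Non-trivial translations have no fixed point, but lifts do. So \<open>n = 2\<close> is visible in the
  dynamics.\<close>

lemma translation_group_not_extension:
  assumes \<eta>: "unit_chart \<eta>" and "n \<ge> 2" and \<rho>: "\<rho> \<in> carrier HomeoR"
  shows "\<not> intertwines HomeoR \<rho> (line_group \<eta> \<alpha> 2) (line_group \<eta> \<beta> (Suc n))"
proof
  assume inter: "intertwines HomeoR \<rho> (line_group \<eta> \<alpha> 2) (line_group \<eta> \<beta> (Suc n))"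
  have sub: "line_group \<eta> \<gamma> m \<subseteq> carrier HomeoR" for \<gamma> m
    using line_group_subgroup[OF \<eta>] subgroup.subset by blast
  let ?\<tau> = "interval_lift \<eta> (translation 1)"
  have "?\<tau> \<in> line_group \<eta> \<beta> (Suc n)"
    unfolding line_group_Suc[OF \<open>n \<ge> 2\<close>] line_extension_def
    using translation_1_in_line_group[OF \<open>n \<ge> 2\<close>] by (auto intro: generate.incl)
  then obtain \<sigma> where \<sigma>: "\<sigma> \<in> line_group \<eta> \<alpha> 2" "\<And>x. \<rho> (\<sigma> x) = ?\<tau> (\<rho> x)"
    using inter unfolding intertwines_HomeoR_iff[OF \<rho> sub sub] by blast
  then obtain a where a: "\<sigma> = translation a" unfolding line_group_2 generate_translations by blast
  obtain x y where x: "\<rho> x = 0" and y: "\<rho> y = \<eta> 0" using \<rho> by (metis HomeoR_iff surjD)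
  have "a = 0"
    using \<sigma>(2)[of x] HomeoR_eq[OF \<rho>, of "\<sigma> x" x] by (simp add: x interval_lift_0 a translation_def)
  then show False
    using \<sigma>(2)[of y] y interval_lift_chart_0[OF \<eta>, of "translation 1" 0] unit_chart_eq[OF \<eta>, of 1 0]
    by (simp add: a translation_def)
qed

text \<open>Induction on the number of extensions: rigidity removes one extension from both groups, and
  the translation groups at the bottom carry the arithmetic of the irrational numbers.\<close>

proposition line_group_rigidity:
  assumes \<eta>: "unit_chart \<eta>" and irr: "\<alpha> \<notin> \<rat>" "\<beta> \<notin> \<rat>" and "n \<ge> 2" "m \<ge> 2"
    and "\<rho> \<in> carrier HomeoR" "intertwines HomeoR \<rho> (line_group \<eta> \<alpha> n) (line_group \<eta> \<beta> m)"
  shows "n = m \<and> equivalent_irrationals \<alpha> \<beta>"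
  using assms(4-)
proof (induction n arbitrary: m \<rho> rule: nat_induct_at_least)
  case base
  have "m = 2"
  proof (rule ccontr)
    assume "m \<noteq> 2"
    then have "m = Suc (m - 1)" "m - 1 \<ge> 2" using base.prems(1) by auto
    then show False using translation_group_not_extension[OF \<eta> _ base.prems(2)] base.prems(3) by metis
  qed
  then show ?case using translation_group_rigidity[OF irr] base.prems by (auto simp: line_group_2)
next
  case (Suc n)
  have sub: "line_group \<eta> \<gamma> l \<subseteq> carrier HomeoR" for \<gamma> l
    using line_group_subgroup[OF \<eta>] subgroup.subset by blast
  have "m \<noteq> 2"
  proof
    assume "m = 2"
    then show False
      using translation_group_not_extension[OF \<eta> Suc.hyps R.inv_closed[OF Suc.prems(2)]]
        R.intertwines_inv[OF Suc.prems(3,2) sub sub] by blast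
  qed
  then obtain m' where m': "m = Suc m'" "m' \<ge> 2" using Suc.prems(1) by (cases m) auto
  have "intertwines HomeoR \<rho> (line_extension \<eta> (line_group \<eta> \<alpha> n)) (line_extension \<eta> (line_group \<eta> \<beta> m'))"
    using Suc.prems(3) unfolding m'(1) line_group_Suc[OF Suc.hyps] line_group_Suc[OF m'(2)] .
  then obtain \<rho>' where "\<rho>' \<in> carrier HomeoR" "intertwines HomeoR \<rho>' (line_group \<eta> \<alpha> n) (line_group \<eta> \<beta> m')"
    using extension_rigidity[OF \<eta> \<eta> refl line_group_subgroup[OF \<eta>] line_group_subgroup[OF \<eta>]
        translation_1_in_line_group[OF Suc.hyps] translation_1_in_line_group[OF m'(2)] Suc.prems(2)] by blast
  then show ?case using Suc.IH[OF m'(2)] m'(1) by blast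
qed

section \<open>Homeomorphisms of the circle and their lifts\<close>

lemma circ_eq_iff: "circ s = circ t \<longleftrightarrow> (\<exists>i. s = t + of_int i)"
proof -
  have "circ s = circ t \<longleftrightarrow> (\<exists>i::int. 2 * pi * s = 2 * pi * t + 2 * pi * of_int i)"
    by (simp add: circ_def complex_eq_iff conj_commute flip: sin_cos_eq_iff)
  also have "\<dots> \<longleftrightarrow> (\<exists>i. s = t + of_int i)"
    by (simp flip: distrib_left)
  finally show ?thesis .
qed

lemma circ_in_sphere: "circ t \<in> sphere 0 1"
  by (simp add: circ_def)

lemma circ_add_int: "circ (t + of_int i) = circ t" "circ (t + 1) = circ t"
proof -
  show "circ (t + of_int i) = circ t" for i by (auto simp: circ_eq_iff)
  from this[of 1] show "circ (t + 1) = circ t" by simp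
qed

lemma circ_onto:
  assumes "z \<in> sphere 0 1" obtains t where "z = circ t"
proof -
  have "cis (Arg z) = z" using assms cis_Arg[of z] by (cases "z = 0") (auto simp: sgn_div_norm)
  then have "z = circ (Arg z / (2 * pi))" by (simp add: circ_def)
  then show ?thesis by (rule that)
qed

lemma continuous_circ: "continuous_on A circ"
  unfolding circ_def by (intro continuous_intros)

lemma extensional_sphere_eqI:
  assumes "f \<in> extensional (sphere 0 1)" "h \<in> extensional (sphere 0 1)" "\<And>t. f (circ t) = h (circ t)"
  shows "f = h"
  using assms by (metis circ_onto extensionalityI)

lemma integer_valued_constant:
  fixes d :: "real \<Rightarrow> real"
  assumes "continuous_on UNIV d" "\<And>t. d t \<in> \<int>" shows "d s = d t"
proof -
  have "d constant_on UNIV"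
  proof (rule continuous_discrete_range_constant[OF connected_UNIV assms(1)])
    fix x :: real
    have "1 \<le> norm (d y - d x)" if "d y \<noteq> d x" for y
    proof -
      obtain i j where "d y = of_int i" "d x = of_int j" using assms(2) by (meson Ints_cases)
      moreover have "i \<noteq> j" using calculation that by auto
      ultimately have "d y - d x = of_int (i - j)" "1 \<le> \<bar>i - j\<bar>" by auto
      then show ?thesis by (metis of_int_1_le_iff of_int_abs real_norm_def)
    qed
    then show "\<exists>e>0. \<forall>y. y \<in> UNIV \<and> d y \<noteq> d x \<longrightarrow> e \<le> norm (d y - d x)"
      by (intro exI[of _ 1]) auto
  qed
  then show ?thesis by (auto simp: constant_on_def)
qed

text \<open>The condition on \<open>t + 1\<close> says that the lift has degree one. Together with the
  bijectivity of \<open>F\<close> it makes \<open>f\<close> bijective on the circle.\<close>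

definition circle_lift :: "(complex \<Rightarrow> complex) \<Rightarrow> (real \<Rightarrow> real) \<Rightarrow> bool"
  where "circle_lift f F \<longleftrightarrow>
    F \<in> carrier HomeoR \<and> (\<forall>t. F (t + 1) = F t + 1) \<and> (\<forall>t. f (circ t) = circ (F t))"

lemma equivariant_add_int:
  fixes F :: "real \<Rightarrow> real"
  assumes "\<And>t. F (t + 1) = F t + 1" shows "F (t + of_int i) = F t + of_int i"
proof (induction i rule: int_induct[of _ 0])
  case base then show ?case by simp
next
  case (step1 i) then show ?case using assms[of "t + of_int i"] by (simp add: add.assoc)
next
  case (step2 i) then show ?case using assms[of "t + of_int (i - 1)"] by (simp add: algebra_simps)
qed

lemma circle_lift_add_int: "circle_lift f F \<Longrightarrow> F (t + of_int i) = F t + of_int i"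
  unfolding circle_lift_def using equivariant_add_int[of F] by blast

text \<open>The degree of a lift is a positive integer by continuity and monotonicity. If it were at
  least two, the lift would take the value \<open>F 0 + 1\<close> strictly inside the unit interval, against the
  injectivity of \<open>f\<close>.\<close>

lemma HomeoS1_lift:
  assumes "f \<in> carrier HomeoS1" obtains F where "circle_lift f F"
proof -
  have "\<exists>f'. homeomorphism (sphere 0 1) (sphere 0 1) f f'"
    and "\<exists>F. continuous_on UNIV F \<and> strict_mono F \<and> (\<forall>t. f (circ t) = circ (F t))"
    using assms by (simp_all add: HomeoS1_def)
  then obtain f' F where f': "homeomorphism (sphere 0 1) (sphere 0 1) f f'"
    and cont: "continuous_on UNIV F" and mono: "strict_mono F" and lift: "\<And>t. f (circ t) = circ (F t)"
    by blast
  have inj: "inj_on f (sphere 0 1)" 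
    using homeomorphism_apply1[OF f'] by (rule inj_on_inverseI)
  have cont': "continuous_on UNIV (\<lambda>t. F (t + 1) - F t)"
    by (intro continuous_intros continuous_on_compose2[OF cont]) auto
  have int: "F (t + 1) - F t \<in> \<int>" for t
  proof -
    have "circ (F (t + 1)) = circ (F t)" by (simp flip: lift add: circ_add_int)
    then show ?thesis by (auto simp: circ_eq_iff)
  qed
  obtain m where m: "F 1 - F 0 = of_int m" using int[of 0] by (auto elim: Ints_cases)
  have step: "F (t + 1) = F t + of_int m" for t
    using integer_valued_constant[OF cont' int, of t 0] m by simp
  have "F 0 < F 1" using mono by (simp add: strict_mono_less)
  then have "m \<ge> 1" using m by simp
  have "m < 2"
  proof (rule ccontr)
    assume "\<not> m < 2"
    then have "F 0 \<le> F 0 + 1" "F 0 + 1 < F 1" using m by linarith+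
    then obtain s where s: "0 \<le> s" "s \<le> 1" "F s = F 0 + 1"
      using IVT'[of F 0 "F 0 + 1" 1] continuous_on_subset[OF cont] by auto
    then have "f (circ s) = f (circ 0)" by (simp add: lift circ_add_int)
    then have "circ s = circ 0" using inj circ_in_sphere by (meson inj_onD)
    then obtain i where "s = of_int i" by (auto simp: circ_eq_iff)
    then have "s = 0 \<or> s = 1" using s by auto
    then show False using s \<open>F 0 + 1 < F 1\<close> by auto
  qed
  then have "m = 1" using \<open>m \<ge> 1\<close> by simp
  then have step1: "F (t + 1) = F t + 1" for t using step by simp
  have "\<exists>t. F t = y" for y
  proof -
    have n: "F (of_int i) = F 0 + of_int i" for i using equivariant_add_int[of F 0 i] step1 by simp
    define i where "i = \<lfloor>y - F 0\<rfloor>"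
    have "F (of_int i) \<le> y" "y \<le> F (of_int (i + 1))" unfolding n i_def by linarith+
    then show ?thesis
      using IVT'[of F "of_int i" y "of_int (i + 1)"] continuous_on_subset[OF cont] by auto
  qed
  then have "F \<in> carrier HomeoR" using mono by (intro HomeoR_I) (auto simp: surj_def eq_commute)
  then show ?thesis using that step1 lift unfolding circle_lift_def by blast
qed

lemma HomeoS1_extensional: "f \<in> carrier HomeoS1 \<Longrightarrow> f \<in> extensional (sphere 0 1)"
  by (simp add: HomeoS1_def)

lemma circle_lift_bij:
  assumes "circle_lift f F" shows "bij_betw f (sphere 0 1) (sphere 0 1)"
proof (rule bij_betwI')
  have F: "F \<in> carrier HomeoR" and lift: "\<And>t. f (circ t) = circ (F t)"
    using assms by (auto simp: circle_lift_def)
  fix w z :: complex assume "w \<in> sphere 0 1" "z \<in> sphere 0 1"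
  then obtain s t where st: "w = circ s" "z = circ t" by (metis circ_onto)
  show "f w = f z \<longleftrightarrow> w = z"
    unfolding st lift circ_eq_iff
    by (simp only: HomeoR_eq[OF F] flip: circle_lift_add_int[OF assms])
  show "f w \<in> sphere 0 1" unfolding st lift by (rule circ_in_sphere)
  obtain u where "F u = s" using F by (metis HomeoR_iff surjD)
  then show "\<exists>z\<in>sphere 0 1. w = f z" using lift st circ_in_sphere by metis
qed

text \<open>The circle is the image of the compact interval \<open>{0..1}\<close>, so that preimages of closed sets under
  \<open>f\<close> are images of compact sets; this is the continuity of \<open>f\<close>.\<close>

lemma HomeoS1_I:
  assumes ext: "f \<in> extensional (sphere 0 1)" and F: "circle_lift f F"
  shows "f \<in> carrier HomeoS1"
proof -
  have lift: "f (circ t) = circ (F t)" and FC: "F \<in> carrier HomeoR" for t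
    using F by (auto simp: circle_lift_def)
  have "continuous_on (sphere 0 1) f"
    unfolding continuous_on_closed_vimage[OF closed_sphere]
  proof (intro allI impI)
    fix B :: "complex set" assume B: "closed B"
    define A where "A = {0..1} \<inter> (circ \<circ> F) -` B"
    have "continuous_on {0..1} F"
      using continuous_on_subset[OF HomeoR_continuous[OF FC]] by simp
    then have "continuous_on {0..1} (circ \<circ> F)" by (rule continuous_on_compose[OF _ continuous_circ])
    then have "closed A" unfolding A_def by (rule continuous_closed_preimage[OF _ closed_atLeastAtMost B])
    then have "compact ({0..1} \<inter> A)" by (rule compact_Int_closed[OF compact_Icc])
    then have "compact A" by (simp add: A_def Int_left_absorb)
    then have "compact (circ ` A)" using continuous_circ compact_continuous_image by blast
    moreover have "circ ` A = f -` B \<inter> sphere 0 1"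
    proof
      show "circ ` A \<subseteq> f -` B \<inter> sphere 0 1" using circ_in_sphere by (auto simp: A_def lift)
      show "f -` B \<inter> sphere 0 1 \<subseteq> circ ` A"
      proof
        fix z assume z: "z \<in> f -` B \<inter> sphere 0 1"
        then obtain t where "z = circ t" using circ_onto by blast
        then have "z = circ (frac t)" by (auto simp: circ_eq_iff frac_def intro: exI[of _ "\<lfloor>t\<rfloor>"])
        then show "z \<in> circ ` A"
          using z frac_ge_0[of t] less_imp_le[OF frac_lt_1[of t]] by (auto simp: A_def lift[symmetric])
      qed
    qed
    ultimately show "closed (f -` B \<inter> sphere 0 1)" by (metis compact_imp_closed)
  qed
  then have "\<exists>f'. homeomorphism (sphere 0 1) (sphere 0 1) f f'"
    using circle_lift_bij[OF F] by (intro homeomorphism_compact) (auto simp: bij_betw_def)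
  moreover have "\<exists>F. continuous_on UNIV F \<and> strict_mono F \<and> (\<forall>t. f (circ t) = circ (F t))"
    using HomeoR_continuous[OF FC] FC lift unfolding HomeoR_iff by blast
  ultimately show ?thesis using ext by (simp add: HomeoS1_def)
qed

lemma circle_lift_id: "circle_lift (\<lambda>z\<in>sphere 0 1. z) id"
  using circ_in_sphere by (simp add: circle_lift_def HomeoR_id)

lemma circle_lift_compose:
  "circle_lift f F \<Longrightarrow> circle_lift h H \<Longrightarrow> circle_lift (compose (sphere 0 1) f h) (F \<circ> H)"
  using circ_in_sphere by (simp add: circle_lift_def HomeoR_comp compose_def)

lemma circle_lift_inv_into:
  assumes "circle_lift f F"
  shows "circle_lift (\<lambda>z\<in>sphere 0 1. inv_into (sphere 0 1) f z) (inv\<^bsub>HomeoR\<^esub> F)"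
proof -
  let ?F' = "inv\<^bsub>HomeoR\<^esub> F"
  have F: "F \<in> carrier HomeoR" and lift: "\<And>t. f (circ t) = circ (F t)"
    using assms by (auto simp: circle_lift_def)
  have "?F' (t + 1) = ?F' t + 1" for t
  proof -
    have "F (?F' t + 1) = t + 1" using assms by (simp add: circle_lift_def HomeoR_inv_apply)
    then show ?thesis using HomeoR_inv_apply(2)[OF F, of "?F' t + 1"] by simp
  qed
  moreover have "inv_into (sphere 0 1) f (circ t) = circ (?F' t)" for t
  proof -
    have "f (circ (?F' t)) = circ t" by (simp add: lift HomeoR_inv_apply F)
    moreover have "inj_on f (sphere 0 1)" using circle_lift_bij[OF assms] by (rule bij_betw_imp_inj_on)
    ultimately show ?thesis using circ_in_sphere by (metis inv_into_f_f)
  qed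
  ultimately show ?thesis using F circ_in_sphere by (simp add: circle_lift_def)
qed

lemma HomeoS1_Bij:
  assumes "f \<in> carrier HomeoS1" shows "f \<in> Bij (sphere 0 1)"
proof -
  obtain F where "circle_lift f F" using HomeoS1_lift[OF assms] .
  then show ?thesis using circle_lift_bij HomeoS1_extensional[OF assms] by (simp add: Bij_def)
qed

lemma HomeoS1_mult:
  assumes "f \<in> carrier HomeoS1" "h \<in> carrier HomeoS1"
  shows "f \<otimes>\<^bsub>HomeoS1\<^esub> h = compose (sphere 0 1) f h"
proof -
  have "f \<otimes>\<^bsub>HomeoS1\<^esub> h = f \<otimes>\<^bsub>BijGroup (sphere 0 1)\<^esub> h" by (simp add: HomeoS1_def)
  also have "\<dots> = compose (sphere 0 1) f h"
    using assms[THEN HomeoS1_Bij] by (simp add: BijGroup_def)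
  finally show ?thesis .
qed

lemma HomeoS1_one: "\<one>\<^bsub>HomeoS1\<^esub> = (\<lambda>z\<in>sphere 0 1. z)"
  by (simp add: HomeoS1_def BijGroup_def)

lemma group_HomeoS1: "group HomeoS1"
proof -
  have "subgroup (carrier HomeoS1) (BijGroup (sphere 0 1))"
  proof
    show "carrier HomeoS1 \<subseteq> carrier (BijGroup (sphere 0 1))"
      using HomeoS1_Bij by (auto simp: BijGroup_def)
    show "f \<otimes>\<^bsub>BijGroup (sphere 0 1)\<^esub> h \<in> carrier HomeoS1"
      if f: "f \<in> carrier HomeoS1" and h: "h \<in> carrier HomeoS1" for f h
    proof -
      have "f \<otimes>\<^bsub>BijGroup (sphere 0 1)\<^esub> h = compose (sphere 0 1) f h"
        using f[THEN HomeoS1_Bij] h[THEN HomeoS1_Bij] by (simp add: BijGroup_def)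
      moreover obtain F H where "circle_lift f F" "circle_lift h H" using f h HomeoS1_lift by metis
      ultimately show ?thesis
        using HomeoS1_I[OF compose_extensional circle_lift_compose] by simp
    qed
    show "\<one>\<^bsub>BijGroup (sphere 0 1)\<^esub> \<in> carrier HomeoS1"
      using HomeoS1_I[OF restrict_extensional circle_lift_id] by (simp add: BijGroup_def)
    show "inv\<^bsub>BijGroup (sphere 0 1)\<^esub> f \<in> carrier HomeoS1" if f: "f \<in> carrier HomeoS1" for f
    proof -
      obtain F where "circle_lift f F" using f HomeoS1_lift by metis
      then show ?thesis
        using HomeoS1_I[OF restrict_extensional circle_lift_inv_into] inv_BijGroup[OF HomeoS1_Bij[OF f]] by simp
    qed
  qed
  from subgroup.subgroup_is_group[OF this group_BijGroup] show ?thesis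
    by (simp add: HomeoS1_def)
qed

interpretation S: group HomeoS1 by (rule group_HomeoS1)

lemma HomeoS1_eqI:
  assumes "f \<in> carrier HomeoS1" "h \<in> carrier HomeoS1" "\<And>t. f (circ t) = h (circ t)"
  shows "f = h"
  by (rule extensional_sphere_eqI[OF assms(1,2)[THEN HomeoS1_extensional] assms(3)])

lemma HomeoS1_mult_apply:
  "f \<in> carrier HomeoS1 \<Longrightarrow> h \<in> carrier HomeoS1 \<Longrightarrow> (f \<otimes>\<^bsub>HomeoS1\<^esub> h) (circ t) = f (h (circ t))"
  using circ_in_sphere by (simp add: HomeoS1_mult compose_def)

lemma HomeoS1_one_apply: "\<one>\<^bsub>HomeoS1\<^esub> (circ t) = circ t"
  using circ_in_sphere by (simp add: HomeoS1_one)

lemma HomeoS1_apply_in_sphere: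
  assumes "f \<in> carrier HomeoS1" "z \<in> sphere 0 1" shows "f z \<in> sphere 0 1"
  using Bij_imp_funcset[OF HomeoS1_Bij[OF assms(1)]] assms(2) by (rule funcset_mem)

lemma HomeoS1_inv_apply:
  assumes f: "f \<in> carrier HomeoS1" and z: "z \<in> sphere 0 1"
  shows "f ((inv\<^bsub>HomeoS1\<^esub> f) z) = z" "(inv\<^bsub>HomeoS1\<^esub> f) (f z) = z"
proof -
  obtain t where t: "z = circ t" using z circ_onto by blast
  show "f ((inv\<^bsub>HomeoS1\<^esub> f) z) = z" "(inv\<^bsub>HomeoS1\<^esub> f) (f z) = z"
    using HomeoS1_mult_apply[OF f S.inv_closed[OF f], of t] HomeoS1_mult_apply[OF S.inv_closed[OF f] f, of t]
    by (simp_all add: t f HomeoS1_one_apply)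
qed



section \<open>Conjugacy of covered groups\<close>

text \<open>\<open>circ \<circ> P\<close> is a universal covering of the circle with deck group generated by \<open>D\<close>;
  \<open>K\<close> is the group of all lifts of elements of \<open>\<Gamma>\<close>. The conjugacy problem for \<open>\<Gamma>\<close> becomes the
  conjugacy problem for the pair \<open>(K, D)\<close>.\<close>

locale covered_group =
  fixes P D :: "real \<Rightarrow> real" and K :: "(real \<Rightarrow> real) set" and \<Gamma> :: "(complex \<Rightarrow> complex) set"
  assumes P: "P \<in> carrier HomeoR" and deck: "\<And>x. P (D x) = P x + 1"
    and K: "subgroup K HomeoR" and D: "D \<in> K" and \<Gamma>: "\<Gamma> \<subseteq> carrier HomeoS1"
    and lift: "\<And>\<gamma>. \<gamma> \<in> \<Gamma> \<Longrightarrow> \<exists>\<kappa>\<in>K. \<forall>x. \<gamma> (circ (P x)) = circ (P (\<kappa> x))"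
    and descend: "\<And>\<kappa>. \<kappa> \<in> K \<Longrightarrow> \<exists>\<gamma>\<in>\<Gamma>. \<forall>x. \<gamma> (circ (P x)) = circ (P (\<kappa> x))"
begin

lemma K_carrier: "K \<subseteq> carrier HomeoR"
  using K by (rule subgroup.subset)

lemma D_pow: "P ((D [^]\<^bsub>HomeoR\<^esub> (i :: int)) x) = P x + of_int i"
proof -
  have DC: "D \<in> carrier HomeoR" using D K_carrier by auto
  show ?thesis
  proof (induction i rule: int_induct[of _ 0])
    case base then show ?case by (simp add: HomeoR_one)
  next
    case (step1 i)
    have "(D [^]\<^bsub>HomeoR\<^esub> (i + 1)) x = D ((D [^]\<^bsub>HomeoR\<^esub> i) x)"
      using HomeoR_int_pow_add[OF DC, of 1 i] DC by (simp add: add.commute)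
    then show ?case using step1 deck by simp
  next
    case (step2 i)
    have "(D [^]\<^bsub>HomeoR\<^esub> i) x = D ((D [^]\<^bsub>HomeoR\<^esub> (i - 1)) x)"
      using HomeoR_int_pow_add[OF DC, of 1 "i - 1"] DC by simp
    then show ?case using step2 deck by simp
  qed
qed

lemma P_onto: obtains x where "t = P x"
  using P by (metis HomeoR_iff surjD)

lemma determined:
  assumes "\<gamma> \<in> carrier HomeoS1" "\<gamma>' \<in> carrier HomeoS1" "\<And>x. \<gamma> (circ (P x)) = \<gamma>' (circ (P x))"
  shows "\<gamma> = \<gamma>'"
  by (rule HomeoS1_eqI[OF assms(1,2)]) (metis P_onto assms(3))

text \<open>Two lifts of the same map differ by a deck transformation, which belongs to \<open>K\<close>.\<close>

lemma every_lift_in_K: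
  assumes "\<gamma> \<in> \<Gamma>" and \<kappa>: "\<kappa> \<in> carrier HomeoR" "\<And>x. \<gamma> (circ (P x)) = circ (P (\<kappa> x))"
  shows "\<kappa> \<in> K"
proof -
  obtain \<mu> where \<mu>: "\<mu> \<in> K" "\<And>x. \<gamma> (circ (P x)) = circ (P (\<mu> x))" using lift[OF assms(1)] by blast
  have \<mu>C: "\<mu> \<in> carrier HomeoR" using \<mu>(1) K_carrier by auto
  have "continuous_on UNIV (\<lambda>x. P (\<kappa> x) - P (\<mu> x))"
    using HomeoR_continuous[OF HomeoR_comp[OF P \<kappa>(1)]] HomeoR_continuous[OF HomeoR_comp[OF P \<mu>C]]
    by (intro continuous_on_diff) (simp_all add: comp_def)
  moreover have "P (\<kappa> x) - P (\<mu> x) \<in> \<int>" for x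
  proof -
    have "circ (P (\<kappa> x)) = circ (P (\<mu> x))" using \<kappa>(2) \<mu>(2) by metis
    then show ?thesis by (auto simp: circ_eq_iff)
  qed
  ultimately have const: "P (\<kappa> x) - P (\<mu> x) = P (\<kappa> 0) - P (\<mu> 0)"
    and int: "P (\<kappa> 0) - P (\<mu> 0) \<in> \<int>" for x
    using integer_valued_constant[of "\<lambda>x. P (\<kappa> x) - P (\<mu> x)"] by blast+
  obtain i where "P (\<kappa> 0) - P (\<mu> 0) = of_int i" using int by (auto elim: Ints_cases)
  then have "P (\<kappa> x) = P ((D [^]\<^bsub>HomeoR\<^esub> i) (\<mu> x))" for x using const[of x] D_pow[of i "\<mu> x"] by simp
  then have "\<kappa> = D [^]\<^bsub>HomeoR\<^esub> i \<circ> \<mu>" using HomeoR_eq[OF P] by auto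
  then show ?thesis using \<mu>(1) R.subgroup_int_pow_closed[OF K D, of i] K by (simp add: subgroup_HomeoR_iff)
qed

end

text \<open>A conjugacy of the circle lifts to a homeomorphism of the line that carries one deck
  generator to the other, and it then carries lifts to lifts. Conversely a homeomorphism of the line
  that matches the deck generators descends to the circle.\<close>

theorem topologically_conjugate_iff_covers:
  assumes "covered_group P D K \<Gamma>" and "covered_group P' D' K' \<Gamma>'"
  shows "topologically_conjugate \<Gamma> \<Gamma>' \<longleftrightarrow>
    (\<exists>H\<in>carrier HomeoR. intertwines HomeoR H K K' \<and> (\<forall>x. H (D x) = D' (H x)))"
proof -
  interpret A: covered_group P D K \<Gamma> by fact
  interpret B: covered_group P' D' K' \<Gamma>' by fact
  have correspond: "intertwines HomeoS1 \<phi> \<Gamma> \<Gamma>' \<longleftrightarrow> intertwines HomeoR H K K'"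
    if \<phi>: "\<phi> \<in> carrier HomeoS1" and H: "H \<in> carrier HomeoR"
      and \<phi>H: "\<And>x. \<phi> (circ (P x)) = circ (P' (H x))" for \<phi> H
  proof -
    let ?rel = "\<lambda>\<kappa> \<kappa>'. \<forall>x. H (\<kappa> x) = \<kappa>' (H x)"
    have conj_down: "\<phi> \<otimes>\<^bsub>HomeoS1\<^esub> \<gamma> = \<gamma>' \<otimes>\<^bsub>HomeoS1\<^esub> \<phi>"
      if "\<gamma> \<in> \<Gamma>" "\<gamma>' \<in> \<Gamma>'" and \<gamma>: "\<And>x. \<gamma> (circ (P x)) = circ (P (\<kappa> x))"
        "\<And>x. \<gamma>' (circ (P' x)) = circ (P' (\<kappa>' x))" and r: "?rel \<kappa> \<kappa>'" for \<gamma> \<gamma>' \<kappa> \<kappa>'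
    proof -
      have c: "\<gamma> \<in> carrier HomeoS1" "\<gamma>' \<in> carrier HomeoS1" using that A.\<Gamma> B.\<Gamma> by auto
      show ?thesis
        by (rule A.determined) (use c \<phi> in \<open>simp_all add: HomeoS1_mult_apply \<phi>H \<gamma> r\<close>)
    qed
    have ex_up: "\<exists>\<kappa>'\<in>carrier HomeoR. ?rel \<kappa> \<kappa>'" if "\<kappa> \<in> K" for \<kappa>
      using H that A.K_carrier
      by (intro bexI[of _ "H \<circ> \<kappa> \<circ> inv\<^bsub>HomeoR\<^esub> H"] HomeoR_comp) (auto simp: HomeoR_inv_apply)
    have ex_down: "\<exists>\<kappa>\<in>carrier HomeoR. ?rel \<kappa> \<kappa>'" if "\<kappa>' \<in> K'" for \<kappa>'
      using H that B.K_carrier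
      by (intro bexI[of _ "inv\<^bsub>HomeoR\<^esub> H \<circ> \<kappa>' \<circ> H"] HomeoR_comp) (auto simp: HomeoR_inv_apply)
    have conj_up: "\<kappa>' \<in> K'"
      if "\<gamma> \<in> \<Gamma>" "\<gamma>' \<in> \<Gamma>'" "\<phi> \<otimes>\<^bsub>HomeoS1\<^esub> \<gamma> = \<gamma>' \<otimes>\<^bsub>HomeoS1\<^esub> \<phi>"
        "\<And>x. \<gamma> (circ (P x)) = circ (P (\<kappa> x))" "\<kappa>' \<in> carrier HomeoR" "?rel \<kappa> \<kappa>'" for \<gamma> \<gamma>' \<kappa> \<kappa>'
    proof (rule B.every_lift_in_K[OF that(2,5)])
      fix y
      have c: "\<gamma> \<in> carrier HomeoS1" "\<gamma>' \<in> carrier HomeoS1" using that A.\<Gamma> B.\<Gamma> by auto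
      obtain x where y: "y = H x" using H by (metis HomeoR_iff surjD)
      have "\<gamma>' (\<phi> (circ (P x))) = \<phi> (\<gamma> (circ (P x)))"
        using that(3) c \<phi> by (metis HomeoS1_mult_apply)
      then show "\<gamma>' (circ (P' y)) = circ (P' (\<kappa>' y))"
        using that(4,6) by (simp add: y \<phi>H)
    qed
    have conj_up': "\<kappa> \<in> K"
      if "\<gamma> \<in> \<Gamma>" "\<gamma>' \<in> \<Gamma>'" "\<phi> \<otimes>\<^bsub>HomeoS1\<^esub> \<gamma> = \<gamma>' \<otimes>\<^bsub>HomeoS1\<^esub> \<phi>"
        "\<And>x. \<gamma>' (circ (P' x)) = circ (P' (\<kappa>' x))" "\<kappa> \<in> carrier HomeoR" "?rel \<kappa> \<kappa>'" for \<gamma> \<gamma>' \<kappa> \<kappa>'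
    proof (rule A.every_lift_in_K[OF that(1,5)])
      fix x
      have c: "\<gamma> \<in> carrier HomeoS1" "\<gamma>' \<in> carrier HomeoS1" using that A.\<Gamma> B.\<Gamma> by auto
      have "\<phi> (\<gamma> (circ (P x))) = \<gamma>' (\<phi> (circ (P x)))"
        using that(3) c \<phi> by (metis HomeoS1_mult_apply)
      also have "\<dots> = \<phi> (circ (P (\<kappa> x)))" using that(4,6) by (simp add: \<phi>H)
      finally show "\<gamma> (circ (P x)) = circ (P (\<kappa> x))"
        using HomeoS1_inv_apply(2)[OF \<phi>] circ_in_sphere HomeoS1_apply_in_sphere[OF c(1)] by metis
    qed
    show ?thesis
      unfolding intertwines_HomeoR_iff[OF H A.K_carrier B.K_carrier] unfolding intertwines_def
    proof (intro iffI conjI ballI; elim conjE)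
      fix \<kappa> assume \<kappa>: "\<kappa> \<in> K" and down: "\<forall>\<gamma>\<in>\<Gamma>. \<exists>\<gamma>'\<in>\<Gamma>'. \<phi> \<otimes>\<^bsub>HomeoS1\<^esub> \<gamma> = \<gamma>' \<otimes>\<^bsub>HomeoS1\<^esub> \<phi>"
      obtain \<gamma> where \<gamma>: "\<gamma> \<in> \<Gamma>" "\<And>x. \<gamma> (circ (P x)) = circ (P (\<kappa> x))" using A.descend[OF \<kappa>] by blast
      obtain \<gamma>' where \<gamma>': "\<gamma>' \<in> \<Gamma>'" "\<phi> \<otimes>\<^bsub>HomeoS1\<^esub> \<gamma> = \<gamma>' \<otimes>\<^bsub>HomeoS1\<^esub> \<phi>" using down \<gamma>(1) by blast
      obtain \<kappa>' where \<kappa>': "\<kappa>' \<in> carrier HomeoR" "?rel \<kappa> \<kappa>'" using ex_up[OF \<kappa>] by blast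
      have "\<kappa>' \<in> K'" by (rule conj_up[OF \<gamma>(1) \<gamma>' \<gamma>(2) \<kappa>'])
      then show "\<exists>\<kappa>'\<in>K'. ?rel \<kappa> \<kappa>'" using \<kappa>'(2) by blast
    next
      fix \<kappa>' assume \<kappa>': "\<kappa>' \<in> K'" and up: "\<forall>\<gamma>'\<in>\<Gamma>'. \<exists>\<gamma>\<in>\<Gamma>. \<phi> \<otimes>\<^bsub>HomeoS1\<^esub> \<gamma> = \<gamma>' \<otimes>\<^bsub>HomeoS1\<^esub> \<phi>"
      obtain \<gamma>' where \<gamma>': "\<gamma>' \<in> \<Gamma>'" "\<And>x. \<gamma>' (circ (P' x)) = circ (P' (\<kappa>' x))" using B.descend[OF \<kappa>'] by blast
      obtain \<gamma> where \<gamma>: "\<gamma> \<in> \<Gamma>" "\<phi> \<otimes>\<^bsub>HomeoS1\<^esub> \<gamma> = \<gamma>' \<otimes>\<^bsub>HomeoS1\<^esub> \<phi>" using up \<gamma>'(1) by blast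
      obtain \<kappa> where \<kappa>: "\<kappa> \<in> carrier HomeoR" "?rel \<kappa> \<kappa>'" using ex_down[OF \<kappa>'] by blast
      have "\<kappa> \<in> K" by (rule conj_up'[OF \<gamma>(1) \<gamma>'(1) \<gamma>(2) \<gamma>'(2) \<kappa>])
      then show "\<exists>\<kappa>\<in>K. ?rel \<kappa> \<kappa>'" using \<kappa>(2) by blast
    next
      fix \<gamma> assume \<gamma>: "\<gamma> \<in> \<Gamma>" and up: "\<forall>\<kappa>\<in>K. \<exists>\<kappa>'\<in>K'. ?rel \<kappa> \<kappa>'"
      obtain \<kappa> where \<kappa>: "\<kappa> \<in> K" "\<And>x. \<gamma> (circ (P x)) = circ (P (\<kappa> x))" using A.lift[OF \<gamma>] by blast
      obtain \<kappa>' where \<kappa>': "\<kappa>' \<in> K'" "?rel \<kappa> \<kappa>'" using up \<kappa>(1) by blast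
      obtain \<gamma>' where \<gamma>': "\<gamma>' \<in> \<Gamma>'" "\<And>x. \<gamma>' (circ (P' x)) = circ (P' (\<kappa>' x))"
        using B.descend[OF \<kappa>'(1)] by blast
      show "\<exists>\<gamma>'\<in>\<Gamma>'. \<phi> \<otimes>\<^bsub>HomeoS1\<^esub> \<gamma> = \<gamma>' \<otimes>\<^bsub>HomeoS1\<^esub> \<phi>"
        using conj_down[OF \<gamma> \<gamma>'(1) \<kappa>(2) \<gamma>'(2) \<kappa>'(2)] \<gamma>'(1) by blast
    next
      fix \<gamma>' assume \<gamma>': "\<gamma>' \<in> \<Gamma>'" and down: "\<forall>\<kappa>'\<in>K'. \<exists>\<kappa>\<in>K. ?rel \<kappa> \<kappa>'"
      obtain \<kappa>' where \<kappa>': "\<kappa>' \<in> K'" "\<And>x. \<gamma>' (circ (P' x)) = circ (P' (\<kappa>' x))" using B.lift[OF \<gamma>'] by blast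
      obtain \<kappa> where \<kappa>: "\<kappa> \<in> K" "?rel \<kappa> \<kappa>'" using down \<kappa>'(1) by blast
      obtain \<gamma> where \<gamma>: "\<gamma> \<in> \<Gamma>" "\<And>x. \<gamma> (circ (P x)) = circ (P (\<kappa> x))" using A.descend[OF \<kappa>(1)] by blast
      show "\<exists>\<gamma>\<in>\<Gamma>. \<phi> \<otimes>\<^bsub>HomeoS1\<^esub> \<gamma> = \<gamma>' \<otimes>\<^bsub>HomeoS1\<^esub> \<phi>"
        using conj_down[OF \<gamma>(1) \<gamma>' \<gamma>(2) \<kappa>'(2) \<kappa>(2)] \<gamma>(1) by blast
    qed
  qed
  have "topologically_conjugate \<Gamma> \<Gamma>' \<longleftrightarrow> (\<exists>\<phi>\<in>carrier HomeoS1. intertwines HomeoS1 \<phi> \<Gamma> \<Gamma>')"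
    unfolding topologically_conjugate_def
    by (rule bex_cong[OF refl]) (simp add: S.conjugate_eq_iff_intertwines A.\<Gamma> B.\<Gamma>)
  also have "\<dots> \<longleftrightarrow> (\<exists>H\<in>carrier HomeoR. intertwines HomeoR H K K' \<and> (\<forall>x. H (D x) = D' (H x)))"
  proof
    assume "\<exists>\<phi>\<in>carrier HomeoS1. intertwines HomeoS1 \<phi> \<Gamma> \<Gamma>'"
    then obtain \<phi> where \<phi>: "\<phi> \<in> carrier HomeoS1" "intertwines HomeoS1 \<phi> \<Gamma> \<Gamma>'" by blast
    obtain F where F: "circle_lift \<phi> F" using \<phi>(1) HomeoS1_lift by blast
    define H where "H = inv\<^bsub>HomeoR\<^esub> P' \<circ> F \<circ> P"
    have H: "H \<in> carrier HomeoR"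
      unfolding H_def using F A.P B.P by (intro HomeoR_comp) (auto simp: circle_lift_def)
    have P'H: "P' (H x) = F (P x)" for x by (simp add: H_def HomeoR_inv_apply B.P)
    have "P' (H (D x)) = P' (D' (H x))" for x
      using F by (simp add: P'H A.deck B.deck circle_lift_def)
    then have "H (D x) = D' (H x)" for x using HomeoR_eq[OF B.P] by blast
    moreover have "\<phi> (circ (P x)) = circ (P' (H x))" for x using F by (simp add: P'H circle_lift_def)
    then have "intertwines HomeoR H K K'" using correspond[OF \<phi>(1) H] \<phi>(2) by blast
    ultimately show "\<exists>H\<in>carrier HomeoR. intertwines HomeoR H K K' \<and> (\<forall>x. H (D x) = D' (H x))"
      using H by blast
  next
    assume "\<exists>H\<in>carrier HomeoR. intertwines HomeoR H K K' \<and> (\<forall>x. H (D x) = D' (H x))"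
    then obtain H where H: "H \<in> carrier HomeoR" "intertwines HomeoR H K K'" "\<And>x. H (D x) = D' (H x)"
      by blast
    define F where "F = P' \<circ> H \<circ> inv\<^bsub>HomeoR\<^esub> P"
    define \<phi> where "\<phi> = (\<lambda>z\<in>sphere 0 1. circ (F (SOME t. circ t = z)))"
    have FC: "F \<in> carrier HomeoR" unfolding F_def using H A.P B.P by (intro HomeoR_comp) auto
    have FP: "F (P x) = P' (H x)" for x by (simp add: F_def HomeoR_inv_apply A.P)
    have F1: "F (t + 1) = F t + 1" for t
    proof -
      obtain x where "t = P x" using A.P_onto by blast
      then show ?thesis using FP[of x] FP[of "D x"] H(3) by (simp add: A.deck B.deck)
    qed
    have "\<phi> (circ t) = circ (F t)" for t
    proof -
      define s where "s = (SOME s. circ s = circ t)"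
      have "circ s = circ t" unfolding s_def by (rule someI) (rule refl)
      then obtain i where "s = t + of_int i" by (auto simp: circ_eq_iff)
      then have "circ (F s) = circ (F t)" by (simp add: equivariant_add_int[of F] F1 circ_add_int)
      then show ?thesis using circ_in_sphere by (simp add: \<phi>_def s_def)
    qed
    then have F: "circle_lift \<phi> F" using FC F1 by (simp add: circle_lift_def)
    then have \<phi>: "\<phi> \<in> carrier HomeoS1" by (intro HomeoS1_I) (auto simp: \<phi>_def)
    have "\<phi> (circ (P x)) = circ (P' (H x))" for x using F by (simp add: circle_lift_def FP)
    then show "\<exists>\<phi>\<in>carrier HomeoS1. intertwines HomeoS1 \<phi> \<Gamma> \<Gamma>'" using correspond[OF \<phi> H(1)] H(2) \<phi> by blast
  qed
  finally show ?thesis .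
qed

section \<open>Coverings of the circle groups\<close>

text \<open>Rescaling the circle by \<open>k\<close> and shifting puts the vertices at the integers modulo
  \<open>k\<close>, starting with \<open>vertex k 1\<close> at \<open>0\<close>, and the first arc onto the unit interval.\<close>

definition mark :: "nat \<Rightarrow> real \<Rightarrow> complex"
  where "mark k x = circ ((x + 1) / real k)"

lemma mark_eq_iff:
  assumes "k \<ge> 1" shows "mark k x = mark k y \<longleftrightarrow> (\<exists>i. x = y + of_int (int k * i))"
proof -
  have "(x + 1) / real k = (y + 1) / real k + of_int i \<longleftrightarrow> x = y + of_int (int k * i)" for i
    using assms by (simp add: field_simps)
  then show ?thesis by (simp add: mark_def circ_eq_iff)
qed

lemma vertex_mark: "vertex k (Suc j) = mark k (real j)"
  by (simp add: vertex_def mark_def add.commute)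

lemma mark_in_arc_iff:
  assumes "k \<ge> 1"
  shows "mark k x \<in> arc_between k (Suc j) \<longleftrightarrow>
    (\<exists>i. of_nat j < x + of_int (int k * i) \<and> x + of_int (int k * i) < of_nat j + 1)"
proof -
  have "arc_between k (Suc j) = mark k ` {real j <..< real j + 1}"
  proof -
    have "(\<lambda>x. (x + 1) / real k) ` {real j <..< real j + 1} = {real (Suc j) / real k <..< real (Suc j + 1) / real k}"
    proof
      show "{real (Suc j) / real k <..< real (Suc j + 1) / real k} \<subseteq> (\<lambda>x. (x + 1) / real k) ` {real j <..< real j + 1}"
      proof
        fix t assume "t \<in> {real (Suc j) / real k <..< real (Suc j + 1) / real k}"
        then have "real k * t - 1 \<in> {real j <..< real j + 1}" "t = ((real k * t - 1) + 1) / real k"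
          using assms by (auto simp: field_simps)
        then show "t \<in> (\<lambda>x. (x + 1) / real k) ` {real j <..< real j + 1}" by (rule rev_image_eqI)
      qed
    qed (use assms in \<open>auto simp: divide_strict_right_mono\<close>)
    then have "arc_between k (Suc j) = circ ` (\<lambda>x. (x + 1) / real k) ` {real j <..< real j + 1}"
      unfolding arc_between_def by simp
    then show ?thesis by (simp add: image_image mark_def)
  qed
  then have "mark k x \<in> arc_between k (Suc j) \<longleftrightarrow> (\<exists>y. real j < y \<and> y < real j + 1 \<and> mark k y = mark k x)"
    by (simp add: image_iff Bex_def conj_assoc eq_commute[of "mark k x"])
  then show ?thesis unfolding mark_eq_iff[OF assms] by blast
qed

lemma small_multiple_eq_0:
  assumes "\<bar>real_of_int (int k * i)\<bar> < real k" shows "i = 0"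
proof (rule ccontr)
  assume "i \<noteq> 0"
  then have "1 \<le> \<bar>real_of_int i\<bar>" by linarith
  then have "real k * 1 \<le> real k * \<bar>real_of_int i\<bar>" by (intro mult_left_mono) auto
  then show False using assms by (simp add: abs_mult)
qed

text \<open>The lift of the chart never meets the integers because the vertices lie outside the first arc.
  Being connected, its range stays inside one unit interval, a translate of the first one by a
  multiple of \<open>k\<close>.\<close>

lemma arc_chart_unit_chart:
  assumes k: "k \<ge> 1" and \<phi>: "arc_chart k \<phi>"
  obtains E where "unit_chart E" "strict_mono E" "\<And>t. \<phi> t = mark k (E t)"
proof -
  have "\<exists>\<phi>'. homeomorphism UNIV (arc_between k 1) \<phi> \<phi>'"
    and "\<exists>\<theta>. continuous_on UNIV \<theta> \<and> strict_mono \<theta> \<and> (\<forall>t. \<phi> t = circ (\<theta> t))"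
    using \<phi> unfolding arc_chart_def by blast+
  then obtain \<phi>' \<theta> where \<phi>': "homeomorphism UNIV (arc_between k 1) \<phi> \<phi>'"
    and cont: "continuous_on UNIV \<theta>" and mono: "strict_mono \<theta>" and lift: "\<And>t. \<phi> t = circ (\<theta> t)"
    by blast
  have range: "range \<phi> = arc_between k (Suc 0)" using \<phi>' by (simp add: homeomorphism_def)
  define e where "e t = real k * \<theta> t - 1" for t
  have \<phi>e: "\<phi> t = mark k (e t)" for t using k by (simp add: lift mark_def e_def)
  have cont_e: "continuous_on UNIV e" unfolding e_def by (intro continuous_intros cont)
  have mono_e: "strict_mono e" using mono k by (simp add: strict_mono_def e_def)
  have in_arc: "\<exists>i. 0 < e t + of_int (int k * i) \<and> e t + of_int (int k * i) < 1" for t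
    using mark_in_arc_iff[OF k, of "e t" 0] range \<phi>e by (metis of_nat_0 add_0 rangeI)
  have avoid: "e t \<noteq> of_int p" for t p
  proof
    assume "e t = of_int p"
    then obtain i where "0 < real_of_int (p + int k * i)" "real_of_int (p + int k * i) < 1"
      using in_arc[of t] by auto
    then have "0 < p + int k * i" "p + int k * i < 1"
      by (simp_all only: of_int_0_less_iff of_int_less_1_iff)
    then show False by simp
  qed
  obtain i where i: "0 < e 0 + of_int (int k * i)" "e 0 + of_int (int k * i) < 1" using in_arc by blast
  define E where "E t = e t + of_int (int k * i)" for t
  have cont_E: "continuous_on UNIV E" unfolding E_def by (intro continuous_intros cont_e)
  have mono_E: "strict_mono E" using mono_e by (simp add: strict_mono_def E_def)
  have avoid_E: "E t \<noteq> of_int p" for t p using avoid[of t "p - int k * i"] by (simp add: E_def algebra_simps)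
  have bounds: "0 < E t \<and> E t < 1" for t
  proof (rule ccontr)
    assume "\<not> (0 < E t \<and> E t < 1)"
    moreover have "0 < E 0" "E 0 < 1" using i by (auto simp: E_def)
    moreover have conn: "connected (range E)" using cont_E connected_UNIV by (rule connected_continuous_image)
    ultimately have "(0 \<in> range E) \<or> (1 \<in> range E)"
      using connectedD_interval[OF conn, of "E t" "E 0" 0] connectedD_interval[OF conn, of "E 0" "E t" 1]
      by (metis linorder_not_less less_imp_le rangeI)
    then show False using avoid_E[of _ 0] avoid_E[of _ 1] by auto
  qed
  have \<phi>E: "\<phi> t = mark k (E t)" for t unfolding \<phi>e E_def using mark_eq_iff[OF k] by metis
  have "range E = {0<..<1}"
  proof
    show "range E \<subseteq> {0<..<1}" using bounds by auto
    show "{0<..<1} \<subseteq> range E"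
    proof
      fix y :: real assume y: "y \<in> {0<..<1}"
      then have "mark k y \<in> range \<phi>" unfolding range mark_in_arc_iff[OF k] by (intro exI[of _ 0]) auto
      then obtain t where "mark k y = mark k (E t)" using \<phi>E by auto
      then obtain i where i: "y = E t + of_int (int k * i)" unfolding mark_eq_iff[OF k] by blast
      have "\<bar>y - E t\<bar> < 1" using y bounds[of t] by auto
      then have "\<bar>real_of_int (int k * i)\<bar> < real k" using k unfolding i by simp
      then have "i = 0" by (rule small_multiple_eq_0)
      then show "y \<in> range E" using i by auto
    qed
  qed
  then have "unit_chart E"
    unfolding unit_chart_def using cont_E mono_E
    by (intro homeomorphism_into_1d) (auto intro: strict_mono_imp_inj_on convex_imp_path_connected)
  then show ?thesis using mono_E \<phi>E by (rule that)
qed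

text \<open>The condition \<open>commute\<close> makes the lifts of the elements \<open>circle_extension \<phi> k f \<sigma>\<close> commute with
  the deck transformation, so that the extension of \<open>\<sigma>\<close> along the orbit of the first arc closes up
  after one turn.\<close>

locale circle_root =
  fixes \<phi> :: "real \<Rightarrow> complex" and k :: nat and f :: "complex \<Rightarrow> complex" and g :: "real \<Rightarrow> real"
    and G :: "(real \<Rightarrow> real) set" and E :: "real \<Rightarrow> real"
  assumes k: "k \<ge> 1" and E: "unit_chart E" and chart: "\<And>t. \<phi> t = mark k (E t)"
    and root: "f \<in> circle_roots \<phi> k g" and G: "subgroup G HomeoR" and g: "g \<in> G"
    and commute: "\<And>\<sigma> x. \<sigma> \<in> G \<Longrightarrow> \<sigma> (g x) = g (\<sigma> x)"
begin

lemma G_carrier: "\<sigma> \<in> G \<Longrightarrow> \<sigma> \<in> carrier HomeoR"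
  using subgroup.subset[OF G] by blast

lemma f: "f \<in> carrier HomeoS1"
  using root by (simp add: circle_roots_def)

lemma E_bounds: "0 < E x" "E x < 1"
  using unit_chart_bounds[OF E] by auto

lemma \<phi>_eq_iff: "\<phi> s = \<phi> t \<longleftrightarrow> s = t"
proof
  assume "\<phi> s = \<phi> t"
  then obtain i where i: "E s = E t + of_int (int k * i)" unfolding chart mark_eq_iff[OF k] by blast
  have "\<bar>E s - E t\<bar> < 1" using E_bounds[of s] E_bounds[of t] by auto
  then have "\<bar>real_of_int (int k * i)\<bar> < real k" using k unfolding i by simp
  then have "i = 0" by (rule small_multiple_eq_0)
  then show "s = t" using i unit_chart_eq[OF E] by simp
qed simp

lemma transport_\<phi>: "transport \<phi> \<sigma> (\<phi> t) = \<phi> (\<sigma> t)"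
proof -
  have "inj \<phi>" using \<phi>_eq_iff by (auto intro: injI)
  then show ?thesis by (simp add: transport_def)
qed

text \<open>The lift of \<open>f\<close> in the rescaled coordinate can be normalised to send \<open>0\<close> to \<open>1\<close>. Then it moves
  every integer up by one: for \<open>j < k\<close> the image of \<open>j\<close> is congruent to \<open>j + 1\<close> modulo \<open>k\<close> and
  lies in \<open>{1..<1 + k}\<close>.\<close>

lemma ex_shift:
  "\<exists>shift\<in>carrier HomeoR. (\<forall>j. shift (of_int j) = of_int (j + 1)) \<and> (\<forall>x. shift (x + real k) = shift x + real k) \<and>
    (\<forall>x. f (mark k x) = mark k (shift x))"
proof -
  obtain F where F: "circle_lift f F" using HomeoS1_lift[OF f] .
  have FC: "F \<in> carrier HomeoR" and F1: "\<And>t. F (t + 1) = F t + 1" and fF: "\<And>t. f (circ t) = circ (F t)"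
    using F by (auto simp: circle_lift_def)
  have vertices: "f (mark k (real j)) = mark k (real (Suc j))" if "j < k" for j
  proof -
    have "f (vertex k (Suc j)) = vertex k (Suc (Suc j))" using root that by (simp add: circle_roots_def)
    then show ?thesis by (simp only: vertex_mark)
  qed
  define B0 where "B0 x = real k * F ((x + 1) / real k) - 1" for x
  have B0_mark: "f (mark k x) = mark k (B0 x)" for x using k by (simp add: mark_def fF B0_def)
  have B0_k: "B0 (x + real k) = B0 x + real k" for x
  proof -
    have "(x + real k + 1) / real k = (x + 1) / real k + 1" using k by (simp add: field_simps)
    then have "F ((x + real k + 1) / real k) = F ((x + 1) / real k) + 1" by (simp only: F1)
    then show ?thesis by (simp add: B0_def algebra_simps)
  qed
  obtain i where i: "B0 0 = 1 + of_int (int k * i)"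
    using vertices[of 0] B0_mark[of 0] k unfolding of_nat_0 by (auto simp: mark_eq_iff)
  define shift where "shift x = B0 x - of_int (int k * i)" for x
  have shift_mark: "f (mark k x) = mark k (shift x)" for x
  proof -
    have "mark k (B0 x) = mark k (shift x)"
      unfolding mark_eq_iff[OF k] by (intro exI[of _ i]) (simp add: shift_def)
    then show ?thesis using B0_mark by simp
  qed
  have shift_k: "shift (x + real k) = shift x + real k" for x by (simp add: shift_def B0_k)
  have BC: "shift \<in> carrier HomeoR"
  proof (rule HomeoR_I)
    show "strict_mono shift"
      using k HomeoR_less[OF FC] by (auto simp: strict_mono_def shift_def B0_def divide_strict_right_mono)
    show "surj shift"
    proof (rule surjI)
      fix y
      show "shift (real k * (inv\<^bsub>HomeoR\<^esub> F) ((y + 1 + of_int (int k * i)) / real k) - 1) = y"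
        using k FC by (simp add: shift_def B0_def HomeoR_inv_apply)
    qed
  qed
  have shift_first: "shift (real j) = real (Suc j)" if j: "j < k" for j
  proof -
    obtain l where l: "shift (real j) = real (Suc j) + of_int (int k * l)"
      using vertices[OF j] shift_mark[of "real j"] mark_eq_iff[OF k, of "shift (real j)" "real (Suc j)"] by auto
    have "shift 0 = 1" using i by (simp add: shift_def)
    then have "1 \<le> shift (real j)" "shift (real j) < 1 + real k"
      using HomeoR_le[OF BC, of 0 "real j"] HomeoR_less[OF BC, of "real j" "0 + real k"] j shift_k[of 0] by auto
    then have "\<bar>real_of_int (int k * l)\<bar> < real k" using l j by linarith
    then have "l = 0" by (rule small_multiple_eq_0)
    then show ?thesis using l by simp
  qed
  have shift_k_int: "shift (x + of_int (int k * l)) = shift x + of_int (int k * l)" for x l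
  proof (induction l rule: int_induct[of _ 0])
    case base then show ?case by simp
  next
    case (step1 l) then show ?case using shift_k[of "x + of_int (int k * l)"] by (simp add: algebra_simps)
  next
    case (step2 l) then show ?case using shift_k[of "x + of_int (int k * (l - 1))"] by (simp add: algebra_simps)
  qed
  have "shift (of_int j) = of_int (j + 1)" for j
  proof -
    have j: "j = j mod int k + int k * (j div int k)" by simp
    have "nat (j mod int k) < k" "real (nat (j mod int k)) = of_int (j mod int k)"
      using k by (simp_all add: nat_less_iff)
    then have "shift (of_int (j mod int k)) = of_int (j mod int k) + 1" using shift_first[of "nat (j mod int k)"] by simp
    then have "shift (of_int (j mod int k) + of_int (int k * (j div int k)))
        = of_int (j mod int k) + 1 + of_int (int k * (j div int k))" by (simp only: shift_k_int)
    then have "shift (of_int (j mod int k + int k * (j div int k))) = of_int (j mod int k + int k * (j div int k)) + 1"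
      by (simp only: of_int_add)
    then show ?thesis by (simp flip: j)
  qed
  then show ?thesis using BC shift_k shift_mark by blast
qed

definition shift :: "real \<Rightarrow> real"
  where "shift = (SOME shift. shift \<in> carrier HomeoR \<and> (\<forall>j. shift (of_int j) = of_int (j + 1)) \<and>
    (\<forall>x. shift (x + real k) = shift x + real k) \<and> (\<forall>x. f (mark k x) = mark k (shift x)))"

lemma shift: "shift \<in> carrier HomeoR" and shift_int: "shift (of_int j) = of_int (j + 1)"
  and shift_k: "shift (x + real k) = shift x + real k" and f_mark: "f (mark k x) = mark k (shift x)"
proof -
  note shift_props = someI_ex[OF ex_shift[unfolded Bex_def], folded shift_def]
  then show "shift \<in> carrier HomeoR" "shift (of_int j) = of_int (j + 1)"
    "shift (x + real k) = shift x + real k" "f (mark k x) = mark k (shift x)" by auto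
qed

definition shift_pow :: "int \<Rightarrow> real \<Rightarrow> real"
  where "shift_pow j = shift [^]\<^bsub>HomeoR\<^esub> j"

lemma shift_pow: "shift_pow j \<in> carrier HomeoR"
  by (simp add: shift_pow_def shift)

lemma shift_pow_add: "shift_pow (i + j) x = shift_pow i (shift_pow j x)"
  unfolding shift_pow_def by (rule HomeoR_int_pow_add[OF shift])

lemma shift_pow_0: "shift_pow 0 x = x"
  by (simp add: shift_pow_def HomeoR_one)

lemma shift_pow_Suc: "shift_pow (j + 1) x = shift (shift_pow j x)"
  using shift_pow_add[of 1 j x] shift by (simp add: shift_pow_def add.commute)

lemma shift_pow_pred: "shift (shift_pow (j - 1) x) = shift_pow j x"
  using shift_pow_Suc[of "j - 1" x] by simp

lemma shift_pow_int: "shift_pow j (of_int i) = of_int (i + j)"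
proof (induction j rule: int_induct[of _ 0])
  case base then show ?case by (simp add: shift_pow_0)
next
  case (step1 j) then show ?case using shift_int[of "i + j"] by (simp add: shift_pow_Suc add.assoc)
next
  case (step2 j)
  then have "shift (shift_pow (j - 1) (of_int i)) = shift (of_int (i + (j - 1)))" by (simp only: shift_pow_pred shift_int)
  then show ?case using HomeoR_eq[OF shift] by simp
qed

lemma shift_pow_k: "shift_pow j (x + real k) = shift_pow j x + real k"
proof (induction j rule: int_induct[of _ 0])
  case base then show ?case by (simp add: shift_pow_0)
next
  case (step1 j) then show ?case by (simp add: shift_pow_Suc shift_k)
next
  case (step2 j)
  then have "shift (shift_pow (j - 1) (x + real k)) = shift (shift_pow (j - 1) x + real k)" by (simp only: shift_pow_pred shift_k)
  then show ?case using HomeoR_eq[OF shift] by simp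
qed

lemma shift_pow_bounds: "of_int j < shift_pow j (E x)" "shift_pow j (E x) < of_int j + 1"
  using HomeoR_less[OF shift_pow, of j 0 "E x"] HomeoR_less[OF shift_pow, of j "E x" 1] E_bounds[of x]
    shift_pow_int[of j 0] shift_pow_int[of j 1] by simp_all

lemma f_pow_mark: "(f [^]\<^bsub>HomeoS1\<^esub> m) (mark k x) = mark k (shift_pow (int m) x)"
proof (induction m arbitrary: x)
  case 0
  then show ?case by (simp add: mark_def HomeoS1_one_apply shift_pow_0)
next
  case (Suc m)
  have "(f [^]\<^bsub>HomeoS1\<^esub> Suc m) (mark k x) = (f [^]\<^bsub>HomeoS1\<^esub> m) (f (mark k x))"
    unfolding mark_def using f by (simp add: HomeoS1_mult_apply)
  also have "\<dots> = mark k (shift_pow (int m) (shift_pow 1 x))" using Suc.IH shift_pow_Suc[of 0 x] by (simp add: f_mark shift_pow_0)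
  finally show ?case by (simp add: add.commute flip: shift_pow_add)
qed

text \<open>The condition on the \<open>k\<close>-th power of \<open>f\<close> determines the lift of that power only modulo \<open>k\<close>;
  its value on the integers fixes the summand.\<close>

lemma shift_pow_root: "shift_pow (int k) (E t) = E (g t) + real k"
proof -
  have "mark k (E t) \<in> arc_between k (Suc 0)"
    unfolding mark_in_arc_iff[OF k] using E_bounds[of t] by (intro exI[of _ 0]) simp
  then have "(f [^]\<^bsub>HomeoS1\<^esub> k) (\<phi> t) = \<phi> (g t)"
    using root transport_\<phi> by (simp add: circle_roots_def chart)
  then have "mark k (shift_pow (int k) (E t)) = mark k (E (g t))" by (simp add: chart f_pow_mark)
  then obtain i where i: "shift_pow (int k) (E t) = E (g t) + of_int (int k * i)" unfolding mark_eq_iff[OF k] by blast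
  then have "real_of_int (int k * (i - 1)) = shift_pow (int k) (E t) - real k - E (g t)"
    by (simp add: algebra_simps)
  then have "\<bar>real_of_int (int k * (i - 1))\<bar> < 1"
    using shift_pow_bounds[of "int k" t] E_bounds[of "g t"] by simp
  then have "i - 1 = 0" using k by (intro small_multiple_eq_0[of k]) simp
  then show ?thesis using i by simp
qed

text \<open>The coordinate in which the lift of \<open>f\<close> is the unit translation.\<close>

definition Q :: "real \<Rightarrow> real"
  where "Q x = (shift_pow \<lfloor>x\<rfloor> \<circ> translation (- of_int \<lfloor>x\<rfloor>)) x"

lemma Q: "Q \<in> carrier HomeoR"
  unfolding Q_def
proof (rule HomeoR_paste(1))
  show "shift_pow j \<circ> translation (- of_int j) \<in> carrier HomeoR" for j
    by (intro HomeoR_comp shift_pow translation_closed)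
  show "(shift_pow j \<circ> translation (- of_int j)) (of_int j) = of_int j" for j
    using shift_pow_int[of j 0] by (simp add: translation_def)
  show "(shift_pow j \<circ> translation (- of_int j)) (of_int (j + 1)) = of_int (j + 1)" for j
    using shift_pow_int[of j 1] by (simp add: translation_def)
qed

lemma Q_int: "Q (of_int j) = of_int j"
  using shift_pow_int[of j 0] by (simp add: Q_def translation_def)

lemma Q_chart: "Q (of_int j + E x) = shift_pow j (E x)"
  using unit_chart_floor_0[OF E, of x] by (simp add: Q_def translation_def)

lemma Q_Suc: "Q (x + 1) = shift (Q x)"
  by (simp add: Q_def translation_def shift_pow_Suc)

definition P :: "real \<Rightarrow> real"
  where "P x = (Q x + 1) / real k"

lemma circ_P: "circ (P x) = mark k (Q x)"
  by (simp add: P_def mark_def)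

lemma P: "P \<in> carrier HomeoR"
proof (rule HomeoR_I)
  show "strict_mono P"
    using HomeoR_less[OF Q] k by (auto simp: strict_mono_def P_def divide_strict_right_mono)
  show "surj P"
    by (rule surjI[of _ "\<lambda>y. (inv\<^bsub>HomeoR\<^esub> Q) (real k * y - 1)"]) (use k in \<open>simp add: P_def HomeoR_inv_apply Q\<close>)
qed

text \<open>Once around the circle is \<open>k\<close> steps of \<open>f\<close>, corrected by the inverse of \<open>g\<close> because the \<open>k\<close>-th
  power of \<open>f\<close> is \<open>g\<close> and not the identity.\<close>

definition D :: "real \<Rightarrow> real"
  where "D = translation (of_int (int k)) \<circ> interval_lift E (inv\<^bsub>HomeoR\<^esub> g)"

lemma inv_g: "inv\<^bsub>HomeoR\<^esub> g \<in> G" "g ((inv\<^bsub>HomeoR\<^esub> g) x) = x" "(inv\<^bsub>HomeoR\<^esub> g) (g x) = x"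
  using subgroup.m_inv_closed[OF G g] HomeoR_inv_apply[OF G_carrier[OF g]] by auto

lemma D_in: "D \<in> line_extension E G"
  unfolding line_extension_eq[OF E G] D_def using inv_g by blast

lemma D: "D \<in> carrier HomeoR"
  unfolding D_def using inv_g by (intro HomeoR_comp translation_closed interval_lift_HomeoR[OF E] G_carrier)

lemma D_int: "D (of_int j) = of_int (j + int k)"
  by (simp add: D_def interval_lift_int translation_def)

lemma D_chart: "D (of_int j + E x) = of_int (j + int k) + E ((inv\<^bsub>HomeoR\<^esub> g) x)"
  by (simp add: D_def interval_lift_chart[OF E] translation_def)

lemma Q_D: "Q (D x) = Q x + real k"
proof (rule unit_chart_cases[OF E, of x])
  fix j assume "x = of_int j"
  then show ?thesis by (simp only: D_int Q_int)
next
  fix j y assume x: "x = of_int j + E y"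
  have "Q (D x) = shift_pow j (shift_pow (int k) (E ((inv\<^bsub>HomeoR\<^esub> g) y)))"
    unfolding x D_chart Q_chart by (rule shift_pow_add)
  also have "\<dots> = Q x + real k" by (simp add: shift_pow_root inv_g shift_pow_k x Q_chart)
  finally show ?thesis .
qed

lemma P_D: "P (D x) = P x + 1"
  using k by (simp add: P_def Q_D field_simps)

lemma floor_D: "\<lfloor>D x\<rfloor> = \<lfloor>x\<rfloor> + int k"
  unfolding D_def by (rule line_extension_floor[OF E])

lemma interval_lift_D:
  assumes "\<sigma> \<in> G" shows "interval_lift E \<sigma> (D x) = D (interval_lift E \<sigma> x)"
proof -
  have "(\<sigma> \<circ> inv\<^bsub>HomeoR\<^esub> g) y = (inv\<^bsub>HomeoR\<^esub> g \<circ> \<sigma>) y" for y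
    using commute[OF assms, of "(inv\<^bsub>HomeoR\<^esub> g) y"] inv_g by (metis comp_apply)
  then have "\<sigma> \<circ> inv\<^bsub>HomeoR\<^esub> g = inv\<^bsub>HomeoR\<^esub> g \<circ> \<sigma>" by auto
  then have "interval_lift E \<sigma> (interval_lift E (inv\<^bsub>HomeoR\<^esub> g) x)
      = interval_lift E (inv\<^bsub>HomeoR\<^esub> g) (interval_lift E \<sigma> x)"
    by (simp only: flip: interval_lift_comp[OF E])
  then show ?thesis
    unfolding D_def translation_def comp_apply interval_lift_add_int[OF E] by simp
qed

lemma mark_in_arc_unique:
  assumes "0 \<le> j" "j < int k" "\<lfloor>x\<rfloor> = j" "i \<in> {1..k}" "mark k x \<in> arc_between k i"
  shows "i = Suc (nat j)"
proof -
  obtain i' where i': "i = Suc i'" "i' < k" using assms(4) by (cases i) auto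
  obtain l where "of_nat i' < x + of_int (int k * l)" "x + of_int (int k * l) < of_nat i' + 1"
    using assms(5) unfolding i'(1) mark_in_arc_iff[OF k] by blast
  then have "\<lfloor>x + of_int (int k * l)\<rfloor> = int i'" by (intro floor_unique) simp_all
  then have "int i' = j + int k * l" using assms(3) by (simp only: flip: floor_add_int)
  then have "int i' mod int k = j mod int k" by simp
  then show ?thesis using i' assms(1,2) by simp
qed

lemma circle_extension_covering_base:
  assumes "\<sigma> \<in> G" "0 \<le> \<lfloor>x\<rfloor>" "\<lfloor>x\<rfloor> < int k"
  shows "circle_extension \<phi> k f \<sigma> (circ (P x)) = circ (P (interval_lift E \<sigma> x))"
proof (rule unit_chart_cases[OF E, of x])
  fix j assume x: "x = of_int j"
  have "mark k (of_int j) \<notin> arc_between k i" if i: "i \<in> {1..k}" for i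
  proof
    assume arc: "mark k (of_int j) \<in> arc_between k i"
    obtain i' where i': "i = Suc i'" using i by (cases i) auto
    obtain l where "of_nat i' < real_of_int j + of_int (int k * l)" "real_of_int j + of_int (int k * l) < of_nat i' + 1"
      using arc unfolding i' mark_in_arc_iff[OF k] by blast
    then have "int i' < j + int k * l" "j + int k * l < int i' + 1" by linarith+
    then show False by simp
  qed
  then show ?thesis
    using circ_in_sphere[of "P x"] by (simp add: circle_extension_def circ_P x interval_lift_int Q_int)
next
  fix j y assume x: "x = of_int j + E y"
  have j: "0 \<le> j" "j < int k" using assms(2,3) unfolding x unit_chart_floor[OF E] by auto
  let ?z = "mark k (shift_pow j (E y))" and ?i = "Suc (nat j)"
  have z: "circ (P x) = ?z" by (simp add: circ_P x Q_chart)
  have floor: "\<lfloor>shift_pow j (E y)\<rfloor> = j" using shift_pow_bounds[of j y] by (simp add: floor_eq_iff)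
  have i_in: "?i \<in> {1..k}" using j by auto
  have in_arc: "?z \<in> arc_between k ?i"
    unfolding mark_in_arc_iff[OF k] using shift_pow_bounds[of j y] j by (intro exI[of _ 0]) simp
  have the_i: "(THE i. i \<in> {1..k} \<and> ?z \<in> arc_between k i) = ?i"
    using i_in in_arc mark_in_arc_unique[OF j floor] by (intro the_equality) auto
  let ?F = "f [^]\<^bsub>HomeoS1\<^esub> nat j"
  have F_mark: "?F (mark k u) = mark k (shift_pow j u)" for u using f_pow_mark[of "nat j"] j by simp
  have "mark k (E y) \<in> sphere 0 1" unfolding mark_def by (rule circ_in_sphere)
  from HomeoS1_inv_apply(2)[OF S.nat_pow_closed[OF f, of "nat j"] this]
  have "(inv\<^bsub>HomeoS1\<^esub> ?F) ?z = \<phi> y" unfolding F_mark chart .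
  then have "?F (transport \<phi> \<sigma> ((inv\<^bsub>HomeoS1\<^esub> ?F) ?z)) = mark k (shift_pow j (E (\<sigma> y)))"
    by (simp add: transport_\<phi>) (simp add: chart F_mark)
  moreover have "circle_extension \<phi> k f \<sigma> ?z = ?F (transport \<phi> \<sigma> ((inv\<^bsub>HomeoS1\<^esub> ?F) ?z))"
  proof -
    have "\<exists>i\<in>{1..k}. ?z \<in> arc_between k i" using i_in in_arc by blast
    moreover have "?z \<in> sphere 0 1" unfolding mark_def by (rule circ_in_sphere)
    ultimately show ?thesis unfolding circle_extension_def by (simp only: restrict_apply if_True the_i Let_def diff_Suc_1)
  qed
  ultimately show ?thesis unfolding z circ_P x interval_lift_chart[OF E] Q_chart by simp
qed

text \<open>Both sides are invariant under \<open>D\<close>, so that the comparison on one fundamental domain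
  suffices. This is where the elements of \<open>G\<close> have to commute with \<open>g\<close>.\<close>

lemma circle_extension_covering:
  assumes \<sigma>: "\<sigma> \<in> G"
  shows "circle_extension \<phi> k f \<sigma> (circ (P x)) = circ (P (interval_lift E \<sigma> x))"
proof -
  let ?C = "\<lambda>x. circle_extension \<phi> k f \<sigma> (circ (P x)) = circ (P (interval_lift E \<sigma> x))"
  have C_D: "?C (D x) \<longleftrightarrow> ?C x" for x
    by (simp add: interval_lift_D[OF \<sigma>] P_D circ_add_int)
  have "?C x" if "\<lfloor>x\<rfloor> div int k = m" for m x
    using that
  proof (induction m arbitrary: x rule: int_induct[of _ 0])
    case base
    have "0 \<le> i \<and> i < int k" if "i div int k = 0" for i
      using that k unfolding zdiv_eq_0_iff by linarith
    with base have "0 \<le> \<lfloor>x\<rfloor>" "\<lfloor>x\<rfloor> < int k" by blast+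
    then show ?case by (rule circle_extension_covering_base[OF \<sigma>])
  next
    case (step1 m)
    define y where "y = (inv\<^bsub>HomeoR\<^esub> D) x"
    have x: "x = D y" by (simp add: y_def HomeoR_inv_apply D)
    have "\<lfloor>y\<rfloor> div int k = m" using step1.prems k unfolding x floor_D by simp
    then show ?case using step1.IH C_D x by blast
  next
    case (step2 m)
    have "\<lfloor>D x\<rfloor> div int k = m" using step2.prems k unfolding floor_D by simp
    then show ?case using step2.IH C_D by blast
  qed
  then show ?thesis by blast
qed

lemma circle_extension_HomeoS1:
  assumes \<sigma>: "\<sigma> \<in> G" shows "circle_extension \<phi> k f \<sigma> \<in> carrier HomeoS1"
proof (rule HomeoS1_I)
  show "circle_extension \<phi> k f \<sigma> \<in> extensional (sphere 0 1)" by (simp add: circle_extension_def)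
  let ?F = "P \<circ> interval_lift E \<sigma> \<circ> inv\<^bsub>HomeoR\<^esub> P"
  have FP: "?F (P x) = P (interval_lift E \<sigma> x)" for x by (simp add: HomeoR_inv_apply P)
  have onto: "\<exists>x. t = P x" for t using P by (metis HomeoR_iff surjD)
  have "?F (t + 1) = ?F t + 1" for t
  proof -
    obtain x where t: "t = P x" using onto by blast
    have "?F (P (D x)) = P (D (interval_lift E \<sigma> x))" by (simp only: FP interval_lift_D[OF \<sigma>])
    then show ?thesis unfolding t by (simp only: P_D FP)
  qed
  moreover have "circle_extension \<phi> k f \<sigma> (circ t) = circ (?F t)" for t
  proof -
    obtain x where t: "t = P x" using onto by blast
    show ?thesis unfolding t FP by (rule circle_extension_covering[OF \<sigma>])
  qed
  moreover have "?F \<in> carrier HomeoR"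
    using \<sigma> by (intro HomeoR_comp P interval_lift_HomeoR[OF E] G_carrier R.inv_closed)
  ultimately show "circle_lift (circle_extension \<phi> k f \<sigma>) ?F" by (simp add: circle_lift_def)
qed

lemma f_covering: "f (circ (P x)) = circ (P (translation 1 x))"
  by (simp add: circ_P f_mark Q_Suc translation_def)

text \<open>The coordinate \<open>P\<close> turns \<open>f\<close> into the unit translation and \<open>circle_extension \<phi> k f \<sigma>\<close> into
  \<open>interval_lift E \<sigma>\<close>. So the generators of the two groups correspond, and with them all words.\<close>

theorem covers_circle_group:
  "covered_group P D (line_extension E G) (generate HomeoS1 (circle_extension \<phi> k f ` G \<union> {f}))"
    (is "covered_group P D ?K ?\<Gamma>")
proof (rule covered_group.intro)
  let ?lifts = "\<lambda>\<gamma> \<kappa>. \<forall>x. \<gamma> (circ (P x)) = circ (P (\<kappa> x))"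
  show "P \<in> carrier HomeoR" by (rule P)
  show "P (D x) = P x + 1" for x by (rule P_D)
  show K: "subgroup ?K HomeoR" by (rule subgroup_line_extension[OF E G])
  show "D \<in> ?K" by (rule D_in)
  have gens: "circle_extension \<phi> k f ` G \<union> {f} \<subseteq> carrier HomeoS1"
    using f circle_extension_HomeoS1 by auto
  show \<Gamma>: "?\<Gamma> \<subseteq> carrier HomeoS1" by (rule S.generate_incl[OF gens])
  have sub: "subgroup ?\<Gamma> HomeoS1" by (rule S.generate_is_subgroup[OF gens])
  have inv_lifts: "?lifts (inv\<^bsub>HomeoS1\<^esub> \<gamma>) (inv\<^bsub>HomeoR\<^esub> \<kappa>)"
    if "\<gamma> \<in> carrier HomeoS1" "\<kappa> \<in> carrier HomeoR" and l: "?lifts \<gamma> \<kappa>" for \<gamma> \<kappa>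
  proof
    fix x
    have "\<gamma> (circ (P ((inv\<^bsub>HomeoR\<^esub> \<kappa>) x))) = circ (P x)" using l that(2) by (simp add: HomeoR_inv_apply)
    then show "(inv\<^bsub>HomeoS1\<^esub> \<gamma>) (circ (P x)) = circ (P ((inv\<^bsub>HomeoR\<^esub> \<kappa>) x))"
      using HomeoS1_inv_apply(2)[OF that(1)] circ_in_sphere by metis
  qed
  have mult_lifts: "?lifts (\<gamma> \<otimes>\<^bsub>HomeoS1\<^esub> \<gamma>') (\<kappa> \<circ> \<kappa>')"
    if "\<gamma> \<in> carrier HomeoS1" "\<gamma>' \<in> carrier HomeoS1" "?lifts \<gamma> \<kappa>" "?lifts \<gamma>' \<kappa>'" for \<gamma> \<gamma>' \<kappa> \<kappa>'
    using that by (simp add: HomeoS1_mult_apply)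
  have K_gen: "interval_lift E \<sigma> \<in> ?K" "translation 1 \<in> ?K" if "\<sigma> \<in> G" for \<sigma>
    using that unfolding line_extension_def by (auto intro: generate.incl)
  have K_mem: "\<kappa> \<in> ?K \<Longrightarrow> \<kappa> \<in> carrier HomeoR" for \<kappa> using subgroup.subset[OF K] by blast
  have gen_lift: "\<exists>\<kappa>\<in>?K. ?lifts \<gamma> \<kappa>" if "\<gamma> \<in> circle_extension \<phi> k f ` G \<union> {f}" for \<gamma>
    using that circle_extension_covering f_covering K_gen g by blast
  have gen_descend: "\<exists>\<gamma>\<in>?\<Gamma>. ?lifts \<gamma> \<kappa>" if "\<kappa> \<in> interval_lift E ` G \<union> {translation 1}" for \<kappa>
  proof -
    from that consider \<sigma> where "\<sigma> \<in> G" "\<kappa> = interval_lift E \<sigma>" | "\<kappa> = translation 1" by blast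
    then show ?thesis
    proof cases
      case 1
      then have "circle_extension \<phi> k f \<sigma> \<in> ?\<Gamma>" by (intro generate.incl) auto
      then show ?thesis using circle_extension_covering 1 by blast
    next
      case 2
      have "f \<in> ?\<Gamma>" by (intro generate.incl) auto
      then show ?thesis using f_covering 2 by blast
    qed
  qed
  show "\<exists>\<kappa>\<in>?K. ?lifts \<gamma> \<kappa>" if "\<gamma> \<in> ?\<Gamma>" for \<gamma>
    using that
  proof (induction \<gamma> rule: generate.induct)
    case one
    have "?lifts \<one>\<^bsub>HomeoS1\<^esub> id" by (simp add: HomeoS1_one_apply)
    moreover have "id \<in> ?K" using K by (simp add: subgroup_HomeoR_iff)
    ultimately show ?case by blast
  next
    case (incl \<gamma>) then show ?case by (rule gen_lift)
  next
    case (inv \<gamma>)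
    then obtain \<kappa> where \<kappa>: "\<kappa> \<in> ?K" "?lifts \<gamma> \<kappa>" using gen_lift by blast
    then show ?case
      using inv_lifts[of \<gamma> \<kappa>] inv gens K_mem subgroup.m_inv_closed[OF K \<kappa>(1)] by blast
  next
    case (eng \<gamma> \<gamma>')
    then obtain \<kappa> \<kappa>' where \<kappa>: "\<kappa> \<in> ?K" "?lifts \<gamma> \<kappa>" "\<kappa>' \<in> ?K" "?lifts \<gamma>' \<kappa>'" by blast
    have "\<kappa> \<circ> \<kappa>' \<in> ?K" using \<kappa> K by (simp add: subgroup_HomeoR_iff)
    then show ?case using mult_lifts[OF _ _ \<kappa>(2,4)] eng.hyps \<Gamma> by blast
  qed
  show "\<exists>\<gamma>\<in>?\<Gamma>. ?lifts \<gamma> \<kappa>" if "\<kappa> \<in> ?K" for \<kappa>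
    using that unfolding line_extension_def
  proof (induction \<kappa> rule: generate.induct)
    case one
    have "?lifts \<one>\<^bsub>HomeoS1\<^esub> \<one>\<^bsub>HomeoR\<^esub>" by (simp add: HomeoS1_one_apply HomeoR_one)
    then show ?case using generate.one by blast
  next
    case (incl \<kappa>) then show ?case by (rule gen_descend)
  next
    case (inv \<kappa>)
    then obtain \<gamma> where \<gamma>: "\<gamma> \<in> ?\<Gamma>" "?lifts \<gamma> \<kappa>" using gen_descend by blast
    have "\<kappa> \<in> ?K" unfolding line_extension_def using inv by (rule generate.incl)
    then have "?lifts (inv\<^bsub>HomeoS1\<^esub> \<gamma>) (inv\<^bsub>HomeoR\<^esub> \<kappa>)" using \<gamma> \<Gamma> K_mem by (intro inv_lifts) auto
    then show ?case using subgroup.m_inv_closed[OF sub \<gamma>(1)] by blast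
  next
    case (eng \<kappa> \<kappa>')
    then obtain \<gamma> \<gamma>' where \<gamma>: "\<gamma> \<in> ?\<Gamma>" "?lifts \<gamma> \<kappa>" "\<gamma>' \<in> ?\<Gamma>" "?lifts \<gamma>' \<kappa>'" by blast
    have c: "\<kappa> \<in> carrier HomeoR" "\<kappa>' \<in> carrier HomeoR"
      using eng.hyps K_mem unfolding line_extension_def by auto
    have "?lifts (\<gamma> \<otimes>\<^bsub>HomeoS1\<^esub> \<gamma>') (\<kappa> \<otimes>\<^bsub>HomeoR\<^esub> \<kappa>')"
      unfolding HomeoR_mult[OF c] using \<gamma> \<Gamma> by (intro mult_lifts) auto
    then show ?case using subgroup.m_closed[OF sub \<gamma>(1,3)] by blast
  qed
qed

end

section \<open>Extending a conjugacy of line groups\<close>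

text \<open>Given \<open>\<rho>\<close> conjugating \<open>G\<close> to \<open>G'\<close> and a twist \<open>h \<in> G\<close>, the homeomorphism that acts on the
  unit interval at \<open>j\<close> by \<open>\<rho> \<circ> h^(-j)\<close> conjugates the extensions. It conjugates
  \<open>translation 1 \<circ> interval_lift E h\<close> to the unit translation, and so realises every element of
  the extension that moves the integers up by one as the image of the translation.\<close>

definition twisted_lift :: "(real \<Rightarrow> real) \<Rightarrow> (real \<Rightarrow> real) \<Rightarrow> (real \<Rightarrow> real) \<Rightarrow> real \<Rightarrow> real"
  where "twisted_lift E \<rho> h x = interval_lift E (\<rho> \<circ> h [^]\<^bsub>HomeoR\<^esub> (- \<lfloor>x\<rfloor>)) x"

lemma twisted_lift_int: "twisted_lift E \<rho> h (of_int j) = of_int j"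
  by (simp add: twisted_lift_def interval_lift_int)

lemma twisted_lift_chart:
  assumes "unit_chart E"
  shows "twisted_lift E \<rho> h (of_int j + E x) = of_int j + E (\<rho> ((h [^]\<^bsub>HomeoR\<^esub> (- j)) x))"
  unfolding twisted_lift_def unit_chart_floor[OF assms] interval_lift_chart[OF assms] by simp

lemma twisted_lift_HomeoR:
  assumes "unit_chart E" "\<rho> \<in> carrier HomeoR" "h \<in> carrier HomeoR"
  shows "twisted_lift E \<rho> h \<in> carrier HomeoR"
  unfolding twisted_lift_def
  by (rule HomeoR_paste(1)[where q = "\<lambda>j. interval_lift E (\<rho> \<circ> h [^]\<^bsub>HomeoR\<^esub> (- j))"])
    (use assms in \<open>auto simp only: interval_lift_int intro!: interval_lift_HomeoR HomeoR_comp R.int_pow_closed\<close>)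

lemma twisted_lift_intertwines:
  assumes E: "unit_chart E" and G: "subgroup G HomeoR" "subgroup G' HomeoR"
    and comm: "\<And>\<sigma> \<tau> x. \<sigma> \<in> G \<Longrightarrow> \<tau> \<in> G \<Longrightarrow> \<sigma> (\<tau> x) = \<tau> (\<sigma> x)"
    and \<rho>: "\<rho> \<in> carrier HomeoR" "intertwines HomeoR \<rho> G G'" and h: "h \<in> G"
  shows "intertwines HomeoR (twisted_lift E \<rho> h) (line_extension E G) (line_extension E G')"
proof -
  have GC: "G \<subseteq> carrier HomeoR" "G' \<subseteq> carrier HomeoR" using G subgroup.subset by blast+
  have hC: "h \<in> carrier HomeoR" using h GC by blast
  define hp where "hp j = h [^]\<^bsub>HomeoR\<^esub> (j :: int)" for j
  have hp: "hp j \<in> G" for j unfolding hp_def using R.subgroup_int_pow_closed[OF G(1) h] .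
  have hp_add: "hp (i + j) x = hp i (hp j x)" for i j x
    unfolding hp_def by (rule HomeoR_int_pow_add[OF hC])
  have hp_cancel: "hp (- j) (hp j x) = x" for j x
    unfolding hp_def by (rule HomeoR_int_pow_cancel(2)[OF hC])
  let ?H = "twisted_lift E \<rho> h"
  let ?\<kappa> = "\<lambda>j \<sigma>. translation (of_int j) \<circ> interval_lift E \<sigma>"
  have \<kappa>_int: "?\<kappa> j \<sigma> (of_int i) = of_int (i + j)" for i j \<sigma>
    by (simp add: interval_lift_int translation_def)
  have \<kappa>_chart: "?\<kappa> j \<sigma> (of_int i + E x) = of_int (i + j) + E (\<sigma> x)" for i j \<sigma> x
    by (simp add: interval_lift_chart[OF E] translation_def)
  have H_chart: "?H (of_int j + E x) = of_int j + E (\<rho> (hp (- j) x))" for j x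
    unfolding hp_def by (rule twisted_lift_chart[OF E])
  \<comment> \<open>Passing from the interval at \<open>i\<close> to the one at \<open>i + j\<close> increases the twist; the surplus
    \<open>hp (- j)\<close> commutes past \<open>\<sigma>\<close> and is absorbed into it.\<close>
  have check: "?H (?\<kappa> j \<sigma> y) = ?\<kappa> j \<tau> (?H y)"
    if \<sigma>: "\<sigma> \<in> G" and eq: "\<And>x. \<rho> (hp (- j) (\<sigma> x)) = \<tau> (\<rho> x)" for j \<sigma> \<tau> y
  proof (rule unit_chart_cases[OF E, of y])
    fix i assume "y = of_int i"
    then show ?thesis by (simp only: \<kappa>_int twisted_lift_int)
  next
    fix i x assume y: "y = of_int i + E x"
    have "hp (- (i + j)) (\<sigma> x) = hp (- j) (\<sigma> (hp (- i) x))"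
      using hp_add[of "- j" "- i" "\<sigma> x"] comm[OF hp \<sigma>] by (simp add: add.commute)
    then show ?thesis unfolding y by (simp only: \<kappa>_chart H_chart eq)
  qed
  have K: "line_extension E G \<subseteq> carrier HomeoR" "line_extension E G' \<subseteq> carrier HomeoR"
    using subgroup_line_extension[OF E] G subgroup.subset by blast+
  have HC: "?H \<in> carrier HomeoR" by (rule twisted_lift_HomeoR[OF E \<rho>(1) hC])
  show ?thesis
    unfolding intertwines_HomeoR_iff[OF HC K]
  proof (intro conjI ballI)
    fix \<kappa> assume "\<kappa> \<in> line_extension E G"
    then obtain j \<sigma> where \<sigma>: "\<sigma> \<in> G" and \<kappa>: "\<kappa> = ?\<kappa> j \<sigma>" unfolding line_extension_eq[OF E G(1)] by blast
    have "hp (- j) \<circ> \<sigma> \<in> G" using hp \<sigma> G(1) by (simp add: subgroup_HomeoR_iff)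
    then obtain \<tau> where \<tau>: "\<tau> \<in> G'" "\<And>x. \<rho> ((hp (- j) \<circ> \<sigma>) x) = \<tau> (\<rho> x)"
      using \<rho>(2) unfolding intertwines_HomeoR_iff[OF \<rho>(1) GC] by blast
    have "?H (\<kappa> x) = ?\<kappa> j \<tau> (?H x)" for x unfolding \<kappa> using \<tau>(2) by (intro check[OF \<sigma>]) simp
    moreover have "?\<kappa> j \<tau> \<in> line_extension E G'" unfolding line_extension_eq[OF E G(2)] using \<tau>(1) by blast
    ultimately show "\<exists>\<kappa>'\<in>line_extension E G'. \<forall>x. ?H (\<kappa> x) = \<kappa>' (?H x)" by blast
  next
    fix \<kappa>' assume "\<kappa>' \<in> line_extension E G'"
    then obtain j \<tau> where \<tau>: "\<tau> \<in> G'" and \<kappa>': "\<kappa>' = ?\<kappa> j \<tau>" unfolding line_extension_eq[OF E G(2)] by blast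
    obtain \<sigma> where \<sigma>: "\<sigma> \<in> G" "\<And>x. \<rho> (\<sigma> x) = \<tau> (\<rho> x)"
      using \<rho>(2) \<tau> unfolding intertwines_HomeoR_iff[OF \<rho>(1) GC] by blast
    have in_G: "hp j \<circ> \<sigma> \<in> G" using hp \<sigma> G(1) by (simp add: subgroup_HomeoR_iff)
    have "?H (?\<kappa> j (hp j \<circ> \<sigma>) x) = \<kappa>' (?H x)" for x
      unfolding \<kappa>' using \<sigma>(2) by (intro check[OF in_G]) (simp add: hp_cancel)
    moreover have "?\<kappa> j (hp j \<circ> \<sigma>) \<in> line_extension E G" unfolding line_extension_eq[OF E G(1)] using in_G by blast
    ultimately show "\<exists>\<kappa>\<in>line_extension E G. \<forall>x. ?H (\<kappa> x) = \<kappa>' (?H x)" by blast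
  qed
qed

section \<open>The conjugacy classification\<close>

lemma (in group) conjugates_eq_iff:
  assumes "\<psi> \<in> carrier G" "\<rho> \<in> carrier G" "a \<in> carrier G" "b \<in> carrier G"
  shows "\<psi> \<otimes> a \<otimes> inv \<psi> = (\<psi> \<otimes> \<rho>) \<otimes> b \<otimes> inv (\<psi> \<otimes> \<rho>) \<longleftrightarrow> a \<otimes> \<rho> = \<rho> \<otimes> b"
proof -
  have cancel: "\<psi> \<otimes> a \<otimes> inv \<psi> = \<psi> \<otimes> c \<otimes> inv \<psi> \<longleftrightarrow> a = c" if "c \<in> carrier G" for c
    using assms that by simp
  have "(\<psi> \<otimes> \<rho>) \<otimes> b \<otimes> inv (\<psi> \<otimes> \<rho>) = \<psi> \<otimes> (\<rho> \<otimes> b \<otimes> inv \<rho>) \<otimes> inv \<psi>"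
    using assms by (simp add: inv_mult_group m_assoc)
  then have "\<psi> \<otimes> a \<otimes> inv \<psi> = (\<psi> \<otimes> \<rho>) \<otimes> b \<otimes> inv (\<psi> \<otimes> \<rho>) \<longleftrightarrow> a = \<rho> \<otimes> b \<otimes> inv \<rho>"
    using assms by (simp only: cancel m_closed inv_closed)
  then show ?thesis using assms inv_solve_right[of a "\<rho> \<otimes> b" \<rho>] by auto
qed

lemma (in group) normalizer_iff_intertwines:
  assumes "A \<subseteq> carrier G"
  shows "\<phi> \<in> normalizer G A \<longleftrightarrow> \<phi> \<in> carrier G \<and> intertwines G \<phi> A A"
  using conjugate_eq_iff_intertwines[OF _ assms assms, of \<phi>] assms
  by (auto simp: normalizer_def stabilizer_def)

lemma (in group) intertwine_pow:
  assumes "\<rho> \<in> carrier G" "a \<in> carrier G" "b \<in> carrier G" "\<rho> \<otimes> a = b \<otimes> \<rho>"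
  shows "\<rho> \<otimes> a [^] (m :: nat) = b [^] m \<otimes> \<rho>"
proof (induction m)
  case 0
  then show ?case using assms by simp
next
  case (Suc m)
  have "\<rho> \<otimes> a [^] Suc m = (\<rho> \<otimes> a [^] m) \<otimes> a" using assms by (simp add: m_assoc)
  also have "\<dots> = b [^] m \<otimes> (\<rho> \<otimes> a)" using assms by (simp add: Suc.IH m_assoc)
  also have "\<dots> = b [^] Suc m \<otimes> \<rho>" using assms by (simp add: m_assoc)
  finally show ?case .
qed

text \<open>The \<open>k\<close>-th powers in the affine action come from here. The conjugate of the unit
  translation is the unit translation composed with the lift of some \<open>h' \<in> G'\<close>, and the deck
  transformation contains the \<open>k\<close>-th power of the unit translation. The exponents \<open>k\<close> and \<open>k'\<close>
  are visible as the amounts by which the deck transformations move the integers. The \<open>h\<close> of the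
  conclusion is the inverse of \<open>h'\<close> transported to \<open>G\<close>.\<close>

lemma deck_conjugacy_necessary:
  assumes E: "unit_chart E" "unit_chart E'" and orient: "\<And>x y. E x < E y \<longleftrightarrow> E' x < E' y"
    and G: "subgroup G HomeoR" "subgroup G' HomeoR"
    and T: "translation 1 \<in> G" "translation 1 \<in> G'" and g: "g \<in> G" "g' \<in> G'"
    and H: "H \<in> carrier HomeoR" "intertwines HomeoR H (line_extension E G) (line_extension E' G')"
    and deck: "\<And>x. H ((translation (of_int (int k)) \<circ> interval_lift E (inv\<^bsub>HomeoR\<^esub> g)) x)
      = (translation (of_int (int k')) \<circ> interval_lift E' (inv\<^bsub>HomeoR\<^esub> g')) (H x)"
  obtains \<rho> h where "k = k'" "\<rho> \<in> carrier HomeoR" "intertwines HomeoR \<rho> G G'" "h \<in> G"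
    "g' \<otimes>\<^bsub>HomeoR\<^esub> \<rho> = \<rho> \<otimes>\<^bsub>HomeoR\<^esub> (g \<otimes>\<^bsub>HomeoR\<^esub> h [^]\<^bsub>HomeoR\<^esub> k)"
proof -
  have GC: "G \<subseteq> carrier HomeoR" "G' \<subseteq> carrier HomeoR" using G subgroup.subset by blast+
  have gC: "g \<in> carrier HomeoR" "g' \<in> carrier HomeoR" using g GC by blast+
  have K: "line_extension E G \<subseteq> carrier HomeoR" "line_extension E' G' \<subseteq> carrier HomeoR"
    using subgroup_line_extension E G subgroup.subset by blast+
  obtain \<rho> m where \<rho>: "\<rho> \<in> carrier HomeoR" "intertwines HomeoR \<rho> G G'"
    and H_int: "\<And>i. H (of_int i) = of_int (i + m)" and H_chart: "\<And>x. H (E x) = of_int m + E' (\<rho> x)"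
    by (rule extension_rigidity[OF E orient G T H]) (rule that)
  have H0: "H 0 = of_int m" using H_int[of 0] by simp
  have "H (of_int (int k)) = of_int m + of_int (int k')"
    using deck[of 0] by (simp add: H0 interval_lift_0 interval_lift_int translation_def)
  then have k_eq: "k = k'" unfolding H_int by simp
  have "translation 1 \<in> line_extension E G" unfolding line_extension_def by (auto intro: generate.incl)
  then obtain \<tau> where "\<tau> \<in> line_extension E' G'" and \<tau>: "\<And>x. H (translation 1 x) = \<tau> (H x)"
    using H(2) unfolding intertwines_HomeoR_iff[OF H(1) K] by blast
  then obtain j h' where h': "h' \<in> G'" and \<tau>_eq: "\<tau> = translation (of_int j) \<circ> interval_lift E' h'"
    unfolding line_extension_eq[OF E(2) G(2)] by blast
  have "j = 1"
    using \<tau>[of 0] H_int[of 1] by (simp add: \<tau>_eq H0 interval_lift_int translation_def)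
  then have H_Suc: "H (x + 1) = interval_lift E' h' (H x) + 1" for x
    using \<tau>[of x] by (simp add: \<tau>_eq translation_def)
  have h'C: "h' \<in> carrier HomeoR" using h' GC by blast
  have H_add: "H (real p + E y) = of_int (int p + m) + E' ((h' [^]\<^bsub>HomeoR\<^esub> p) (\<rho> y))" for p y
  proof (induction p)
    case 0
    then show ?case by (simp add: H_chart HomeoR_one)
  next
    case (Suc p)
    have "(h' [^]\<^bsub>HomeoR\<^esub> Suc p) z = h' ((h' [^]\<^bsub>HomeoR\<^esub> p) z)" for z
    proof -
      have "h' [^]\<^bsub>HomeoR\<^esub> Suc p = h' \<otimes>\<^bsub>HomeoR\<^esub> h' [^]\<^bsub>HomeoR\<^esub> p" by (rule R.nat_pow_Suc2[OF h'C])
      then show ?thesis using h'C by (simp add: HomeoR_mult del: R.nat_pow_Suc)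
    qed
    moreover have "real (Suc p) + E y = (real p + E y) + 1" by simp
    ultimately show ?case
      by (simp only: H_Suc Suc.IH interval_lift_chart[OF E(2)])
  qed
  \<comment> \<open>Both sides of the deck equation at \<open>E (g y)\<close>, where the inverse of \<open>g\<close> cancels.\<close>
  have key: "(h' [^]\<^bsub>HomeoR\<^esub> k) (\<rho> y) = (inv\<^bsub>HomeoR\<^esub> g') (\<rho> (g y))" for y
  proof -
    have "H (real k + E y) = of_int m + E' ((inv\<^bsub>HomeoR\<^esub> g') (\<rho> (g y))) + real k"
      using deck[of "E (g y)"] gC
      by (simp add: translation_def interval_lift_chart_0[OF E(1)] interval_lift_chart[OF E(2)] H_chart
          HomeoR_inv_apply add.commute k_eq)
    then show ?thesis unfolding H_add by (simp add: unit_chart_eq[OF E(2)])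
  qed
  have "inv\<^bsub>HomeoR\<^esub> h' \<in> G'" using subgroup.m_inv_closed[OF G(2) h'] .
  then obtain h where h: "h \<in> G" "\<rho> \<otimes>\<^bsub>HomeoR\<^esub> h = inv\<^bsub>HomeoR\<^esub> h' \<otimes>\<^bsub>HomeoR\<^esub> \<rho>"
    using \<rho>(2) unfolding intertwines_def by blast
  have hC: "h \<in> carrier HomeoR" using h GC by blast
  have "\<rho> \<otimes>\<^bsub>HomeoR\<^esub> h [^]\<^bsub>HomeoR\<^esub> k = (inv\<^bsub>HomeoR\<^esub> h') [^]\<^bsub>HomeoR\<^esub> k \<otimes>\<^bsub>HomeoR\<^esub> \<rho>"
    using h'C by (intro R.intertwine_pow[OF \<rho>(1) hC _ h(2)]) simp
  also have "\<dots> = inv\<^bsub>HomeoR\<^esub> (h' [^]\<^bsub>HomeoR\<^esub> k) \<otimes>\<^bsub>HomeoR\<^esub> \<rho>" using R.nat_pow_inv[OF h'C] by simp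
  finally have "\<rho> \<circ> h [^]\<^bsub>HomeoR\<^esub> k = inv\<^bsub>HomeoR\<^esub> (h' [^]\<^bsub>HomeoR\<^esub> k) \<circ> \<rho>"
    using \<rho>(1) hC h'C by (simp add: HomeoR_mult)
  then have \<rho>h: "\<rho> ((h [^]\<^bsub>HomeoR\<^esub> k) y) = (inv\<^bsub>HomeoR\<^esub> (h' [^]\<^bsub>HomeoR\<^esub> k)) (\<rho> y)" for y by (metis comp_apply)
  have "g' (\<rho> y) = \<rho> (g ((h [^]\<^bsub>HomeoR\<^esub> k) y))" for y
  proof -
    have "(h' [^]\<^bsub>HomeoR\<^esub> k) (\<rho> ((h [^]\<^bsub>HomeoR\<^esub> k) y)) = \<rho> y"
      using h'C by (simp add: \<rho>h HomeoR_inv_apply)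
    then have "g' (\<rho> y) = g' ((inv\<^bsub>HomeoR\<^esub> g') (\<rho> (g ((h [^]\<^bsub>HomeoR\<^esub> k) y))))" by (simp only: key)
    then show ?thesis by (simp add: HomeoR_inv_apply gC)
  qed
  then have "g' \<otimes>\<^bsub>HomeoR\<^esub> \<rho> = \<rho> \<otimes>\<^bsub>HomeoR\<^esub> (g \<otimes>\<^bsub>HomeoR\<^esub> h [^]\<^bsub>HomeoR\<^esub> k)"
    using \<rho>(1) hC gC HomeoR_comp by (simp add: HomeoR_mult fun_eq_iff)
  then show ?thesis using that k_eq \<rho> h(1) by blast
qed

text \<open>Over one turn the twist of \<open>twisted_lift\<close> changes by the factor \<open>h ^ k\<close>, by which \<open>g'\<close> and the
  conjugate of \<open>g\<close> differ.\<close>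

lemma deck_conjugacy_sufficient:
  assumes E: "unit_chart E" and G: "subgroup G HomeoR" "subgroup G' HomeoR"
    and comm: "\<And>\<sigma> \<tau> x. \<sigma> \<in> G \<Longrightarrow> \<tau> \<in> G \<Longrightarrow> \<sigma> (\<tau> x) = \<tau> (\<sigma> x)"
    and g: "g \<in> G" "g' \<in> G'" and h: "h \<in> G"
    and \<rho>: "\<rho> \<in> carrier HomeoR" "intertwines HomeoR \<rho> G G'"
    and eq: "g' \<otimes>\<^bsub>HomeoR\<^esub> \<rho> = \<rho> \<otimes>\<^bsub>HomeoR\<^esub> (g \<otimes>\<^bsub>HomeoR\<^esub> h [^]\<^bsub>HomeoR\<^esub> k)"
  shows "twisted_lift E \<rho> h ((translation (of_int (int k)) \<circ> interval_lift E (inv\<^bsub>HomeoR\<^esub> g)) x)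
      = (translation (of_int (int k)) \<circ> interval_lift E (inv\<^bsub>HomeoR\<^esub> g')) (twisted_lift E \<rho> h x)"
proof (rule unit_chart_cases[OF E, of x])
  fix j assume "x = of_int j"
  then show ?thesis
    using twisted_lift_int[of E \<rho> h "j + int k"] by (simp add: twisted_lift_int interval_lift_int translation_def)
next
  fix j y assume x: "x = of_int j + E y"
  have GC: "G \<subseteq> carrier HomeoR" "G' \<subseteq> carrier HomeoR" using G subgroup.subset by blast+
  have C: "g \<in> carrier HomeoR" "g' \<in> carrier HomeoR" "h \<in> carrier HomeoR" using g h GC by blast+
  define hp where "hp i = h [^]\<^bsub>HomeoR\<^esub> (i :: int)" for i
  have hp: "hp i \<in> G" for i unfolding hp_def using R.subgroup_int_pow_closed[OF G(1) h] .
  have hp_add: "hp (i + l) z = hp i (hp l z)" for i l z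
    unfolding hp_def by (rule HomeoR_int_pow_add[OF C(3)])
  have eq': "g' (\<rho> z) = \<rho> (g (hp (int k) z))" for z
  proof -
    have "g' \<circ> \<rho> = \<rho> \<circ> (g \<circ> h [^]\<^bsub>HomeoR\<^esub> k)"
      using eq \<rho>(1) C HomeoR_comp by (simp add: HomeoR_mult)
    then show ?thesis unfolding hp_def int_pow_int by (metis comp_apply)
  qed
  define w where "w = hp (- (j + int k)) ((inv\<^bsub>HomeoR\<^esub> g) y)"
  have "g (hp (int k) w) = hp (- j) (g ((inv\<^bsub>HomeoR\<^esub> g) y))"
    unfolding w_def using comm[OF g(1) hp] by (simp flip: hp_add)
  then have "g' (\<rho> w) = \<rho> (hp (- j) y)" by (simp add: eq' HomeoR_inv_apply C)
  then have w: "\<rho> w = (inv\<^bsub>HomeoR\<^esub> g') (\<rho> (hp (- j) y))" using HomeoR_inv_apply(2)[OF C(2)] by metis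
  have "twisted_lift E \<rho> h ((translation (of_int (int k)) \<circ> interval_lift E (inv\<^bsub>HomeoR\<^esub> g)) x)
      = twisted_lift E \<rho> h (of_int (j + int k) + E ((inv\<^bsub>HomeoR\<^esub> g) y))"
    by (simp only: x comp_apply interval_lift_chart[OF E] translation_def) (simp add: add_ac)
  also have "\<dots> = of_int (j + int k) + E (\<rho> w)"
    unfolding twisted_lift_chart[OF E] w_def hp_def ..
  also have "\<dots> = (translation (of_int (int k)) \<circ> interval_lift E (inv\<^bsub>HomeoR\<^esub> g')) (twisted_lift E \<rho> h x)"
    unfolding x twisted_lift_chart[OF E] w hp_def by (simp add: interval_lift_chart[OF E] translation_def)
  finally show ?thesis .
qed

theorem theorem6p4:
  fixes \<eta> :: "real \<Rightarrow> real"
    and \<phi> :: "nat \<Rightarrow> real \<Rightarrow> complex"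
    and n n' k k' :: nat
    and \<alpha> \<alpha>' :: real
    and g g' \<psi> :: "real \<Rightarrow> real"
    and f f' :: "complex \<Rightarrow> complex"
  assumes "\<exists>\<eta>'. homeomorphism UNIV {0<..<1} \<eta> \<eta>'"
    and "\<And>k. k \<ge> 1 \<Longrightarrow> arc_chart k (\<phi> k)"
    and "n \<ge> 2" and "n' \<ge> 2" and "k \<ge> 1" and "k' \<ge> 1"
    and "\<alpha> \<in> {0<..<1}" and "\<alpha> \<notin> \<rat>"
    and "\<alpha>' \<in> {0<..<1}" and "\<alpha>' \<notin> \<rat>"
    and "admissible k (line_group \<eta> \<alpha> n) g"
    and "admissible k' (line_group \<eta> \<alpha>' n') g'"
    and "f \<in> circle_roots (\<phi> k) k g"
    and "f' \<in> circle_roots (\<phi> k') k' g'"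
    and "n = n' \<and> k = k' \<and> equivalent_irrationals \<alpha> \<alpha>' \<Longrightarrow>
      \<psi> \<in> carrier HomeoR \<and>
      line_group \<eta> \<alpha> n = \<psi> <#\<^bsub>HomeoR\<^esub> line_group \<eta> \<alpha>' n #>\<^bsub>HomeoR\<^esub> inv\<^bsub>HomeoR\<^esub> \<psi>"
  shows "topologically_conjugate
      (circle_group \<eta> (\<phi> k) \<alpha> n k f) (circle_group \<eta> (\<phi> k') \<alpha>' n' k' f')
    \<longleftrightarrow>
      (n = n' \<and> k = k') \<and>
      equivalent_irrationals \<alpha> \<alpha>' \<and>
      \<psi> \<otimes>\<^bsub>HomeoR\<^esub> g' \<otimes>\<^bsub>HomeoR\<^esub> inv\<^bsub>HomeoR\<^esub> \<psi>
        \<in> orbit (affine_group (line_group \<eta> \<alpha> n) k) affine_act g"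
proof -
  let ?G = "line_group \<eta> \<alpha> n" and ?G' = "line_group \<eta> \<alpha>' n'"
  have \<eta>: "unit_chart \<eta>" using assms(1) by (simp add: unit_chart_def)
  have G: "subgroup ?G HomeoR" "subgroup ?G' HomeoR" using line_group_subgroup[OF \<eta>] by blast+
  have GC: "?G \<subseteq> carrier HomeoR" "?G' \<subseteq> carrier HomeoR" using G subgroup.subset by blast+
  have T: "translation 1 \<in> ?G" "translation 1 \<in> ?G'"
    using translation_1_in_line_group assms(3,4) by blast+
  have g: "g \<in> ?G" "g' \<in> ?G'" using assms(11,12) by (auto simp: admissible_def)
  have gC: "g \<in> carrier HomeoR" "g' \<in> carrier HomeoR" using g GC by blast+
  obtain E where E: "unit_chart E" "strict_mono E" "\<And>t. \<phi> k t = mark k (E t)"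
    using arc_chart_unit_chart[OF assms(5) assms(2)[OF assms(5)]] by blast
  obtain E' where E': "unit_chart E'" "strict_mono E'" "\<And>t. \<phi> k' t = mark k' (E' t)"
    using arc_chart_unit_chart[OF assms(6) assms(2)[OF assms(6)]] by blast
  have root: "circle_root (\<phi> k) k f g ?G E"
    by (intro circle_root.intro assms(5) E(1,3) assms(13) G(1) g(1) line_group_commute[OF \<eta> assms(3) _ g(1)])
  have root': "circle_root (\<phi> k') k' f' g' ?G' e"
    if "unit_chart e" "\<And>t. \<phi> k' t = mark k' (e t)" for e
    by (intro circle_root.intro assms(6) that assms(14) G(2) g(2) line_group_commute[OF \<eta> assms(4) _ g(2)])
  note cover = circle_root.covers_circle_group[OF root, folded circle_group_def]
  note cover' = circle_root.covers_circle_group[OF root', folded circle_group_def]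
  note D = circle_root.D_def[OF root]
  note D' = circle_root.D_def[OF root']
  have \<psi>: "\<psi> \<in> carrier HomeoR \<and> intertwines HomeoR \<psi> ?G' ?G"
    if "n = n' \<and> k = k' \<and> equivalent_irrationals \<alpha> \<alpha>'"
    using assms(15)[OF that] R.conjugate_eq_iff_intertwines[OF _ GC(2,1), of \<psi>] that by auto
  show ?thesis
  proof
    assume "topologically_conjugate (circle_group \<eta> (\<phi> k) \<alpha> n k f) (circle_group \<eta> (\<phi> k') \<alpha>' n' k' f')"
    then obtain H where H: "H \<in> carrier HomeoR" "intertwines HomeoR H (line_extension E ?G) (line_extension E' ?G')"
      and deck: "\<And>x. H (circle_root.D k g E x) = circle_root.D k' g' E' (H x)"
      using topologically_conjugate_iff_covers[OF cover cover'[OF E'(1,3)]] by blast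
    have orient: "E x < E y \<longleftrightarrow> E' x < E' y" for x y using E(2) E'(2) by (simp add: strict_mono_less)
    obtain \<rho> h where kk: "k = k'" and \<rho>: "\<rho> \<in> carrier HomeoR" "intertwines HomeoR \<rho> ?G ?G'" and h: "h \<in> ?G"
      and eq: "g' \<otimes>\<^bsub>HomeoR\<^esub> \<rho> = \<rho> \<otimes>\<^bsub>HomeoR\<^esub> (g \<otimes>\<^bsub>HomeoR\<^esub> h [^]\<^bsub>HomeoR\<^esub> k)"
      using deck_conjugacy_necessary[OF E(1) E'(1) orient G T g H deck[unfolded D D'[OF E'(1,3)]]] .
    have ne: "n = n' \<and> equivalent_irrationals \<alpha> \<alpha>'"
      by (rule line_group_rigidity[OF \<eta> assms(8,10,3,4) \<rho>])
    then have \<psi>': "\<psi> \<in> carrier HomeoR" "intertwines HomeoR \<psi> ?G' ?G" using \<psi> kk by blast+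
    have "\<psi> \<otimes>\<^bsub>HomeoR\<^esub> \<rho> \<in> normalizer HomeoR ?G"
      unfolding R.normalizer_iff_intertwines[OF GC(1)]
      using R.intertwines_mult[OF \<rho>(2) \<psi>'(2) \<rho>(1) \<psi>'(1) GC(1,2,1)] \<rho>(1) \<psi>'(1) by blast
    moreover have "g \<otimes>\<^bsub>HomeoR\<^esub> h [^]\<^bsub>HomeoR\<^esub> k \<in> carrier HomeoR"
      using h GC gC(1) by (intro R.m_closed R.nat_pow_closed) auto
    then have "\<psi> \<otimes>\<^bsub>HomeoR\<^esub> g' \<otimes>\<^bsub>HomeoR\<^esub> inv\<^bsub>HomeoR\<^esub> \<psi> = (\<psi> \<otimes>\<^bsub>HomeoR\<^esub> \<rho>) \<otimes>\<^bsub>HomeoR\<^esub>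
        (g \<otimes>\<^bsub>HomeoR\<^esub> h [^]\<^bsub>HomeoR\<^esub> k) \<otimes>\<^bsub>HomeoR\<^esub> inv\<^bsub>HomeoR\<^esub> (\<psi> \<otimes>\<^bsub>HomeoR\<^esub> \<rho>)"
      by (rule R.conjugates_eq_iff[OF \<psi>'(1) \<rho>(1) gC(2), THEN iffD2, OF _ eq])
    ultimately have "\<psi> \<otimes>\<^bsub>HomeoR\<^esub> g' \<otimes>\<^bsub>HomeoR\<^esub> inv\<^bsub>HomeoR\<^esub> \<psi> \<in> orbit (affine_group ?G k) affine_act g"
      unfolding affine_orbit_iff[OF G(1) g(1)] using h by (intro bexI)
    then show "(n = n' \<and> k = k') \<and> equivalent_irrationals \<alpha> \<alpha>' \<and>
        \<psi> \<otimes>\<^bsub>HomeoR\<^esub> g' \<otimes>\<^bsub>HomeoR\<^esub> inv\<^bsub>HomeoR\<^esub> \<psi> \<in> orbit (affine_group ?G k) affine_act g"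
      using ne kk by blast
  next
    assume R: "(n = n' \<and> k = k') \<and> equivalent_irrationals \<alpha> \<alpha>' \<and>
        \<psi> \<otimes>\<^bsub>HomeoR\<^esub> g' \<otimes>\<^bsub>HomeoR\<^esub> inv\<^bsub>HomeoR\<^esub> \<psi> \<in> orbit (affine_group ?G k) affine_act g"
    then have kk: "k = k'" by blast
    have \<psi>': "\<psi> \<in> carrier HomeoR" "intertwines HomeoR \<psi> ?G' ?G" using \<psi> R by blast+
    obtain \<mu> h where \<mu>: "\<mu> \<in> normalizer HomeoR ?G" and h: "h \<in> ?G"
      and eq: "\<psi> \<otimes>\<^bsub>HomeoR\<^esub> g' \<otimes>\<^bsub>HomeoR\<^esub> inv\<^bsub>HomeoR\<^esub> \<psi>
        = \<mu> \<otimes>\<^bsub>HomeoR\<^esub> (g \<otimes>\<^bsub>HomeoR\<^esub> h [^]\<^bsub>HomeoR\<^esub> k) \<otimes>\<^bsub>HomeoR\<^esub> inv\<^bsub>HomeoR\<^esub> \<mu>"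
      using R unfolding affine_orbit_iff[OF G(1) g(1)] by blast
    have \<mu>': "\<mu> \<in> carrier HomeoR" "intertwines HomeoR \<mu> ?G ?G"
      using \<mu> unfolding R.normalizer_iff_intertwines[OF GC(1)] by blast+
    define \<rho> where "\<rho> = inv\<^bsub>HomeoR\<^esub> \<psi> \<otimes>\<^bsub>HomeoR\<^esub> \<mu>"
    have \<rho>: "\<rho> \<in> carrier HomeoR" using \<psi>'(1) \<mu>'(1) by (simp add: \<rho>_def)
    have \<mu>_eq: "\<mu> = \<psi> \<otimes>\<^bsub>HomeoR\<^esub> \<rho>" using \<psi>'(1) \<mu>'(1) by (simp add: \<rho>_def R.m_assoc[symmetric])
    have "intertwines HomeoR (inv\<^bsub>HomeoR\<^esub> \<psi>) ?G ?G'"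
      by (rule R.intertwines_inv[OF \<psi>'(2,1) GC(2,1)])
    then have \<rho>_inter: "intertwines HomeoR \<rho> ?G ?G'"
      unfolding \<rho>_def by (rule R.intertwines_mult[OF \<mu>'(2) _ \<mu>'(1) R.inv_closed[OF \<psi>'(1)] GC(1,1,2)])
    have hC: "h \<in> carrier HomeoR" using h GC by blast
    have "g \<otimes>\<^bsub>HomeoR\<^esub> h [^]\<^bsub>HomeoR\<^esub> k \<in> carrier HomeoR" using gC(1) hC by simp
    then have eq': "g' \<otimes>\<^bsub>HomeoR\<^esub> \<rho> = \<rho> \<otimes>\<^bsub>HomeoR\<^esub> (g \<otimes>\<^bsub>HomeoR\<^esub> h [^]\<^bsub>HomeoR\<^esub> k)"
      by (rule R.conjugates_eq_iff[OF \<psi>'(1) \<rho> gC(2), THEN iffD1, OF _ eq[unfolded \<mu>_eq]])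
    have chart: "\<phi> k' t = mark k' (E t)" for t using E(3) kk by simp
    let ?H = "twisted_lift E \<rho> h"
    have D_E: "circle_root.D k' g' E = translation (of_int (int k)) \<circ> interval_lift E (inv\<^bsub>HomeoR\<^esub> g')"
      using D'[OF E(1) chart] kk by simp
    have comm: "\<sigma> (\<tau> x) = \<tau> (\<sigma> x)" if "\<sigma> \<in> ?G" "\<tau> \<in> ?G" for \<sigma> \<tau> x
      by (rule line_group_commute[OF \<eta> assms(3) that])
    have "?H (circle_root.D k g E x) = circle_root.D k' g' E (?H x)" for x
      unfolding D D_E
      by (rule deck_conjugacy_sufficient[OF E(1) G _ g h \<rho> \<rho>_inter eq']) (use comm in blast)
    moreover have "intertwines HomeoR ?H (line_extension E ?G) (line_extension E ?G')"
      
      by (rule twisted_lift_intertwines[OF E(1) G _ \<rho> \<rho>_inter h]) (use comm in blast)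
    moreover have "?H \<in> carrier HomeoR" by (rule twisted_lift_HomeoR[OF E(1) \<rho> hC])
    ultimately show "topologically_conjugate (circle_group \<eta> (\<phi> k) \<alpha> n k f) (circle_group \<eta> (\<phi> k') \<alpha>' n' k' f')"
      unfolding topologically_conjugate_iff_covers[OF cover cover'[OF E(1) chart]] by blast
  qed
qed

end
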